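(* Let $1/3<\gamma_1<1/2$ and $\gamma_2>1/2$, let $x\in\mathcal P_{1,1}^{\gamma_1,\gamma_2}$ admit a geometric rough sheet $\mathbb X$ above it (as defined in the context), and let $\zeta$ be a field controlled by $x$, with derivative $\zeta^1$ and remainder $\mathbf r$ (as defined in the context). Then: (i) The increments $$\mathbf z=[\mathrm{id}-\Lambda_1\delta_1][\mathrm{id}-\Lambda_2\delta_2]\bigl(\zeta\,\mathbf x^{1;2}+\zeta^1\,\mathbf x^{11;0\cdot 2}\bigr),\qquad \hat{\mathbf z}=[\mathrm{id}-\Lambda_1\delta_1][\mathrm{id}-\Lambda_2\delta_2]\bigl(\zeta\,\mathbf x^{\hat 1;\hat 2}+\zeta^1\,\mathbf x^{1\hat 1;0\cdot\hat 2}\bigr)$$ are well defined in $\mathcal P_{2,2}^{\gamma_1,\gamma_2}$. (ii) Whenever $x$ is smooth, a geometric rough sheet above $x$ exists, given by the Riemann–Stieltjes iterated integrals of $x$; in this case $\mathbf z$ and $\hat{\mathbf z}$ coincide with the Riemann–Stieltjes integrals $$\mathbf z_{s_1s_2;t_1t_2}=\int_{s_1}^{s_2}\!\int_{t_1}^{t_2}\zeta_{\sigma;\tau}\,\partial_{12}x_{\sigma;\tau}\,d\tau\,d\sigma,\qquad \hat{\mathbf z}_{s_1s_2;t_1t_2}=\int_{s_1}^{s_2}\!\int_{t_1}^{t_2}\zeta_{\sigma;\tau}\,\partial_1x_{\sigma;\tau}\,\partial_2x_{\sigma;\tau}\,d\tau\,d\sigma .$$ (iii) Let $s_1<s_2$,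 $t_1<t_2$, and let $(\pi_n^1)_{n\ge1}$, $(\pi_n^2)_{n\ge1}$ be sequences of partitions $\{\sigma_i\}$ of $[s_1,s_2]$ and $\{\tau_j\}$ of $[t_1,t_2]$ whose meshes go to $0$ as $n\to\infty$. Then $$\lim_{n\to\infty}\sum_{\pi_n^1,\pi_n^2}\Bigl[\zeta_{\sigma_i;\tau_j}\,\mathbf x^{1;2}_{\sigma_i\sigma_{i+1};\tau_j\tau_{j+1}}+\zeta^1_{\sigma_i;\tau_j}\,\mathbf x^{11;0\cdot2}_{\sigma_i\sigma_{i+1};\tau_j\tau_{j+1}}\Bigr]=\mathbf z_{s_1s_2;t_1t_2},$$ $$\lim_{n\to\infty}\sum_{\pi_n^1,\pi_n^2}\Bigl[\zeta_{\sigma_i;\tau_j}\,\mathbf x^{\hat1;\hat2}_{\sigma_i\sigma_{i+1};\tau_j\tau_{j+1}}+\zeta^1_{\sigma_i;\tau_j}\,\mathbf x^{1\hat1;0\cdot\hat2}_{\sigma_i\sigma_{i+1};\tau_j\tau_{j+1}}\Bigr]=\hat{\mathbf z}_{s_1s_2;t_1t_2}.$$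
   Context: Fix $T>0$. **Increments.** $\mathcal P_{k,l}$ is the set of continuous $f:[0,T]^k\times[0,T]^l\to\mathbb R$, written $f_{s_1\cdots s_k;t_1\cdots t_l}$, vanishing whenever $s_i=s_{i+1}$ or $t_j=t_{j+1}$ for some $i$ or $j$. Increments are considered on ordered tuples $s_1\le s_2\le\cdots$, $t_1\le t_2\le\cdots$. The operator $\delta_1:\mathcal P_{k,l}\to\mathcal P_{k+1,l}$ acts on the $s$-variables: for $k=1$, $\delta_1f_{s_1s_2}=f_{s_2}-f_{s_1}$; for $k=2$, $\delta_1f_{s_1s_2s_3}=f_{s_1s_3}-f_{s_1s_2}-f_{s_2s_3}$. $\delta_2$ is the same operator on the $t$-variables, and $\delta=\delta_1\delta_2$; for $f\in\mathcal P_{1,1}$, $\delta f_{s_1s_2;t_1t_2}=f_{s_2;t_2}-f_{s_1;t_2}-f_{s_2;t_1}+f_{s_1;t_1}$. **Norms.** For $k,l\in\{2,3\}$, $f\in\mathcal P_{k,l}$: $\|f\|_{a;b}=\sup |f_{s_1\cdots s_k;t_1\cdots t_l}|/(|s_k-s_1|^a|t_l-t_1|^b)$, sup over strictly ordered tuples; $\mathcal P_{k,l}^{a,b}=\{f\in\mathcal P_{k,l}:\|f\|_{a;b}<\infty\}$. An exponent $*$ means that some exponent in $(0,1)$ works. For $r\in\mathcal P_{2,1}$, $r\in\mathcal P_{2,1}^{a,*}$ means $\sup_{s_1<s_2,t}|r_{s_1s_2;t}|/|s_2-s_1|^a<\infty$. For $f\in\mathcal P_{1,1}$, $\|f\|_{a,b}=\|\delta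 f\|_{a;b}+\sup_{t,\,s_1<s_2}\frac{|\delta_1f_{s_1s_2;t}|}{|s_2-s_1|^a}+\sup_{s,\,t_1<t_2}\frac{|\delta_2f_{s;t_1t_2}|}{|t_2-t_1|^b}$, and $\mathcal P_{1,1}^{a,b}=\{f\in\mathcal P_{1,1}:\|f\|_{a,b}<\infty\}$. **Products.** For $g\in\mathcal P_{n_1,n_2}$, $h\in\mathcal P_{m_1,m_2}$, $gh\in\mathcal P_{n_1+m_1-1,n_2+m_2-1}$ is $(gh)_{s_1\cdots;t_1\cdots}=g_{s_1\cdots s_{n_1};t_1\cdots t_{n_2}}\,h_{s_{n_1}\cdots s_{n_1+m_1-1};t_{n_2}\cdots t_{n_2+m_2-1}}$. E.g. $(\zeta\,\mathbf x^{1;2})_{s_1s_2;t_1t_2}=\zeta_{s_1;t_1}\mathbf x^{1;2}_{s_1s_2;t_1t_2}$. **Sewing maps.** In one variable, if $h_{sut}$ lies in the kernel of the one-parameter coboundary operator and $|h_{sut}|\le C|t-s|^\mu$ with $\mu>1$, then there is a unique $\Lambda h$ with $|(\Lambda h)_{st}|\le C'|t-s|^\mu$ and $(\Lambda h)_{st}-(\Lambda h)_{su}-(\Lambda h)_{ut}=h_{sut}$. $\Lambda_1$ (resp. $\Lambda_2$) is this map applied in the $s$-variables (resp. $t$-variables) with the other variables frozen, and $\Lambda=\Lambda_1\Lambda_2$. For $g\in\mathcal P_{2,2}$, the increment $[\mathrm{id}-\Lambda_1\delta_1][\mathrm{id}-\Lambda_2\delta_2]g=g-\Lambda_1\delta_1g-\Lambda_2\delta_2g+\Lambda\delta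 g$ is well defined as soon as $\delta_1g\in\mathcal P_{3,2}^{a,*}$, $\delta_2g\in\mathcal P_{2,3}^{*,b}$, $\delta g\in\mathcal P_{3,3}^{a,b}$ for some $a,b>1$. **Geometric rough sheet.** For smooth $x$ write $\partial_1x,\partial_2x,\partial_{12}x$ for its partial derivatives and define, for $s_1<s_2$, $t_1<t_2(<t_3)$ (with required regularity in brackets): - $\mathbf x^{1;0}=\delta_1x$ $[(\gamma_1,0)]$; $\mathbf x^{0;2}=\delta_2x$ $[(0,\gamma_2)]$; $\mathbf x^{11;00}=\frac12(\delta_1x)^2$ $[(2\gamma_1,0)]$; $\mathbf x^{00;22}=\frac12(\delta_2x)^2$ $[(0,2\gamma_2)]$; $\mathbf x^{1;2}=\delta x$ $[(\gamma_1,\gamma_2)]$; $\mathbf x^{\hat1;\hat2}_{s_1s_2;t_1t_2}=\int_{s_1}^{s_2}\int_{t_1}^{t_2}\partial_1x_{\sigma;\tau}\partial_2x_{\sigma;\tau}\,d\tau d\sigma$ $[(\gamma_1,\gamma_2)]$. - Writing $D^{12}x=\partial_{12}x$ and $D^{\hat1\hat2}x=\partial_1x\,\partial_2x$, for $(i,j)=(1,2)$ and $(i,j)=(\hat1,\hat2)$: $\mathbf x^{1i;0j}_{s_1s_2;t_1t_2}=\int_{s_1}^{s_2}\int_{t_1}^{t_2}\delta_1x_{s_1\sigma;\tau}\,D^{ij}x_{\sigma;\tau}\,d\tau d\sigma$ $[(2\gamma_1,\gamma_2)]$; $\mathbf x^{1i;0\cdot j}_{s_1s_2;t_1t_2}=\int_{s_1}^{s_2}\int_{t_1}^{t_2}\delta_1x_{s_1\sigma;t_1}\,D^{ij}x_{\sigma;\tau}\,d\tau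 d\sigma$ $[(2\gamma_1,\gamma_2)]$; $\mathbf x^{1i;2j}_{s_1s_2;t_1t_2}=\int_{s_1}^{s_2}\int_{t_1}^{t_2}\delta x_{s_1\sigma;t_1\tau}\,D^{ij}x_{\sigma;\tau}\,d\tau d\sigma$ $[(2\gamma_1,2\gamma_2)]$; $\mathbf x^{1i;2\cdot j}_{s_1s_2;t_1t_2t_3}=\int_{s_1}^{s_2}\int_{t_2}^{t_3}\delta x_{s_1\sigma;t_1t_2}\,D^{ij}x_{\sigma;\tau}\,d\tau d\sigma$ $[(2\gamma_1,2\gamma_2)$, an element of $\mathcal P_{2,3}]$. A field $x\in\mathcal P_{1,1}^{\gamma_1,\gamma_2}$ admits a geometric rough sheet $\mathbb X$ if there are smooth $x^n$ with $\|x-x^n\|_{\gamma_1,\gamma_2}\to0$ such that the increments $\mathbf x^{1;0}$, $\mathbf x^{0;2}$, $\mathbf x^{11;00}$, $\mathbf x^{00;22}$, $\mathbf x^{1;2}$, $\mathbf x^{\hat1;\hat2}$ and, for both $(i,j)=(1,2)$ and $(i,j)=(\hat1,\hat2)$, $\mathbf x^{1i;0j}$, $\mathbf x^{1i;0\cdot j}$, $\mathbf x^{1i;2j}$, $\mathbf x^{1i;2\cdot j}$, all built from $x^n$ in place of $x$, converge, each in the Hölder norm of its indicated regularity (an exponent $0$ meaning a supremum over the corresponding single variable); $\mathbb X$ is the collection of the limits, denoted by the same symbols. **Controlled field.** $\zeta\in\mathcal P_{1,1}^{\gamma_1,\gamma_2}$ is controlled by $x$ if there are $\zeta^1\in\mathcal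 P_{1,1}^{\gamma_1,\gamma_2}$ and $\mathbf r\in\mathcal P_{2,1}^{2\gamma_1,*}$ with $\delta_2\mathbf r\in\mathcal P_{2,2}^{2\gamma_1,\gamma_2}$ such that $\delta_1\zeta=\zeta^1\mathbf x^{1;0}+\mathbf r$ and $\delta\zeta=\zeta^1\mathbf x^{1;2}+\delta_2\zeta^1\,\mathbf x^{1;0}+\delta_2\mathbf r$. *)

theory Defs
  imports "HOL-Analysis.Analysis"
begin

text \<open>Tuples of time points are (nested) products of reals, flattened by \<open>entries\<close>; an increment in
  \<open>P_{k,l}\<close> is a function \<open>'s \<Rightarrow> 't \<Rightarrow> real\<close> with \<open>'s\<close> the type of real \<open>k\<close>-tuples and \<open>'t\<close> the type
  of real \<open>l\<close>-tuples.\<close>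

class tuple = topological_space +
  fixes entries :: "'a \<Rightarrow> real list"

instantiation real :: tuple
begin
definition entries_real :: "real \<Rightarrow> real list" where
  [simp]: "entries_real s = [s]"
instance ..
end

instantiation prod :: (tuple, tuple) tuple
begin
definition entries_prod :: "'a \<times> 'b \<Rightarrow> real list" where
  [simp]: "entries_prod p = entries (fst p) @ entries (snd p)"
instance ..
end

definition ordered_tuples :: "real \<Rightarrow> 'a::tuple set" where
  "ordered_tuples T = {s. sorted (entries s) \<and> set (entries s) \<subseteq> {0..T}}"

definition strict_tuples :: "real \<Rightarrow> 'a::tuple set" where
  "strict_tuples T = {s \<in> ordered_tuples T. sorted_wrt (<) (entries s)}"

definition width :: "'a::tuple \<Rightarrow> real" where
  "width s = last (entries s) - hd (entries s)"

lemma ordered_tuples_iff: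
  "(s1::real) \<in> ordered_tuples T \<longleftrightarrow> 0 \<le> s1 \<and> s1 \<le> T"
  "(s1::real, s2::real) \<in> ordered_tuples T \<longleftrightarrow> 0 \<le> s1 \<and> s1 \<le> s2 \<and> s2 \<le> T"
  "(s1::real, s2::real, s3::real) \<in> ordered_tuples T \<longleftrightarrow> 0 \<le> s1 \<and> s1 \<le> s2 \<and> s2 \<le> s3 \<and> s3 \<le> T"
  by (auto simp: ordered_tuples_def)

lemma strict_tuples_iff:
  "(s1::real) \<in> strict_tuples T \<longleftrightarrow> 0 \<le> s1 \<and> s1 \<le> T"
  "(s1::real, s2::real) \<in> strict_tuples T \<longleftrightarrow> 0 \<le> s1 \<and> s1 < s2 \<and> s2 \<le> T"
  "(s1::real, s2::real, s3::real) \<in> strict_tuples T \<longleftrightarrow> 0 \<le> s1 \<and> s1 < s2 \<and> s2 < s3 \<and> s3 \<le> T"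
  by (auto simp: strict_tuples_def ordered_tuples_def)

lemma width_simps:
  "width (s1::real, s2::real) = s2 - s1"
  "width (s1::real, s2::real, s3::real) = s3 - s1"
  by (auto simp: width_def)

text \<open>Increments are considered on ordered tuples only; an ordered tuple has two equal consecutive
  entries iff it is not strictly ordered.\<close>

definition incr :: "real \<Rightarrow> ('s::tuple \<Rightarrow> 't::tuple \<Rightarrow> real) set" where
  "incr T = {f. continuous_on (ordered_tuples T \<times> ordered_tuples T) (\<lambda>(s, t). f s t) \<and>
     (\<forall>s\<in>ordered_tuples T. \<forall>t\<in>ordered_tuples T. s \<notin> strict_tuples T \<or> t \<notin> strict_tuples T \<longrightarrow> f s t = 0)}"

text \<open>One-parameter operators are applied in the \<open>s\<close>-variables by \<open>on1\<close> and in the \<open>t\<close>-variables by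
  \<open>on2\<close>, the other variables being frozen.\<close>

definition on1 :: "(('a \<Rightarrow> real) \<Rightarrow> 'b \<Rightarrow> real) \<Rightarrow> ('a \<Rightarrow> 't \<Rightarrow> real) \<Rightarrow> 'b \<Rightarrow> 't \<Rightarrow> real" where
  "on1 L f = (\<lambda>s t. L (\<lambda>\<sigma>. f \<sigma> t) s)"

definition on2 :: "(('a \<Rightarrow> real) \<Rightarrow> 'b \<Rightarrow> real) \<Rightarrow> ('s \<Rightarrow> 'a \<Rightarrow> real) \<Rightarrow> 's \<Rightarrow> 'b \<Rightarrow> real" where
  "on2 L f = (\<lambda>s t. L (f s) t)"

definition cob :: "(real \<Rightarrow> real) \<Rightarrow> real \<times> real \<Rightarrow> real" where
  "cob f = (\<lambda>(s1, s2). f s2 - f s1)"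

definition cob' :: "(real \<times> real \<Rightarrow> real) \<Rightarrow> real \<times> real \<times> real \<Rightarrow> real" where
  "cob' f = (\<lambda>(s1, s2, s3). f (s1, s3) - f (s1, s2) - f (s2, s3))"

text \<open>The coboundaries \<open>\<delta>1\<close>, \<open>\<delta>2\<close> on one variable, and (primed) on two variables.\<close>

definition \<delta>1 :: "(real \<Rightarrow> 't \<Rightarrow> real) \<Rightarrow> real \<times> real \<Rightarrow> 't \<Rightarrow> real" where
  "\<delta>1 = on1 cob"

definition \<delta>2 :: "('s \<Rightarrow> real \<Rightarrow> real) \<Rightarrow> 's \<Rightarrow> real \<times> real \<Rightarrow> real" where
  "\<delta>2 = on2 cob"

definition \<delta> :: "(real \<Rightarrow> real \<Rightarrow> real) \<Rightarrow> real \<times> real \<Rightarrow> real \<times> real \<Rightarrow> real" where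
  "\<delta> f = \<delta>1 (\<delta>2 f)"

definition \<delta>1' :: "(real \<times> real \<Rightarrow> 't \<Rightarrow> real) \<Rightarrow> real \<times> real \<times> real \<Rightarrow> 't \<Rightarrow> real" where
  "\<delta>1' = on1 cob'"

definition \<delta>2' :: "('s \<Rightarrow> real \<times> real \<Rightarrow> real) \<Rightarrow> 's \<Rightarrow> real \<times> real \<times> real \<Rightarrow> real" where
  "\<delta>2' = on2 cob'"

definition \<delta>' ::
  "(real \<times> real \<Rightarrow> real \<times> real \<Rightarrow> real) \<Rightarrow> real \<times> real \<times> real \<Rightarrow> real \<times> real \<times> real \<Rightarrow> real" where
  "\<delta>' f = \<delta>1' (\<delta>2' f)"

text \<open>Hoelder norms, with values in \<^typ>\<open>ennreal\<close> so that an infinite supremum is not mistaken for a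
  real number. \<open>hnorm\<close> is meant for \<open>k, l \<in> {2,3}\<close>; \<open>hnorm1\<close> and \<open>hnorm2\<close> are the norms with regularity
  \<open>(a, 0)\<close> on \<open>P_{2,1}\<close> and \<open>(0, b)\<close> on \<open>P_{1,2}\<close>.\<close>

definition hnorm :: "real \<Rightarrow> real \<Rightarrow> real \<Rightarrow> ('s::tuple \<Rightarrow> 't::tuple \<Rightarrow> real) \<Rightarrow> ennreal" where
  "hnorm T a b f = (SUP (s, t) \<in> strict_tuples T \<times> strict_tuples T.
     ennreal (\<bar>f s t\<bar> / (width s powr a * width t powr b)))"

definition hnorm1 :: "real \<Rightarrow> real \<Rightarrow> (real \<times> real \<Rightarrow> real \<Rightarrow> real) \<Rightarrow> ennreal" where
  "hnorm1 T a f = (SUP (s, t) \<in> strict_tuples T \<times> {0..T}. ennreal (\<bar>f s t\<bar> / width s powr a))"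

definition hnorm2 :: "real \<Rightarrow> real \<Rightarrow> (real \<Rightarrow> real \<times> real \<Rightarrow> real) \<Rightarrow> ennreal" where
  "hnorm2 T b f = (SUP (s, t) \<in> {0..T} \<times> strict_tuples T. ennreal (\<bar>f s t\<bar> / width t powr b))"

definition field_norm :: "real \<Rightarrow> real \<Rightarrow> real \<Rightarrow> (real \<Rightarrow> real \<Rightarrow> real) \<Rightarrow> ennreal" where
  "field_norm T a b f = hnorm T a b (\<delta> f) + hnorm1 T a (\<delta>1 f) + hnorm2 T b (\<delta>2 f)"

definition holder :: "real \<Rightarrow> real \<Rightarrow> real \<Rightarrow> ('s::tuple \<Rightarrow> 't::tuple \<Rightarrow> real) set" where
  "holder T a b = {f \<in> incr T. hnorm T a b f < \<infinity>}"

definition holder1 :: "real \<Rightarrow> real \<Rightarrow> (real \<times> real \<Rightarrow> real \<Rightarrow> real) set" where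
  "holder1 T a = {f \<in> incr T. hnorm1 T a f < \<infinity>}"

definition holder2 :: "real \<Rightarrow> real \<Rightarrow> (real \<Rightarrow> real \<times> real \<Rightarrow> real) set" where
  "holder2 T b = {f \<in> incr T. hnorm2 T b f < \<infinity>}"

definition holder_field :: "real \<Rightarrow> real \<Rightarrow> real \<Rightarrow> (real \<Rightarrow> real \<Rightarrow> real) set" where
  "holder_field T a b = {f \<in> incr T. field_norm T a b f < \<infinity>}"

text \<open>\<open>F = \<Lambda>h\<close>. Uniqueness only concerns ordered pairs, so \<open>F\<close> is normalised to vanish elsewhere. That
  \<open>h\<close> lies in the kernel of the coboundary is implied by \<open>cob' F = h\<close>.\<close>

definition sews :: "real \<Rightarrow> (real \<times> real \<times> real \<Rightarrow> real) \<Rightarrow> (real \<times> real \<Rightarrow> real) \<Rightarrow> bool" where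
  "sews T h F \<longleftrightarrow>
     (\<exists>\<mu>>1. (\<exists>C. \<forall>s\<in>ordered_tuples T. \<bar>h s\<bar> \<le> C * width s powr \<mu>) \<and>
             (\<exists>C. \<forall>s\<in>ordered_tuples T. \<bar>F s\<bar> \<le> C * width s powr \<mu>)) \<and>
     (\<forall>s\<in>ordered_tuples T. cob' F s = h s) \<and>
     (\<forall>s. s \<notin> ordered_tuples T \<longrightarrow> F s = 0)"

definition sewing :: "real \<Rightarrow> (real \<times> real \<times> real \<Rightarrow> real) \<Rightarrow> real \<times> real \<Rightarrow> real" where
  "sewing T h = (THE F. sews T h F)"

definition \<Lambda>1 :: "real \<Rightarrow> (real \<times> real \<times> real \<Rightarrow> 't \<Rightarrow> real) \<Rightarrow> real \<times> real \<Rightarrow> 't \<Rightarrow> real" where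
  "\<Lambda>1 T = on1 (sewing T)"

definition \<Lambda>2 :: "real \<Rightarrow> ('s \<Rightarrow> real \<times> real \<times> real \<Rightarrow> real) \<Rightarrow> 's \<Rightarrow> real \<times> real \<Rightarrow> real" where
  "\<Lambda>2 T = on2 (sewing T)"

text \<open>\<open>h\<close> belongs to the domain of \<open>\<Lambda>1\<close>, resp. of \<open>\<Lambda>2\<close>.\<close>

definition sewable1 :: "real \<Rightarrow> (real \<times> real \<times> real \<Rightarrow> 't::tuple \<Rightarrow> real) \<Rightarrow> bool" where
  "sewable1 T h \<longleftrightarrow> (\<forall>t\<in>ordered_tuples T. \<exists>!F. sews T (\<lambda>s. h s t) F)"

definition sewable2 :: "real \<Rightarrow> ('s::tuple \<Rightarrow> real \<times> real \<times> real \<Rightarrow> real) \<Rightarrow> bool" where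
  "sewable2 T h \<longleftrightarrow> (\<forall>s\<in>ordered_tuples T. \<exists>!F. sews T (h s) F)"

text \<open>The increment \<open>[id - \<Lambda>1 \<delta>1][id - \<Lambda>2 \<delta>2] g\<close>, in expanded form.\<close>

definition sew2d ::
  "real \<Rightarrow> (real \<times> real \<Rightarrow> real \<times> real \<Rightarrow> real) \<Rightarrow> real \<times> real \<Rightarrow> real \<times> real \<Rightarrow> real" where
  "sew2d T g = (\<lambda>s t. g s t - \<Lambda>1 T (\<delta>1' g) s t - \<Lambda>2 T (\<delta>2' g) s t + \<Lambda>1 T (\<Lambda>2 T (\<delta>' g)) s t)"

text \<open>Every sewing map occurring in \<open>sew2d T g\<close> is applied inside its domain, and the regularity
  conditions which are meant to guarantee this hold. The exponents \<open>c\<close>, \<open>d\<close> stand for \<open>*\<close>.\<close>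

definition sew2d_well_defined :: "real \<Rightarrow> (real \<times> real \<Rightarrow> real \<times> real \<Rightarrow> real) \<Rightarrow> bool" where
  "sew2d_well_defined T g \<longleftrightarrow>
     (\<exists>a>1. \<exists>b>1.
        (\<exists>c. 0 < c \<and> c < 1 \<and> \<delta>1' g \<in> holder T a c) \<and>
        (\<exists>d. 0 < d \<and> d < 1 \<and> \<delta>2' g \<in> holder T d b) \<and>
        \<delta>' g \<in> holder T a b) \<and>
     sewable1 T (\<delta>1' g) \<and> sewable2 T (\<delta>2' g) \<and>
     sewable2 T (\<delta>' g) \<and> sewable1 T (\<Lambda>2 T (\<delta>' g))"

text \<open>Partial derivatives on the square, one-sided at its boundary. \<open>smooth\<close> means \<open>C^\<infinity>\<close> up to the
  boundary: \<open>D i j\<close> is the partial derivative of order \<open>i\<close> in \<open>s\<close> and \<open>j\<close> in \<open>t\<close>.\<close>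

definition pd1 :: "real \<Rightarrow> (real \<Rightarrow> real \<Rightarrow> real) \<Rightarrow> real \<Rightarrow> real \<Rightarrow> real" where
  "pd1 T f = (\<lambda>s t. vector_derivative (\<lambda>\<sigma>. f \<sigma> t) (at s within {0..T}))"

definition pd2 :: "real \<Rightarrow> (real \<Rightarrow> real \<Rightarrow> real) \<Rightarrow> real \<Rightarrow> real \<Rightarrow> real" where
  "pd2 T f = (\<lambda>s t. vector_derivative (\<lambda>\<tau>. f s \<tau>) (at t within {0..T}))"

definition pd12 :: "real \<Rightarrow> (real \<Rightarrow> real \<Rightarrow> real) \<Rightarrow> real \<Rightarrow> real \<Rightarrow> real" where
  "pd12 T f = pd1 T (pd2 T f)"

definition smooth :: "real \<Rightarrow> (real \<Rightarrow> real \<Rightarrow> real) \<Rightarrow> bool" where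
  "smooth T f \<longleftrightarrow> (\<exists>D :: nat \<Rightarrow> nat \<Rightarrow> real \<Rightarrow> real \<Rightarrow> real.
     (\<forall>s\<in>{0..T}. \<forall>t\<in>{0..T}. D 0 0 s t = f s t) \<and>
     (\<forall>i j. continuous_on ({0..T} \<times> {0..T}) (\<lambda>(s, t). D i j s t)) \<and>
     (\<forall>i j. \<forall>s\<in>{0..T}. \<forall>t\<in>{0..T}.
        ((\<lambda>\<sigma>. D i j \<sigma> t) has_real_derivative D (Suc i) j s t) (at s within {0..T}) \<and>
        ((\<lambda>\<tau>. D i j s \<tau>) has_real_derivative D i (Suc j) s t) (at t within {0..T})))"

text \<open>\<open>Plain\<close> stands for the indices \<open>(i,j) = (1,2)\<close> and \<open>Hat\<close> for their hatted version; \<open>D_kind T k x\<close>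
  is the corresponding \<open>D^{ij} x\<close>.\<close>

datatype kind = Plain | Hat

fun D_kind :: "real \<Rightarrow> kind \<Rightarrow> (real \<Rightarrow> real \<Rightarrow> real) \<Rightarrow> real \<Rightarrow> real \<Rightarrow> real" where
  "D_kind T Plain x = (\<lambda>\<sigma> \<tau>. pd12 T x \<sigma> \<tau>)"
| "D_kind T Hat x = (\<lambda>\<sigma> \<tau>. pd1 T x \<sigma> \<tau> * pd2 T x \<sigma> \<tau>)"

definition iint :: "real \<Rightarrow> real \<Rightarrow> real \<Rightarrow> real \<Rightarrow> (real \<Rightarrow> real \<Rightarrow> real) \<Rightarrow> real" where
  "iint a b c d f = integral {a..b} (\<lambda>\<sigma>. integral {c..d} (\<lambda>\<tau>. f \<sigma> \<tau>))"

text \<open>The suffix \<open>_1i_0dj\<close> renders the superscript \<open>1i;0.j\<close> with a dot, and likewise \<open>_1i_2dj\<close>.\<close>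

record rough_sheet =
  x_1_0 :: "real \<times> real \<Rightarrow> real \<Rightarrow> real"
  x_0_2 :: "real \<Rightarrow> real \<times> real \<Rightarrow> real"
  x_11_00 :: "real \<times> real \<Rightarrow> real \<Rightarrow> real"
  x_00_22 :: "real \<Rightarrow> real \<times> real \<Rightarrow> real"
  x_i_j :: "kind \<Rightarrow> real \<times> real \<Rightarrow> real \<times> real \<Rightarrow> real"
  x_1i_0j :: "kind \<Rightarrow> real \<times> real \<Rightarrow> real \<times> real \<Rightarrow> real"
  x_1i_0dj :: "kind \<Rightarrow> real \<times> real \<Rightarrow> real \<times> real \<Rightarrow> real"
  x_1i_2j :: "kind \<Rightarrow> real \<times> real \<Rightarrow> real \<times> real \<Rightarrow> real"
  x_1i_2dj :: "kind \<Rightarrow> real \<times> real \<Rightarrow> real \<times> real \<times> real \<Rightarrow> real"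

text \<open>The increments built from a smooth field \<open>x\<close>.\<close>

definition smooth_sheet :: "real \<Rightarrow> (real \<Rightarrow> real \<Rightarrow> real) \<Rightarrow> rough_sheet" where
  "smooth_sheet T x = \<lparr>
     x_1_0 = \<delta>1 x,
     x_0_2 = \<delta>2 x,
     x_11_00 = (\<lambda>s t. 1/2 * (\<delta>1 x s t)\<^sup>2),
     x_00_22 = (\<lambda>s t. 1/2 * (\<delta>2 x s t)\<^sup>2),
     x_i_j = (\<lambda>k. case k of Plain \<Rightarrow> \<delta> x
       | Hat \<Rightarrow> (\<lambda>(s1, s2) (t1, t2). iint s1 s2 t1 t2 (\<lambda>\<sigma> \<tau>. pd1 T x \<sigma> \<tau> * pd2 T x \<sigma> \<tau>))),
     x_1i_0j = (\<lambda>k (s1, s2) (t1, t2).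
       iint s1 s2 t1 t2 (\<lambda>\<sigma> \<tau>. \<delta>1 x (s1, \<sigma>) \<tau> * D_kind T k x \<sigma> \<tau>)),
     x_1i_0dj = (\<lambda>k (s1, s2) (t1, t2).
       iint s1 s2 t1 t2 (\<lambda>\<sigma> \<tau>. \<delta>1 x (s1, \<sigma>) t1 * D_kind T k x \<sigma> \<tau>)),
     x_1i_2j = (\<lambda>k (s1, s2) (t1, t2).
       iint s1 s2 t1 t2 (\<lambda>\<sigma> \<tau>. \<delta> x (s1, \<sigma>) (t1, \<tau>) * D_kind T k x \<sigma> \<tau>)),
     x_1i_2dj = (\<lambda>k (s1, s2) (t1, t2, t3).
       iint s1 s2 t2 t3 (\<lambda>\<sigma> \<tau>. \<delta> x (s1, \<sigma>) (t1, t2) * D_kind T k x \<sigma> \<tau>)) \<rparr>"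

definition holder_limit ::
  "real \<Rightarrow> real \<Rightarrow> real \<Rightarrow> (nat \<Rightarrow> 's::tuple \<Rightarrow> 't::tuple \<Rightarrow> real) \<Rightarrow> ('s \<Rightarrow> 't \<Rightarrow> real) \<Rightarrow> bool" where
  "holder_limit T a b f F \<longleftrightarrow>
     F \<in> holder T a b \<and> (\<lambda>n. hnorm T a b (\<lambda>s t. f n s t - F s t)) \<longlonglongrightarrow> 0"

definition holder_limit1 ::
  "real \<Rightarrow> real \<Rightarrow> (nat \<Rightarrow> real \<times> real \<Rightarrow> real \<Rightarrow> real) \<Rightarrow> (real \<times> real \<Rightarrow> real \<Rightarrow> real) \<Rightarrow> bool" where
  "holder_limit1 T a f F \<longleftrightarrow>
     F \<in> holder1 T a \<and> (\<lambda>n. hnorm1 T a (\<lambda>s t. f n s t - F s t)) \<longlonglongrightarrow> 0"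

definition holder_limit2 ::
  "real \<Rightarrow> real \<Rightarrow> (nat \<Rightarrow> real \<Rightarrow> real \<times> real \<Rightarrow> real) \<Rightarrow> (real \<Rightarrow> real \<times> real \<Rightarrow> real) \<Rightarrow> bool" where
  "holder_limit2 T b f F \<longleftrightarrow>
     F \<in> holder2 T b \<and> (\<lambda>n. hnorm2 T b (\<lambda>s t. f n s t - F s t)) \<longlonglongrightarrow> 0"

definition sheet_limit :: "real \<Rightarrow> real \<Rightarrow> real \<Rightarrow> (nat \<Rightarrow> rough_sheet) \<Rightarrow> rough_sheet \<Rightarrow> bool" where
  "sheet_limit T \<gamma>1 \<gamma>2 Y X \<longleftrightarrow>
     holder_limit1 T \<gamma>1 (\<lambda>n. x_1_0 (Y n)) (x_1_0 X) \<and>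
     holder_limit2 T \<gamma>2 (\<lambda>n. x_0_2 (Y n)) (x_0_2 X) \<and>
     holder_limit1 T (2*\<gamma>1) (\<lambda>n. x_11_00 (Y n)) (x_11_00 X) \<and>
     holder_limit2 T (2*\<gamma>2) (\<lambda>n. x_00_22 (Y n)) (x_00_22 X) \<and>
     (\<forall>k. holder_limit T \<gamma>1 \<gamma>2 (\<lambda>n. x_i_j (Y n) k) (x_i_j X k) \<and>
          holder_limit T (2*\<gamma>1) \<gamma>2 (\<lambda>n. x_1i_0j (Y n) k) (x_1i_0j X k) \<and>
          holder_limit T (2*\<gamma>1) \<gamma>2 (\<lambda>n. x_1i_0dj (Y n) k) (x_1i_0dj X k) \<and>
          holder_limit T (2*\<gamma>1) (2*\<gamma>2) (\<lambda>n. x_1i_2j (Y n) k) (x_1i_2j X k) \<and>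
          holder_limit T (2*\<gamma>1) (2*\<gamma>2) (\<lambda>n. x_1i_2dj (Y n) k) (x_1i_2dj X k))"

definition geometric_rough_sheet ::
  "real \<Rightarrow> real \<Rightarrow> real \<Rightarrow> (real \<Rightarrow> real \<Rightarrow> real) \<Rightarrow> rough_sheet \<Rightarrow> bool" where
  "geometric_rough_sheet T \<gamma>1 \<gamma>2 x X \<longleftrightarrow>
     (\<exists>xn :: nat \<Rightarrow> real \<Rightarrow> real \<Rightarrow> real.
        (\<forall>n. smooth T (xn n)) \<and>
        (\<lambda>n. field_norm T \<gamma>1 \<gamma>2 (\<lambda>s t. x s t - xn n s t)) \<longlonglongrightarrow> 0 \<and>
        sheet_limit T \<gamma>1 \<gamma>2 (\<lambda>n. smooth_sheet T (xn n)) X)"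

text \<open>The products are written out. Being controlled depends on \<open>x\<close> only: for every geometric rough
  sheet above \<open>x\<close>, \<open>x^{1;0}\<close> and \<open>x^{1;2}\<close> are \<open>\<delta>1 x\<close> and \<open>\<delta> x\<close> on ordered tuples.\<close>

definition controlled ::
  "real \<Rightarrow> real \<Rightarrow> real \<Rightarrow> (real \<Rightarrow> real \<Rightarrow> real) \<Rightarrow> (real \<Rightarrow> real \<Rightarrow> real) \<Rightarrow> (real \<Rightarrow> real \<Rightarrow> real) \<Rightarrow>
   (real \<times> real \<Rightarrow> real \<Rightarrow> real) \<Rightarrow> bool" where
  "controlled T \<gamma>1 \<gamma>2 x \<zeta> \<zeta>1 r \<longleftrightarrow>
     \<zeta> \<in> holder_field T \<gamma>1 \<gamma>2 \<and> \<zeta>1 \<in> holder_field T \<gamma>1 \<gamma>2 \<and>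
     r \<in> holder1 T (2*\<gamma>1) \<and> \<delta>2 r \<in> holder T (2*\<gamma>1) \<gamma>2 \<and>
     (\<forall>(s1, s2) \<in> ordered_tuples T. \<forall>t\<in>{0..T}.
        \<delta>1 \<zeta> (s1, s2) t = \<zeta>1 s1 t * \<delta>1 x (s1, s2) t + r (s1, s2) t) \<and>
     (\<forall>(s1, s2) \<in> ordered_tuples T. \<forall>(t1, t2) \<in> ordered_tuples T.
        \<delta> \<zeta> (s1, s2) (t1, t2) =
          \<zeta>1 s1 t1 * \<delta> x (s1, s2) (t1, t2) + \<delta>2 \<zeta>1 s1 (t1, t2) * \<delta>1 x (s1, s2) t2
          + \<delta>2 r (s1, s2) (t1, t2))"

text \<open>The germs \<open>\<zeta> x^{i;j} + \<zeta>^1 x^{1i;0.j}\<close> for \<open>k = Plain\<close> (giving the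
  integral \<open>z\<close>) and for \<open>k = Hat\<close> (giving the hatted \<open>z\<close>).\<close>

definition germ ::
  "kind \<Rightarrow> rough_sheet \<Rightarrow> (real \<Rightarrow> real \<Rightarrow> real) \<Rightarrow> (real \<Rightarrow> real \<Rightarrow> real) \<Rightarrow>
   real \<times> real \<Rightarrow> real \<times> real \<Rightarrow> real" where
  "germ k X \<zeta> \<zeta>1 = (\<lambda>(s1, s2) (t1, t2).
     \<zeta> s1 t1 * x_i_j X k (s1, s2) (t1, t2) + \<zeta>1 s1 t1 * x_1i_0dj X k (s1, s2) (t1, t2))"

definition rough_integral ::
  "real \<Rightarrow> kind \<Rightarrow> rough_sheet \<Rightarrow> (real \<Rightarrow> real \<Rightarrow> real) \<Rightarrow> (real \<Rightarrow> real \<Rightarrow> real) \<Rightarrow>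
   real \<times> real \<Rightarrow> real \<times> real \<Rightarrow> real" where
  "rough_integral T k X \<zeta> \<zeta>1 = sew2d T (germ k X \<zeta> \<zeta>1)"

definition is_partition :: "real \<Rightarrow> real \<Rightarrow> real list \<Rightarrow> bool" where
  "is_partition a b p \<longleftrightarrow> p \<noteq> [] \<and> sorted_wrt (<) p \<and> hd p = a \<and> last p = b"

definition mesh :: "real list \<Rightarrow> real" where
  "mesh p = Max ((\<lambda>i. p ! Suc i - p ! i) ` {..<length p - 1})"

end

theory Submission
  imports Defs
begin

text \<open>
  \<^bold>\<open>One parameter.\<close> Let \<open>h\<close> be a germ, that is, a function of ordered pairs, with
  \<open>\<bar>\<delta>h\<bar> \<le> C w\<^sup>\<mu>\<close> for some \<open>\<mu> > 1\<close>, where \<open>w\<close> is the length of the interval. Its dyadic Riemann sums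
  converge to a function \<open>sew_int h\<close> with \<open>\<bar>h - sew_int h\<bar> \<le> C' w\<^sup>\<mu>\<close>; for continuous \<open>h\<close> it is additive,
  and it is the only additive function which is so close to \<open>h\<close>. Hence \<open>\<Lambda>\<delta>h = h - sew_int h\<close>, and
  \<open>id - \<Lambda>\<delta>\<close> is nothing but the integration of germs.

  \<^bold>\<open>Two parameters.\<close> Consequently \<open>[id - \<Lambda>1 \<delta>1][id - \<Lambda>2 \<delta>2] g\<close> is obtained from \<open>g\<close> by integrating in the
  \<open>t\<close>-variables and then in the \<open>s\<close>-variables. If \<open>g\<close>, \<open>\<delta>1 g\<close>, \<open>\<delta>2 g\<close>, \<open>\<delta>g\<close> have the regularities \<open>(a, b)\<close>,
  \<open>(\<alpha>, b)\<close>, \<open>(a, \<beta>)\<close>, \<open>(\<alpha>, \<beta>)\<close> with \<open>\<alpha>, \<beta> > 1\<close> (the locale \<open>germ2d\<close>), then every sewing map is applied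
  inside its domain, and the result \<open>J12\<close> is additive in each of its two pairs of variables. Moreover \<open>g\<close> splits
  into \<open>J12\<close>, a term additive in \<open>t\<close> of order \<open>\<alpha>\<close> in \<open>s\<close>, a term additive in \<open>s\<close> of order \<open>\<beta>\<close> in \<open>t\<close>, and a
  term of order \<open>(\<alpha>, \<beta>)\<close>. The sums of the last three terms over a grid vanish as both meshes tend to zero, which
  proves the convergence of the Riemann sums.

  \<^bold>\<open>The germs of a controlled field.\<close> For \<open>g = \<zeta> x_i_j + \<zeta>1 x_1i_0dj\<close> the coboundaries are computed from the
  relations of Chen type between the components of a sheet (\<open>chen_relations\<close>). These are elementary for
  iterated integrals of smooth fields, and persist in the limit because convergence in a Hoelder norm implies
  pointwise convergence. Together with the two identities that define a controlled field they cancel all terms of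
  low order, and leave the exponents \<open>\<alpha> = 3 \<gamma>1 > 1\<close> and \<open>\<beta> = 2 \<gamma>2 > 1\<close> (\<open>controlled_germ2d\<close>).

  \<^bold>\<open>Smooth fields.\<close> If \<open>x\<close> is smooth, the iterated integral of \<open>\<zeta>\<close> times \<open>D_kind T k x\<close> is additive in \<open>s\<close> and \<open>t\<close>.
  Replacing \<open>\<zeta>\<close> by its expansion of first order at the left endpoint of the \<open>s\<close>-interval gives a function that is additive in \<open>t\<close>.
  It differs from the germ by a term of order \<open>1 + \<gamma>2\<close> in \<open>t\<close>, and from the iterated integral by one of order
  \<open>1 + 2 \<gamma>1\<close> in \<open>s\<close>. By uniqueness of the additive functions close to a germ, the iterated integral is \<open>J12\<close>.
\<close>

section \<open>One-parameter sewing\<close>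

text \<open>The points that divide \<open>[s, t]\<close> into \<open>k\<close> equal parts, and the corresponding Riemann sums of a germ
  \<open>g\<close>. For \<open>k = 0\<close> they are meaningless.\<close>

definition knot :: "nat \<Rightarrow> real \<Rightarrow> real \<Rightarrow> nat \<Rightarrow> real" where
  "knot k s t i = s + real i * (t - s) / real k"

definition eq_sum :: "nat \<Rightarrow> (real \<times> real \<Rightarrow> real) \<Rightarrow> real \<times> real \<Rightarrow> real" where
  "eq_sum k g = (\<lambda>(s, t). \<Sum>i<k. g (knot k s t i, knot k s t (Suc i)))"

text \<open>The limit of the dyadic Riemann sums of \<open>g\<close>; for the germs considered below this is the additive
  function associated with \<open>g\<close>, that is, \<open>g - \<Lambda>\<delta>g\<close>.\<close>

definition sew_int :: "(real \<times> real \<Rightarrow> real) \<Rightarrow> real \<times> real \<Rightarrow> real" where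
  "sew_int g p = lim (\<lambda>n. eq_sum (2 ^ n) g p)"

text \<open>The germs to which the sewing lemma applies, with the exponent \<open>\<mu>\<close> and the constant \<open>C\<close>.\<close>

definition sewing_germ :: "real \<Rightarrow> real \<Rightarrow> real \<Rightarrow> (real \<times> real \<Rightarrow> real) \<Rightarrow> bool" where
  "sewing_germ T C \<mu> g \<longleftrightarrow> 1 < \<mu> \<and> 0 \<le> C \<and>
     (\<forall>s\<in>ordered_tuples T. \<bar>cob' g s\<bar> \<le> C * width s powr \<mu>)"

lemma sewing_germD:
  assumes "sewing_germ T C \<mu> g" "0 \<le> s" "s \<le> u" "u \<le> t" "t \<le> T"
  shows "\<bar>g (s, t) - g (s, u) - g (u, t)\<bar> \<le> C * (t - s) powr \<mu>"
proof -
  have "(s, u, t) \<in> ordered_tuples T" using assms by (simp add: ordered_tuples_iff)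
  then show ?thesis using assms(1) unfolding sewing_germ_def
    by (fastforce simp: cob'_def width_simps)
qed

lemma knot_0 [simp]: "knot k s t 0 = s"
  by (simp add: knot_def)

lemma knot_last [simp]: "k > 0 \<Longrightarrow> knot k s t k = t"
  by (simp add: knot_def)

lemma knot_diff: "knot k s t (Suc i) - knot k s t i = (t - s) / real k"
  by (simp add: knot_def diff_divide_distrib[symmetric] algebra_simps)

lemma knot_mono: "s \<le> t \<Longrightarrow> i \<le> j \<Longrightarrow> knot k s t i \<le> knot k s t j"
  by (simp add: knot_def divide_right_mono mult_right_mono)

lemma knot_bounds:
  assumes "s \<le> t" "i \<le> k" "0 < k"
  shows "s \<le> knot k s t i" "knot k s t i \<le> t"
  using knot_mono[OF assms(1), of 0 i k] knot_mono[OF assms(1,2), of k] assms by auto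

lemma knot_ordered:
  assumes "(s, t) \<in> ordered_tuples T" "i < k"
  shows "(knot k s t i, knot k s t (Suc i)) \<in> ordered_tuples T"
  using knot_bounds[of s t i k] knot_bounds[of s t "Suc i" k] knot_mono[of s t i "Suc i" k] assms
  by (auto simp: ordered_tuples_iff)

lemma knot_knot:
  assumes "0 < m" "0 < k"
  shows "knot k (knot m s t i) (knot m s t (Suc i)) j = knot (m * k) s t (i * k + j)"
proof -
  have "knot k (knot m s t i) (knot m s t (Suc i)) j = knot m s t i + real j * ((t - s) / real m) / real k"
    using knot_diff[of m s t i] by (simp only: knot_def[of k])
  then show ?thesis using assms by (simp add: knot_def field_simps)
qed

lemma eq_sum_mult:
  assumes "0 < m" "0 < k"
  shows "eq_sum m (eq_sum k g) p = eq_sum (m * k) g p"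
proof -
  obtain s t where p: "p = (s, t)" by (cases p)
  define G where "G = (\<lambda>i. g (knot (m * k) s t i, knot (m * k) s t (Suc i)))"
  have "eq_sum (m * k) g p = (\<Sum>i<m. sum G {i * k..<i * k + k})"
    by (simp add: p eq_sum_def G_def sum.nat_group)
  also have "\<dots> = (\<Sum>i<m. \<Sum>j<k. G (i * k + j))"
  proof (rule sum.cong[OF refl])
    fix i show "sum G {i * k..<i * k + k} = (\<Sum>j<k. G (i * k + j))"
      using sum.atLeastLessThan_shift_0[of G "i * k" "i * k + k"] by (simp add: lessThan_atLeast0)
  qed
  also have "\<dots> = eq_sum m (eq_sum k g) p"
    by (simp add: p eq_sum_def G_def knot_knot[OF assms])
  finally show ?thesis by simp
qed

lemma eq_sum_1 [simp]: "eq_sum (Suc 0) g p = g p"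
  by (cases p) (simp add: eq_sum_def knot_def)

lemma eq_sum_cong:
  assumes "\<And>q. q \<in> ordered_tuples T \<Longrightarrow> g q = h q" "p \<in> ordered_tuples T"
  shows "eq_sum k g p = eq_sum k h p"
  using assms knot_ordered[of "fst p" "snd p" T _ k]
  by (cases p) (auto simp: eq_sum_def intro!: sum.cong)

lemma eq_sum_diff: "eq_sum k (\<lambda>q. g q - h q) p = eq_sum k g p - eq_sum k h p"
  by (cases p) (simp add: eq_sum_def sum_subtractf)

lemma eq_sum_bound:
  assumes g: "\<And>q. q \<in> ordered_tuples T \<Longrightarrow> \<bar>g q\<bar> \<le> C * width q powr \<mu>"
    and p: "p \<in> ordered_tuples T" and k: "0 < k"
  shows "\<bar>eq_sum k g p\<bar> \<le> C * width p powr \<mu> * real k powr (1 - \<mu>)"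
proof -
  obtain s t where p': "p = (s, t)" by (cases p)
  have st: "0 \<le> t - s" using p by (simp add: p' ordered_tuples_iff)
  have "\<bar>eq_sum k g p\<bar> \<le> (\<Sum>i<k. \<bar>g (knot k s t i, knot k s t (Suc i))\<bar>)"
    by (simp add: p' eq_sum_def sum_abs)
  also have "\<dots> \<le> (\<Sum>i<k. C * ((t - s) / real k) powr \<mu>)"
    using g[OF knot_ordered] p unfolding p' by (intro sum_mono) (force simp: width_simps knot_diff)
  also have "\<dots> = C * width p powr \<mu> * real k powr (1 - \<mu>)"
    using st k by (simp add: p' width_simps powr_divide powr_diff)
  finally show ?thesis .
qed

lemma geometric_increments:
  fixes a :: "nat \<Rightarrow> real"
  assumes a: "\<And>n. \<bar>a n - a (Suc n)\<bar> \<le> M * q ^ n" and q: "0 \<le> q" "q < 1"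
  shows "a \<longlonglongrightarrow> lim a" "\<bar>a n - lim a\<bar> \<le> M / (1 - q) * q ^ n"
proof -
  have s: "summable (\<lambda>n. M * q ^ n)" using q by (intro summable_mult summable_geometric) auto
  have "summable (\<lambda>n. a (Suc n) - a n)"
    by (rule summable_comparison_test'[OF s, of 0]) (use a in \<open>simp add: abs_minus_commute\<close>)
  from summable_LIMSEQ[OF this] have "(\<lambda>n. a n - a 0) \<longlonglongrightarrow> (\<Sum>n. a (Suc n) - a n)"
    by (simp add: sum_lessThan_telescope)
  from tendsto_add[OF this tendsto_const[of "a 0"]] have "convergent a"
    by (auto simp: convergent_def)
  then show l: "a \<longlonglongrightarrow> lim a" by (simp add: convergent_LIMSEQ_iff)
  have M: "0 \<le> M" using a[of 0] by simp
  have step: "\<bar>a n - a (n + k)\<bar> \<le> M / (1 - q) * q ^ n * (1 - q ^ k)" for k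
  proof (induction k)
    case (Suc k)
    have "\<bar>a n - a (n + Suc k)\<bar> \<le> M / (1 - q) * q ^ n * (1 - q ^ k) + M * q ^ (n + k)"
      using Suc a[of "n + k"] by simp
    also have "\<dots> = M / (1 - q) * q ^ n * (1 - q ^ Suc k)"
      using q by (simp add: field_simps power_add)
    finally show ?case .
  qed simp
  have "\<bar>a n - a (n + k)\<bar> \<le> M / (1 - q) * q ^ n" for k
  proof -
    have "M / (1 - q) * q ^ n * (1 - q ^ k) \<le> M / (1 - q) * q ^ n * 1"
      using q M by (intro mult_left_mono) auto
    then show ?thesis using step[of k] by simp
  qed
  moreover have "(\<lambda>k. \<bar>a n - a (n + k)\<bar>) \<longlonglongrightarrow> \<bar>a n - lim a\<bar>"
    using LIMSEQ_ignore_initial_segment[OF l, of n] by (intro tendsto_intros) (simp add: add.commute)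
  ultimately show "\<bar>a n - lim a\<bar> \<le> M / (1 - q) * q ^ n"
    by (intro LIMSEQ_le_const2) auto
qed

text \<open>The constant of the sewing lemma.\<close>

definition sew_const :: "real \<Rightarrow> real" where
  "sew_const \<mu> = 1 / (1 - 2 powr (1 - \<mu>))"

lemma sew_ratio:
  assumes "1 < \<mu>"
  shows "0 < 2 powr (1 - \<mu>)" "2 powr (1 - \<mu>) < (1::real)" "0 < sew_const \<mu>"
proof -
  show *: "2 powr (1 - \<mu>) < (1::real)"
    using assms powr_less_mono[of "1 - \<mu>" 0 2] by simp
  show "0 < sew_const \<mu>" using * by (simp add: sew_const_def)
qed simp

lemma two_power_powr: "real (2 ^ n) powr e = (2 powr e) ^ n"
  by (simp add: powr_realpow[symmetric] powr_powr mult.commute)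

lemma eq_sum_dyadic_step:
  assumes g: "sewing_germ T C \<mu> g" and p: "p \<in> ordered_tuples T"
  shows "\<bar>eq_sum (2 ^ n) g p - eq_sum (2 ^ Suc n) g p\<bar> \<le> C * width p powr \<mu> * (2 powr (1 - \<mu>)) ^ n"
proof -
  have "\<bar>g q - eq_sum 2 g q\<bar> \<le> C * width q powr \<mu>" if q: "q \<in> ordered_tuples T" for q
  proof -
    obtain s t where st: "q = (s, t)" by (cases q)
    have "eq_sum 2 g q = g (s, knot 2 s t 1) + g (knot 2 s t 1, t)"
      using knot_last[of 2 s t] by (simp add: st eq_sum_def numeral_2_eq_2)
    then show ?thesis
      using sewing_germD[OF g, of s "knot 2 s t 1" t] q knot_bounds[of s t 1 2]
      by (simp add: st ordered_tuples_iff width_simps)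
  qed
  from eq_sum_bound[OF this p, of "2 ^ n"]
  show ?thesis
    by (simp add: eq_sum_diff eq_sum_mult two_power_powr[simplified] mult.commute)
qed

lemma
  assumes g: "sewing_germ T C \<mu> g" and p: "p \<in> ordered_tuples T"
  shows eq_sum_tendsto: "(\<lambda>n. eq_sum (2 ^ n) g p) \<longlonglongrightarrow> sew_int g p"
    and eq_sum_rate: "\<bar>eq_sum (2 ^ n) g p - sew_int g p\<bar>
      \<le> C * sew_const \<mu> * width p powr \<mu> * (2 powr (1 - \<mu>)) ^ n"
proof -
  have \<mu>: "1 < \<mu>" using g by (simp add: sewing_germ_def)
  note * = geometric_increments(1)[OF eq_sum_dyadic_step[OF g p]]
    geometric_increments(2)[OF eq_sum_dyadic_step[OF g p], of n] sew_ratio[OF \<mu>]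
  show "(\<lambda>n. eq_sum (2 ^ n) g p) \<longlonglongrightarrow> sew_int g p"
    using * unfolding sew_int_def by simp
  show "\<bar>eq_sum (2 ^ n) g p - sew_int g p\<bar>
      \<le> C * sew_const \<mu> * width p powr \<mu> * (2 powr (1 - \<mu>)) ^ n"
    using * unfolding sew_int_def sew_const_def by simp
qed

lemma sew_int_bound:
  assumes g: "sewing_germ T C \<mu> g" and p: "p \<in> ordered_tuples T"
  shows "\<bar>g p - sew_int g p\<bar> \<le> C * sew_const \<mu> * width p powr \<mu>"
  using eq_sum_rate[OF assms, of 0] by simp

text \<open>A function which is additive at midpoints, and hence equal to its own dyadic sums, is determined by any germ
  from which it differs by a term of order greater than one.\<close>

lemma sew_int_unique:
  assumes mid: "\<And>q. q \<in> ordered_tuples T \<Longrightarrow> eq_sum 2 J q = J q"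
    and near: "\<And>q. q \<in> ordered_tuples T \<Longrightarrow> \<bar>J q - g q\<bar> \<le> C * width q powr \<mu>"
    and \<mu>: "1 < \<mu>" and p: "p \<in> ordered_tuples T"
  shows "(\<lambda>n. eq_sum (2 ^ n) g p) \<longlonglongrightarrow> J p" "sew_int g p = J p"
proof -
  have J: "eq_sum (2 ^ n) J q = J q" if "q \<in> ordered_tuples T" for n q
    using that
  proof (induction n arbitrary: q)
    case (Suc n)
    have "eq_sum (2 ^ Suc n) J q = eq_sum 2 (eq_sum (2 ^ n) J) q" by (simp add: eq_sum_mult)
    also have "\<dots> = eq_sum 2 J q" using Suc by (intro eq_sum_cong[where T = T]) auto
    finally show ?case using mid Suc by simp
  qed simp
  have "(\<lambda>n. J p - eq_sum (2 ^ n) g p) \<longlonglongrightarrow> 0"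
  proof (rule Lim_null_comparison)
    show "\<forall>\<^sub>F n in sequentially. norm (J p - eq_sum (2 ^ n) g p)
        \<le> C * width p powr \<mu> * (2 powr (1 - \<mu>)) ^ n"
      using eq_sum_bound[OF near p, of "2 ^ n" for n] J[OF p]
      by (simp add: eq_sum_diff two_power_powr[simplified])
    show "(\<lambda>n. C * width p powr \<mu> * (2 powr (1 - \<mu>)) ^ n) \<longlonglongrightarrow> 0"
      using sew_ratio[OF \<mu>] by (intro tendsto_mult_right_zero LIMSEQ_realpow_zero) auto
  qed
  from tendsto_diff[OF tendsto_const[of "J p"] this]
  show *: "(\<lambda>n. eq_sum (2 ^ n) g p) \<longlonglongrightarrow> J p" by simp
  then show "sew_int g p = J p" by (simp add: sew_int_def limI)
qed

lemma additive_midpoint: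
  assumes add: "\<And>s u t. 0 \<le> s \<Longrightarrow> s \<le> u \<Longrightarrow> u \<le> t \<Longrightarrow> t \<le> T \<Longrightarrow> J (s, t) = J (s, u) + J (u, t)"
    and q: "q \<in> ordered_tuples T"
  shows "eq_sum 2 J q = (J q :: real)"
proof -
  obtain s t where st: "q = (s, t)" by (cases q)
  show ?thesis
    using knot_last[of 2 s t] add[of s "knot 2 s t 1" t] q knot_bounds[of s t 1 2]
    by (simp add: st eq_sum_def numeral_2_eq_2 ordered_tuples_iff)
qed

lemma sewing_germ_eq_sum:
  assumes g: "sewing_germ T C \<mu> g" and p: "p \<in> ordered_tuples T" and k: "0 < k"
  shows "\<bar>g p - eq_sum k g p\<bar> \<le> real k * C * width p powr \<mu>"
proof -
  obtain s t where p': "p = (s, t)" by (cases p)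
  have st: "0 \<le> s" "s \<le> t" "t \<le> T" using p by (auto simp: p' ordered_tuples_iff)
  have C: "1 < \<mu>" "0 \<le> C" using g by (auto simp: sewing_germ_def)
  have "\<bar>g (s, knot k s t j) - (\<Sum>i<j. g (knot k s t i, knot k s t (Suc i)))\<bar>
      \<le> real j * C * (t - s) powr \<mu>" if "j \<le> k" for j
    using that
  proof (induction j)
    case 0
    have "\<bar>g (s, s)\<bar> \<le> 0" using sewing_germD[OF g, of s s s] st C by simp
    then show ?case by simp
  next
    case (Suc j)
    have b: "s \<le> knot k s t j" "knot k s t j \<le> knot k s t (Suc j)" "knot k s t (Suc j) \<le> t"
      using knot_bounds[OF st(2), of j k] knot_bounds[OF st(2), of "Suc j" k]
        knot_mono[OF st(2), of j "Suc j" k] Suc.prems k by auto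
    have "\<bar>g (s, knot k s t (Suc j)) - g (s, knot k s t j) - g (knot k s t j, knot k s t (Suc j))\<bar>
        \<le> C * (knot k s t (Suc j) - s) powr \<mu>"
      using b st by (intro sewing_germD[OF g]) auto
    also have "\<dots> \<le> C * (t - s) powr \<mu>"
      using b C by (intro mult_left_mono powr_mono2) auto
    finally show ?case using Suc by (simp add: algebra_simps)
  qed
  from this[of k] k show ?thesis by (simp add: p' eq_sum_def width_simps)
qed

lemma eq_sum_continuous:
  fixes g :: "'p::topological_space \<Rightarrow> real \<times> real \<Rightarrow> real"
  assumes "continuous_on (P \<times> ordered_tuples T) (\<lambda>(p, t). g p t)"
  shows "continuous_on (P \<times> ordered_tuples T) (\<lambda>(p, t). eq_sum k (g p) t)"
proof -
  have "continuous_on (P \<times> ordered_tuples T)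
      (\<lambda>x. g (fst x) (knot k (fst (snd x)) (snd (snd x)) i, knot k (fst (snd x)) (snd (snd x)) (Suc i)))"
    if "i < k" for i
  proof -
    have "continuous_on (P \<times> ordered_tuples T) ((\<lambda>(p, t). g p t) \<circ>
       (\<lambda>x. (fst x, knot k (fst (snd x)) (snd (snd x)) i, knot k (fst (snd x)) (snd (snd x)) (Suc i))))"
    proof (intro continuous_on_compose continuous_on_subset[OF assms])
      show "continuous_on (P \<times> ordered_tuples T)
        (\<lambda>x. (fst x, knot k (fst (snd x)) (snd (snd x)) i, knot k (fst (snd x)) (snd (snd x)) (Suc i)))"
        unfolding knot_def divide_inverse by (intro continuous_intros)
    qed (use that in \<open>auto intro!: knot_ordered\<close>)
    then show ?thesis by (simp add: o_def)
  qed
  then show ?thesis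
    unfolding eq_sum_def case_prod_beta by (intro continuous_on_sum) auto
qed

lemma width_le: "p \<in> ordered_tuples T \<Longrightarrow> 0 \<le> width p \<and> width p \<le> T" for p :: "real \<times> real"
  by (cases p) (simp add: ordered_tuples_iff width_simps)

text \<open>The Riemann sums converge uniformly, so that \<open>sew_int\<close> preserves continuity, also in the presence of
  a parameter.\<close>

lemma sew_int_continuous:
  fixes g :: "'p::topological_space \<Rightarrow> real \<times> real \<Rightarrow> real"
  assumes cont: "continuous_on (P \<times> ordered_tuples T) (\<lambda>(p, t). g p t)"
    and g: "\<And>p. p \<in> P \<Longrightarrow> sewing_germ T C \<mu> (g p)"
  shows "continuous_on (P \<times> ordered_tuples T) (\<lambda>(p, t). sew_int (g p) t)"
proof (cases "P = {}")
  case False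
  then have C: "1 < \<mu>" "0 \<le> C" using g by (auto simp: sewing_germ_def)
  define K where "K = C * sew_const \<mu> * T powr \<mu>"
  have lim: "(\<lambda>n. K * (2 powr (1 - \<mu>)) ^ n) \<longlonglongrightarrow> 0"
    using sew_ratio[OF C(1)] by (intro tendsto_mult_right_zero LIMSEQ_realpow_zero) auto
  have bound: "\<bar>eq_sum (2 ^ n) (g p) t - sew_int (g p) t\<bar> \<le> K * (2 powr (1 - \<mu>)) ^ n"
    if "p \<in> P" "t \<in> ordered_tuples T" for p t n
  proof -
    have "C * sew_const \<mu> * width t powr \<mu> * (2 powr (1 - \<mu>)) ^ n \<le> K * (2 powr (1 - \<mu>)) ^ n"
      unfolding K_def using C sew_ratio[OF C(1)] width_le[OF that(2)]
      by (intro mult_right_mono mult_left_mono powr_mono2) auto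
    then show ?thesis using eq_sum_rate[OF g[OF that(1)] that(2), of n] by linarith
  qed
  have "uniform_limit (P \<times> ordered_tuples T) (\<lambda>n (p, t). eq_sum (2 ^ n) (g p) t)
      (\<lambda>(p, t). sew_int (g p) t) sequentially"
  proof (rule uniform_limitI)
    fix e :: real assume "e > 0"
    with lim have "\<forall>\<^sub>F n in sequentially. K * (2 powr (1 - \<mu>)) ^ n < e" by (rule order_tendstoD(2))
    then show "\<forall>\<^sub>F n in sequentially. \<forall>x\<in>P \<times> ordered_tuples T.
        dist (case x of (p, t) \<Rightarrow> eq_sum (2 ^ n) (g p) t) (case x of (p, t) \<Rightarrow> sew_int (g p) t) < e"
      by eventually_elim (use bound in \<open>fastforce simp: dist_real_def intro: le_less_trans\<close>)
  qed
  then show ?thesis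
    by (rule uniform_limit_theorem[rotated]) (use eq_sum_continuous[OF cont] in auto)
qed simp

text \<open>Additivity of \<open>sew_int g\<close>. The sums of \<open>I = sew_int g\<close> over equal parts are again additive at
  midpoints and close to \<open>g\<close>, hence equal to \<open>I\<close>. This is additivity at all points which divide the interval
  in a rational ratio, and continuity does the rest.\<close>

lemma eq_sum_sew_int:
  assumes g: "sewing_germ T C \<mu> g" and p: "p \<in> ordered_tuples T" and k: "0 < k"
  shows "eq_sum k (sew_int g) p = sew_int g p"
proof -
  let ?I = "sew_int g"
  have C: "1 < \<mu>" "0 \<le> C" using g by (auto simp: sewing_germ_def)
  have mid: "eq_sum 2 ?I q = ?I q" if q: "q \<in> ordered_tuples T" for q
  proof -
    have "(\<lambda>n. eq_sum 2 (eq_sum (2 ^ n) g) q) \<longlonglongrightarrow> eq_sum 2 ?I q"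
      using knot_ordered[of "fst q" "snd q" T _ 2] q unfolding eq_sum_def[of 2] case_prod_beta
      by (intro tendsto_sum eq_sum_tendsto[OF g]) auto
    moreover have "(\<lambda>n. eq_sum 2 (eq_sum (2 ^ n) g) q) \<longlonglongrightarrow> ?I q"
      using LIMSEQ_Suc[OF eq_sum_tendsto[OF g q]] by (simp add: eq_sum_mult)
    ultimately show ?thesis by (rule LIMSEQ_unique)
  qed
  have mid': "eq_sum 2 (eq_sum k ?I) q = eq_sum k ?I q" if q: "q \<in> ordered_tuples T" for q
  proof -
    have "eq_sum 2 (eq_sum k ?I) q = eq_sum k (eq_sum 2 ?I) q"
      using k by (simp add: eq_sum_mult mult.commute)
    also have "\<dots> = eq_sum k ?I q" using mid q by (intro eq_sum_cong[where T = T]) auto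
    finally show ?thesis .
  qed
  define D where "D = real k powr (1 - \<mu>) * (C * sew_const \<mu>) + real k * C"
  have near: "\<bar>eq_sum k ?I q - g q\<bar> \<le> D * width q powr \<mu>" if q: "q \<in> ordered_tuples T" for q
  proof -
    have "\<bar>eq_sum k (\<lambda>q. g q - ?I q) q\<bar> \<le> C * sew_const \<mu> * width q powr \<mu> * real k powr (1 - \<mu>)"
      by (rule eq_sum_bound[OF sew_int_bound[OF g] q k])
    then show ?thesis
      using sewing_germ_eq_sum[OF g q k] by (simp add: eq_sum_diff D_def algebra_simps)
  qed
  show ?thesis using sew_int_unique(2)[OF mid' near C(1) p] by simp
qed

lemma sew_int_diagonal:
  assumes g: "sewing_germ T C \<mu> g" and s: "0 \<le> s" "s \<le> T"
  shows "sew_int g (s, s) = 0"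
proof -
  have "\<bar>g (s, s) - sew_int g (s, s)\<bar> \<le> 0" "\<bar>g (s, s)\<bar> \<le> 0"
    using s sew_int_bound[OF g, of "(s, s)"] sewing_germD[OF g, of s s s]
    by (auto simp: ordered_tuples_iff width_simps sewing_germ_def)
  then show ?thesis by simp
qed

lemma sew_int_additive:
  assumes g: "sewing_germ T C \<mu> g" and cont: "continuous_on (ordered_tuples T) g"
    and o: "0 \<le> s" "s \<le> u" "u \<le> t" "t \<le> T"
  shows "sew_int g (s, t) = sew_int g (s, u) + sew_int g (u, t)"
proof (cases "s = t")
  case True
  then show ?thesis using o sew_int_diagonal[OF g, of s] by simp
next
  case False
  let ?I = "sew_int g"
  have ratio: "?I (s, t) = ?I (s, knot k s t m) + ?I (knot k s t m, t)" if m: "m \<le> k" "0 < k" for k m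
  proof -
    have st: "(s, t) \<in> ordered_tuples T" using o by (simp add: ordered_tuples_iff)
    have k: "s \<le> knot k s t m" "knot k s t m \<le> t" using o m knot_bounds[of s t m k] by auto
    have "?I (s, t) = (\<Sum>i<k. ?I (knot k s t i, knot k s t (Suc i)))"
      using eq_sum_sew_int[OF g st m(2)] by (simp add: eq_sum_def)
    also have "\<dots> = (\<Sum>i<m. ?I (knot k s t i, knot k s t (Suc i))) +
        (\<Sum>i\<in>{m..<k}. ?I (knot k s t i, knot k s t (Suc i)))"
      using m by (simp add: lessThan_atLeast0 sum.atLeastLessThan_concat)
    also have "(\<Sum>i<m. ?I (knot k s t i, knot k s t (Suc i))) = ?I (s, knot k s t m)"
    proof (cases "m = 0")
      case True
      then show ?thesis using o sew_int_diagonal[OF g, of s] by simp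
    next
      case False
      have "knot m s (knot k s t m) i = knot k s t i" for i
        using False m by (simp add: knot_def field_simps)
      then show ?thesis
        using eq_sum_sew_int[OF g, of "(s, knot k s t m)" m] False k o
        by (simp add: eq_sum_def ordered_tuples_iff)
    qed
    also have "(\<Sum>i\<in>{m..<k}. ?I (knot k s t i, knot k s t (Suc i))) = ?I (knot k s t m, t)"
    proof (cases "m = k")
      case True
      then show ?thesis using o m sew_int_diagonal[OF g, of t] by simp
    next
      case False
      then have mk: "0 < k - m" "real (k - m) = real k - real m" "real m < real k" using m by auto
      have "knot (k - m) (knot k s t m) t i = knot k s t (m + i)" for i
      proof -
        have "t - knot k s t m = (real k - real m) * (t - s) / real k"
          using m by (simp add: knot_def field_simps)
        then show ?thesis using mk m(2)
          by (simp add: knot_def field_simps)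
      qed
      then have "?I (knot k s t m, t) = (\<Sum>i<k - m. ?I (knot k s t (m + i), knot k s t (Suc (m + i))))"
        using eq_sum_sew_int[OF g, of "(knot k s t m, t)" "k - m"] mk k o
        by (simp add: eq_sum_def ordered_tuples_iff)
      then show ?thesis
        using sum.atLeastLessThan_shift_0[of "\<lambda>i. ?I (knot k s t i, knot k s t (Suc i))" m k]
        by (simp add: lessThan_atLeast0)
    qed
    finally show ?thesis .
  qed
  have contI: "continuous_on (ordered_tuples T) ?I"
  proof -
    have "continuous_on ({0} \<times> ordered_tuples T) (\<lambda>(p, t). sew_int ((\<lambda>_::real. g) p) t)"
      by (rule sew_int_continuous[OF _ g])
        (auto simp: case_prod_beta intro!: continuous_on_compose2[OF cont] continuous_intros)
    then have "continuous_on (ordered_tuples T) ((\<lambda>(p, t). sew_int ((\<lambda>_::real. g) p) t) \<circ> Pair 0)"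
      by (intro continuous_on_compose2[folded o_def]) (auto intro!: continuous_intros)
    then show ?thesis by (simp add: o_def)
  qed
  \<comment> \<open>Approximation of \<open>u\<close> by points \<open>v n\<close> that divide \<open>[s, t]\<close> in rational ratios.\<close>
  define \<theta> where "\<theta> = (u - s) / (t - s)"
  have \<theta>: "0 \<le> \<theta>" "\<theta> \<le> 1" using o False by (auto simp: \<theta>_def)
  define m where "m = (\<lambda>n. nat \<lfloor>real (Suc n) * \<theta>\<rfloor>)"
  define v where "v = (\<lambda>n. knot (Suc n) s t (m n))"
  have m: "m n \<le> Suc n" for n
  proof -
    have "real (Suc n) * \<theta> \<le> real (Suc n)" using \<theta> by (simp add: mult_left_le)
    then have "\<lfloor>real (Suc n) * \<theta>\<rfloor> \<le> int (Suc n)" by linarith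
    then show ?thesis unfolding m_def by linarith
  qed
  have vb: "s \<le> v n" "v n \<le> t" for n
    unfolding v_def using o knot_bounds[OF _ m[of n], of s t] by auto
  have frac: "(\<lambda>n. real (m n) / real (Suc n)) \<longlonglongrightarrow> \<theta>"
  proof (rule real_tendsto_sandwich[where f = "\<lambda>n. \<theta> - inverse (real (Suc n))" and h = "\<lambda>_. \<theta>"])
    have fl: "real (m n) = of_int \<lfloor>real (Suc n) * \<theta>\<rfloor>" for n
      unfolding m_def using \<theta> by simp
    have 1: "\<theta> - inverse (real (Suc n)) \<le> real (m n) / real (Suc n)" for n
    proof -
      have "real (Suc n) * \<theta> - 1 \<le> real (m n)" unfolding fl by linarith
      then have "(real (Suc n) * \<theta> - 1) / real (Suc n) \<le> real (m n) / real (Suc n)"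
        by (intro divide_right_mono) auto
      then show ?thesis by (simp add: diff_divide_distrib inverse_eq_divide)
    qed
    have 2: "real (m n) / real (Suc n) \<le> \<theta>" for n
    proof -
      have "real (m n) \<le> real (Suc n) * \<theta>" unfolding fl by linarith
      then show ?thesis by (simp add: field_simps)
    qed
    show "\<forall>\<^sub>F n in sequentially. \<theta> - inverse (real (Suc n)) \<le> real (m n) / real (Suc n)"
      using 1 by simp
    show "\<forall>\<^sub>F n in sequentially. real (m n) / real (Suc n) \<le> \<theta>" using 2 by simp
    show "(\<lambda>n. \<theta> - inverse (real (Suc n))) \<longlonglongrightarrow> \<theta>"
      using tendsto_diff[OF tendsto_const LIMSEQ_inverse_real_of_nat, of \<theta>] by simp
  qed simp
  have v: "v \<longlonglongrightarrow> u"
  proof -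
    have "(\<lambda>n. s + (real (m n) / real (Suc n)) * (t - s)) \<longlonglongrightarrow> s + \<theta> * (t - s)"
      by (intro tendsto_intros frac)
    then show ?thesis using False by (simp add: v_def knot_def[abs_def] \<theta>_def)
  qed
  have "(\<lambda>n. ?I (s, v n) + ?I (v n, t)) \<longlonglongrightarrow> ?I (s, u) + ?I (u, t)"
    using o vb
    by (intro tendsto_add continuous_on_tendsto_compose[OF contI] tendsto_Pair v tendsto_const)
       (auto simp: ordered_tuples_iff intro!: always_eventually order_trans[OF _ o(4)] order_trans[OF o(1)])
  moreover have "(\<lambda>n. ?I (s, v n) + ?I (v n, t)) = (\<lambda>n. ?I (s, t))"
    using ratio[OF m] by (simp add: v_def)
  ultimately show ?thesis by (simp add: LIMSEQ_const_iff)
qed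

lemma cob'_eq: "cob' f (s, u, t) = f (s, t) - f (s, u) - f (u, t)"
  by (simp add: cob'_def)

lemma sews_unique:
  assumes F: "sews T h F" and G: "sews T h G"
  shows "F = G"
proof
  fix p
  show "F p = G p"
  proof (cases "p \<in> ordered_tuples T")
    case p: True
    obtain \<mu> B where \<mu>: "1 < \<mu>" and B: "\<And>q. q \<in> ordered_tuples T \<Longrightarrow> \<bar>F q\<bar> \<le> B * width q powr \<mu>"
      using F unfolding sews_def by blast
    obtain \<nu> C where \<nu>: "1 < \<nu>" and C: "\<And>q. q \<in> ordered_tuples T \<Longrightarrow> \<bar>G q\<bar> \<le> C * width q powr \<nu>"
      using G unfolding sews_def by blast
    have add: "F (s, t) - G (s, t) = F (s, u) - G (s, u) + (F (u, t) - G (u, t))"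
      if "0 \<le> s" "s \<le> u" "u \<le> t" "t \<le> T" for s u t
    proof -
      have "(s, u, t) \<in> ordered_tuples T" using that by (simp add: ordered_tuples_iff)
      then have "cob' F (s, u, t) = h (s, u, t)" "cob' G (s, u, t) = h (s, u, t)"
        using F G unfolding sews_def by blast+
      then show ?thesis by (simp add: cob'_eq)
    qed
    \<comment> \<open>Both \<open>F - G\<close> and 0 are additive functions close to the germ \<open>F\<close>.\<close>
    have "sew_int F p = F p - G p"
    proof (rule sew_int_unique(2)[OF additive_midpoint[where T = T] _ \<nu> p])
      show "\<bar>F q - G q - F q\<bar> \<le> C * width q powr \<nu>" if "q \<in> ordered_tuples T" for q
        using C[OF that] by simp
    qed (assumption | rule add)+
    moreover have "sew_int F p = 0"
      by (rule sew_int_unique(2)[where J = "\<lambda>_. 0", OF _ _ \<mu> p]) (use B in \<open>auto simp: eq_sum_def\<close>)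
    ultimately show ?thesis by simp
  next
    case False
    then show ?thesis using F G unfolding sews_def by metis
  qed
qed

lemma sews_cob':
  assumes g: "sewing_germ T C \<mu> g" and cont: "continuous_on (ordered_tuples T) g"
    and h: "\<And>u. u \<in> ordered_tuples T \<Longrightarrow> h u = cob' g u"
  shows "\<exists>!F. sews T h F" "p \<in> ordered_tuples T \<Longrightarrow> sewing T h p = g p - sew_int g p"
proof -
  define F where "F = (\<lambda>p. if p \<in> ordered_tuples T then g p - sew_int g p else 0)"
  have "1 < \<mu> \<and> (\<forall>u\<in>ordered_tuples T. \<bar>h u\<bar> \<le> C * width u powr \<mu>) \<and>
      (\<forall>q\<in>ordered_tuples T. \<bar>F q\<bar> \<le> C * sew_const \<mu> * width q powr \<mu>)"
  proof (intro conjI ballI)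
    show "1 < \<mu>" using g by (simp add: sewing_germ_def)
    show "\<bar>h u\<bar> \<le> C * width u powr \<mu>" if "u \<in> ordered_tuples T" for u
      using g that by (simp add: h sewing_germ_def)
    show "\<bar>F q\<bar> \<le> C * sew_const \<mu> * width q powr \<mu>" if "q \<in> ordered_tuples T" for q
      using sew_int_bound[OF g that] that by (simp add: F_def)
  qed
  moreover have "(\<forall>q\<in>ordered_tuples T. cob' F q = h q) \<and> (\<forall>q. q \<notin> ordered_tuples T \<longrightarrow> F q = 0)"
  proof (intro conjI ballI allI impI)
    show "cob' F q = h q" if "q \<in> ordered_tuples T" for q
    proof -
      obtain s u t where q: "q = (s, u, t)" by (cases q)
      with that have o: "0 \<le> s" "s \<le> u" "u \<le> t" "t \<le> T" by (auto simp: ordered_tuples_iff)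
      show ?thesis using sew_int_additive[OF g cont o] o h[OF that]
        by (simp add: q cob'_eq F_def ordered_tuples_iff)
    qed
  qed (simp add: F_def)
  ultimately have "sews T h F" unfolding sews_def by blast
  then show "\<exists>!F. sews T h F" using sews_unique by blast
  then have "sewing T h = F" using \<open>sews T h F\<close> unfolding sewing_def by (simp add: the1_equality)
  then show "p \<in> ordered_tuples T \<Longrightarrow> sewing T h p = g p - sew_int g p" by (simp add: F_def)
qed

lemma sew_int_diff:
  assumes "sewing_germ T C \<mu> g" "sewing_germ T D \<nu> h" "p \<in> ordered_tuples T"
  shows "sew_int (\<lambda>q. g q - h q) p = sew_int g p - sew_int h p"
  unfolding sew_int_def[of "\<lambda>q. g q - h q"] eq_sum_diff
  by (intro limI tendsto_diff eq_sum_tendsto[OF assms(1,3)] eq_sum_tendsto[OF assms(2,3)])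

lemma sew_int_diff2:
  assumes "sewing_germ T C \<mu> g" "sewing_germ T D \<nu> h" "sewing_germ T E \<kappa> k" "p \<in> ordered_tuples T"
  shows "sew_int (\<lambda>q. g q - h q - k q) p = sew_int g p - sew_int h p - sew_int k p"
  unfolding sew_int_def[of "\<lambda>q. g q - h q - k q"] eq_sum_diff
  by (intro limI tendsto_diff eq_sum_tendsto[OF assms(1,4)] eq_sum_tendsto[OF assms(2,4)]
      eq_sum_tendsto[OF assms(3,4)])

section \<open>Increments and Hoelder bounds\<close>

lemma powr_weaken:
  fixes w :: real
  assumes "0 \<le> w" "w \<le> T" "c \<le> b"
  shows "w powr b \<le> T powr (b - c) * w powr c"
proof (cases "w = 0")
  case False
  have "w powr b = w powr (b - c) * w powr c" by (simp add: powr_add[symmetric])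
  also have "\<dots> \<le> T powr (b - c) * w powr c"
    using assms by (intro mult_right_mono powr_mono2) auto
  finally show ?thesis .
qed simp

text \<open>Membership in the Hoelder classes is handled through real bounds. These may be stated on all ordered tuples,
  because increments vanish on those which are not strictly ordered.\<close>

lemma holderI:
  assumes "f \<in> incr T" "0 \<le> C"
    and "\<And>s t. s \<in> ordered_tuples T \<Longrightarrow> t \<in> ordered_tuples T \<Longrightarrow>
      \<bar>f s t\<bar> \<le> C * width s powr a * width t powr b"
  shows "f \<in> holder T a b"
proof -
  have "\<bar>f s t\<bar> / (width s powr a * width t powr b) \<le> C"
    if "s \<in> strict_tuples T" "t \<in> strict_tuples T" for s t
  proof -
    have *: "\<bar>f s t\<bar> \<le> C * (width s powr a * width t powr b)"
      using assms(3)[of s t] that by (simp add: strict_tuples_def mult.assoc)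
    show ?thesis
    proof (cases "width s powr a * width t powr b = 0")
      case True
      show ?thesis unfolding True using assms(2) by simp
    next
      case False
      then have "0 < width s powr a * width t powr b" by (simp add: order_less_le)
      then show ?thesis using * by (rule pos_divide_le_eq[THEN iffD2])
    qed
  qed
  then have "hnorm T a b f \<le> ennreal C"
    unfolding hnorm_def by (intro SUP_least) (auto intro!: ennreal_leI)
  then have "hnorm T a b f < \<infinity>" by (rule le_less_trans) simp
  with assms show ?thesis by (simp add: holder_def)
qed

lemma width_pos:
  "s \<in> strict_tuples T \<Longrightarrow> 0 < width s" "t \<in> strict_tuples T \<Longrightarrow> 0 < width t"
  for s :: "real \<times> real" and t :: "real \<times> real \<times> real"
  by (cases s, force simp: strict_tuples_iff width_simps, cases t, force simp: strict_tuples_iff width_simps)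

lemma incr_continuous: "f \<in> incr T \<Longrightarrow> continuous_on (ordered_tuples T \<times> ordered_tuples T) (\<lambda>(s, t). f s t)"
  by (simp add: incr_def)

lemma incr_zero:
  "f \<in> incr T \<Longrightarrow> s \<in> ordered_tuples T \<Longrightarrow> t \<in> ordered_tuples T \<Longrightarrow>
    s \<notin> strict_tuples T \<or> t \<notin> strict_tuples T \<Longrightarrow> f s t = 0"
  unfolding incr_def by blast

lemma incr_compose:
  assumes f: "f \<in> incr T" and u: "continuous_on A u" and v: "continuous_on A v"
    and "\<And>x. x \<in> A \<Longrightarrow> u x \<in> ordered_tuples T" "\<And>x. x \<in> A \<Longrightarrow> v x \<in> ordered_tuples T"
  shows "continuous_on A (\<lambda>x. f (u x) (v x))"
proof -
  have "continuous_on A ((\<lambda>(s, t). f s t) \<circ> (\<lambda>x. (u x, v x)))"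
    using assms by (intro continuous_on_compose continuous_on_Pair continuous_on_subset[OF incr_continuous[OF f]]) auto
  then show ?thesis by (simp add: o_def)
qed

lemma incr_\<delta>1':
  assumes g: "g \<in> incr T"
  shows "\<delta>1' g \<in> incr T"
proof -
  let ?A = "ordered_tuples T \<times> ordered_tuples T :: ((real \<times> real \<times> real) \<times> 'a) set"
  have "continuous_on ?A (\<lambda>x. g (fst (fst x), snd (snd (fst x))) (snd x)
      - g (fst (fst x), fst (snd (fst x))) (snd x) - g (snd (fst x)) (snd x))"
    by (intro continuous_on_diff incr_compose[OF g] continuous_intros) (auto simp: ordered_tuples_iff)
  then have "continuous_on ?A (\<lambda>(s, t). \<delta>1' g s t)"
    by (simp add: \<delta>1'_def on1_def cob'_def case_prod_beta)
  moreover have "\<delta>1' g s t = 0" if "s \<in> ordered_tuples T" "t \<in> ordered_tuples T"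
    "s \<notin> strict_tuples T \<or> t \<notin> strict_tuples T" for s t
  proof -
    obtain s1 s2 s3 where s: "s = (s1, s2, s3)" by (cases s)
    show ?thesis
      using that incr_zero[OF g, of "(s1, s3)" t] incr_zero[OF g, of "(s1, s2)" t] incr_zero[OF g, of "(s2, s3)" t]
      by (auto simp: s \<delta>1'_def on1_def cob'_def ordered_tuples_iff strict_tuples_iff)
  qed
  ultimately show ?thesis by (simp add: incr_def)
qed

lemma incr_\<delta>2':
  assumes g: "g \<in> incr T"
  shows "\<delta>2' g \<in> incr T"
proof -
  let ?A = "ordered_tuples T \<times> ordered_tuples T :: ('a \<times> (real \<times> real \<times> real)) set"
  have "continuous_on ?A (\<lambda>x. g (fst x) (fst (snd x), snd (snd (snd x)))
      - g (fst x) (fst (snd x), fst (snd (snd x))) - g (fst x) (snd (snd x)))"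
    by (intro continuous_on_diff incr_compose[OF g] continuous_intros) (auto simp: ordered_tuples_iff)
  then have "continuous_on ?A (\<lambda>(s, t). \<delta>2' g s t)"
    by (simp add: \<delta>2'_def on2_def cob'_def case_prod_beta)
  moreover have "\<delta>2' g s t = 0" if "s \<in> ordered_tuples T" "t \<in> ordered_tuples T"
    "s \<notin> strict_tuples T \<or> t \<notin> strict_tuples T" for s t
  proof -
    obtain t1 t2 t3 where t: "t = (t1, t2, t3)" by (cases t)
    show ?thesis
      using that incr_zero[OF g, of s "(t1, t3)"] incr_zero[OF g, of s "(t1, t2)"] incr_zero[OF g, of s "(t2, t3)"]
      by (auto simp: t \<delta>2'_def on2_def cob'_def ordered_tuples_iff strict_tuples_iff)
  qed
  ultimately show ?thesis by (simp add: incr_def)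
qed

lemma \<delta>1'_eq: "\<delta>1' g (s1, s2, s3) t = g (s1, s3) t - g (s1, s2) t - g (s2, s3) t"
  by (simp add: \<delta>1'_def on1_def cob'_def)

lemma \<delta>2'_eq: "\<delta>2' g s (t1, t2, t3) = g s (t1, t3) - g s (t1, t2) - g s (t2, t3)"
  by (simp add: \<delta>2'_def on2_def cob'_def)

lemma abs_mult_le: "\<bar>p\<bar> \<le> A \<Longrightarrow> \<bar>q\<bar> \<le> B \<Longrightarrow> \<bar>p * q\<bar> \<le> A * B" for p q A B :: real
  unfolding abs_mult by (rule mult_mono) auto

lemma ordered_tuples_real: "(ordered_tuples T :: real set) = {0..T}"
  by (auto simp: ordered_tuples_def)

text \<open>For a function of two real variables, being an increment just means continuity on the square.\<close>

lemma incr_field_iff: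
  "(f :: real \<Rightarrow> real \<Rightarrow> real) \<in> incr T \<longleftrightarrow> continuous_on ({0..T} \<times> {0..T}) (\<lambda>(s, t). f s t)"
  by (auto simp: incr_def ordered_tuples_real strict_tuples_iff)

lemma \<delta>1_eq: "\<delta>1 f (s1, s2) t = f s2 t - f s1 t"
  and \<delta>2_eq: "\<delta>2 h s (t1, t2) = h s t2 - h s t1"
  and \<delta>_eq: "\<delta> f (s1, s2) (t1, t2) = f s2 t2 - f s2 t1 - (f s1 t2 - f s1 t1)"
  by (simp_all add: \<delta>_def \<delta>1_def on1_def cob_def \<delta>2_def on2_def)

lemma pair_not_strict:
  "s \<in> ordered_tuples T \<Longrightarrow> s \<notin> strict_tuples T \<Longrightarrow> snd s = fst s" for s :: "real \<times> real"
  by (cases s) (auto simp: ordered_tuples_iff strict_tuples_iff)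

lemma triple_not_strict:
  "t \<in> ordered_tuples T \<Longrightarrow> t \<notin> strict_tuples T \<Longrightarrow> fst t = fst (snd t) \<or> fst (snd t) = snd (snd t)"
  for t :: "real \<times> real \<times> real"
  by (cases t) (auto simp: ordered_tuples_iff strict_tuples_iff)

lemma field_compose:
  assumes "f \<in> incr T" "continuous_on A u" "continuous_on A v"
    and "\<And>x. x \<in> A \<Longrightarrow> u x \<in> {0..T}" "\<And>x. x \<in> A \<Longrightarrow> v x \<in> {0..T}"
  shows "continuous_on A (\<lambda>x. f (u x :: real) (v x :: real))"
  by (rule incr_compose[OF assms(1-3)]) (use assms in \<open>auto simp: ordered_tuples_real\<close>)

lemma field_mult: "f \<in> incr T \<Longrightarrow> h \<in> incr T \<Longrightarrow> (\<lambda>\<sigma> \<tau>. f \<sigma> \<tau> * h \<sigma> \<tau>) \<in> incr T"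
  for f h :: "real \<Rightarrow> real \<Rightarrow> real"
  unfolding incr_field_iff case_prod_beta by (rule continuous_on_mult)

lemma field_diff: "f \<in> incr T \<Longrightarrow> h \<in> incr T \<Longrightarrow> (\<lambda>\<sigma> \<tau>. f \<sigma> \<tau> - h \<sigma> \<tau>) \<in> incr T"
  for f h :: "real \<Rightarrow> real \<Rightarrow> real"
  unfolding incr_field_iff case_prod_beta by (rule continuous_on_diff)

lemma field_add: "f \<in> incr T \<Longrightarrow> h \<in> incr T \<Longrightarrow> (\<lambda>\<sigma> \<tau>. f \<sigma> \<tau> + h \<sigma> \<tau>) \<in> incr T"
  for f h :: "real \<Rightarrow> real \<Rightarrow> real"
  unfolding incr_field_iff case_prod_beta by (rule continuous_on_add)

lemma field_const: "(\<lambda>(\<sigma>::real) (\<tau>::real). c) \<in> incr T"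
  by (simp add: incr_field_iff case_prod_beta)

lemma field_s:
  fixes f :: "real \<Rightarrow> real \<Rightarrow> real"
  assumes "f \<in> incr T" "t \<in> {0..T}"
  shows "(\<lambda>\<sigma> (\<tau>::real). f \<sigma> t) \<in> incr T"
proof -
  have "continuous_on ({0..T} \<times> {0..T}) (\<lambda>x::real \<times> real. f (fst x) t)"
    using assms by (intro field_compose[OF assms(1)] continuous_intros) auto
  then show ?thesis by (simp add: incr_field_iff case_prod_beta)
qed

lemma field_t:
  fixes f :: "real \<Rightarrow> real \<Rightarrow> real"
  assumes "f \<in> incr T" "s \<in> {0..T}"
  shows "(\<lambda>(\<sigma>::real) \<tau>. f s \<tau>) \<in> incr T"
proof -
  have "continuous_on ({0..T} \<times> {0..T}) (\<lambda>x::real \<times> real. f s (snd x))"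
    using assms by (intro field_compose[OF assms(1)] continuous_intros) auto
  then show ?thesis by (simp add: incr_field_iff case_prod_beta)
qed

lemma field_bounded:
  fixes f :: "real \<Rightarrow> real \<Rightarrow> real"
  assumes "f \<in> incr T"
  obtains B where "0 \<le> B" "\<And>s t. s \<in> {0..T} \<Longrightarrow> t \<in> {0..T} \<Longrightarrow> \<bar>f s t\<bar> \<le> B"
proof -
  have "compact ((\<lambda>(s, t). f s t) ` ({0..T} \<times> {0..T}))"
    using assms by (intro compact_continuous_image compact_Times) (auto simp: incr_field_iff)
  then obtain B where "\<And>x. x \<in> (\<lambda>(s, t). f s t) ` ({0..T} \<times> {0..T}) \<Longrightarrow> norm x \<le> B"
    using compact_imp_bounded bounded_iff by metis
  then have "\<bar>f s t\<bar> \<le> max B 0" if "s \<in> {0..T}" "t \<in> {0..T}" for s t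
    using that by (fastforce simp: max.coboundedI1)
  then show ?thesis using that[of "max B 0"] by simp
qed

lemma incr_\<delta>:
  fixes f :: "real \<Rightarrow> real \<Rightarrow> real"
  assumes f: "f \<in> incr T"
  shows "\<delta>1 f \<in> incr T" "\<delta>2 f \<in> incr T" "\<delta> f \<in> incr T"
proof -
  have "continuous_on (ordered_tuples T \<times> ordered_tuples T)
      (\<lambda>x. f (snd (fst x)) (snd x) - f (fst (fst x)) (snd x))"
    by (intro continuous_on_diff field_compose[OF f] continuous_intros)
       (auto simp: ordered_tuples_iff)
  then show "\<delta>1 f \<in> incr T"
    by (auto simp: incr_def \<delta>1_def on1_def cob_def case_prod_beta ordered_tuples_iff strict_tuples_iff)
  have "continuous_on (ordered_tuples T \<times> ordered_tuples T)
      (\<lambda>x. f (fst x) (snd (snd x)) - f (fst x) (fst (snd x)))"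
    by (intro continuous_on_diff field_compose[OF f] continuous_intros)
       (auto simp: ordered_tuples_iff)
  then show "\<delta>2 f \<in> incr T"
    by (auto simp: incr_def \<delta>2_def on2_def cob_def case_prod_beta ordered_tuples_iff strict_tuples_iff)
  have "continuous_on (ordered_tuples T \<times> ordered_tuples T)
      (\<lambda>x. f (snd (fst x)) (snd (snd x)) - f (snd (fst x)) (fst (snd x))
        - (f (fst (fst x)) (snd (snd x)) - f (fst (fst x)) (fst (snd x))))"
    by (intro continuous_on_diff field_compose[OF f] continuous_intros)
       (auto simp: ordered_tuples_iff)
  moreover have "\<delta> f s t = 0" if "s \<in> ordered_tuples T" "t \<in> ordered_tuples T"
    "s \<notin> strict_tuples T \<or> t \<notin> strict_tuples T" for s t
    using that pair_not_strict[of s T] pair_not_strict[of t T] by (cases s; cases t) (auto simp: \<delta>_eq)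
  ultimately show "\<delta> f \<in> incr T"
    by (simp add: incr_def case_prod_beta \<delta>_def \<delta>1_def on1_def cob_def \<delta>2_def on2_def)
qed

lemma SUP_ennreal_bounded:
  assumes "(SUP p\<in>A. ennreal (F p)) < \<infinity>"
  obtains C where "0 \<le> C" "\<And>p. p \<in> A \<Longrightarrow> F p \<le> C"
proof -
  define C where "C = enn2real (SUP p\<in>A. ennreal (F p))"
  have C: "0 \<le> C" "(SUP p\<in>A. ennreal (F p)) = ennreal C" using assms by (simp_all add: C_def)
  have "F p \<le> C" if "p \<in> A" for p
  proof -
    have "ennreal (F p) \<le> ennreal C" unfolding C(2)[symmetric] using that by (rule SUP_upper)
    then show ?thesis using C(1) by simp
  qed
  with C show ?thesis by (intro that)
qed

lemma holderD:
  fixes f :: "'s::tuple \<Rightarrow> 't::tuple \<Rightarrow> real"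
  assumes f: "f \<in> holder T a b"
    and pos: "\<And>s::'s. s \<in> strict_tuples T \<Longrightarrow> 0 < width s" "\<And>t::'t. t \<in> strict_tuples T \<Longrightarrow> 0 < width t"
  shows "\<exists>C\<ge>0. \<forall>s\<in>ordered_tuples T. \<forall>t\<in>ordered_tuples T.
      \<bar>f s t\<bar> \<le> C * width s powr a * width t powr b"
proof -
  have i: "f \<in> incr T" and fin: "hnorm T a b f < \<infinity>" using f by (auto simp: holder_def)
  obtain C where C: "0 \<le> C" "\<And>p. p \<in> strict_tuples T \<times> strict_tuples T \<Longrightarrow>
      \<bar>f (fst p) (snd p)\<bar> / (width (fst p) powr a * width (snd p) powr b) \<le> C"
    using SUP_ennreal_bounded[OF fin[unfolded hnorm_def case_prod_beta]] by blast
  have "\<bar>f s t\<bar> \<le> C * width s powr a * width t powr b"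
    if o: "s \<in> ordered_tuples T" "t \<in> ordered_tuples T" for s t
  proof (cases "s \<in> strict_tuples T \<and> t \<in> strict_tuples T")
    case True
    then have "0 < width s powr a * width t powr b" using pos(1)[of s] pos(2)[of t] by simp
    then show ?thesis using C(2)[of "(s, t)"] True by (simp add: divide_le_eq mult.assoc)
  next
    case False
    then show ?thesis using incr_zero[OF i o] C(1) by auto
  qed
  then show ?thesis using C(1) by blast
qed

lemma holder22D:
  fixes f :: "real \<times> real \<Rightarrow> real \<times> real \<Rightarrow> real"
  assumes "f \<in> holder T a b"
  shows "\<exists>C\<ge>0. \<forall>s\<in>ordered_tuples T. \<forall>t\<in>ordered_tuples T. \<bar>f s t\<bar> \<le> C * width s powr a * width t powr b"
  by (rule holderD[OF assms width_pos(1)[of _ T] width_pos(1)[of _ T]])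

lemma holder23D:
  fixes f :: "real \<times> real \<Rightarrow> real \<times> real \<times> real \<Rightarrow> real"
  assumes "f \<in> holder T a b"
  shows "\<exists>C\<ge>0. \<forall>s\<in>ordered_tuples T. \<forall>t\<in>ordered_tuples T. \<bar>f s t\<bar> \<le> C * width s powr a * width t powr b"
  by (rule holderD[OF assms width_pos(1)[of _ T] width_pos(2)[of _ T]])

lemma holder1D:
  assumes "f \<in> holder1 T a"
  obtains C where "0 \<le> C" "\<And>s t. s \<in> ordered_tuples T \<Longrightarrow> t \<in> {0..T} \<Longrightarrow> \<bar>f s t\<bar> \<le> C * width s powr a"
proof -
  have i: "f \<in> incr T" and fin: "hnorm1 T a f < \<infinity>" using assms by (auto simp: holder1_def)
  obtain C where C: "0 \<le> C"
    "\<And>p. p \<in> strict_tuples T \<times> {0..T} \<Longrightarrow> \<bar>f (fst p) (snd p)\<bar> / width (fst p) powr a \<le> C"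
    using SUP_ennreal_bounded[OF fin[unfolded hnorm1_def case_prod_beta]] by blast
  have "\<bar>f s t\<bar> \<le> C * width s powr a" if "s \<in> ordered_tuples T" "t \<in> {0..T}" for s t
  proof (cases "s \<in> strict_tuples T")
    case True
    then show ?thesis using C(2)[of "(s, t)"] that width_pos(1)[of s T] by (simp add: divide_le_eq)
  next
    case False
    then show ?thesis using incr_zero[OF i that(1), of t] that C(1) by (simp add: ordered_tuples_real)
  qed
  then show ?thesis using C(1) that by blast
qed

lemma holder2D:
  assumes "f \<in> holder2 T b"
  obtains C where "0 \<le> C" "\<And>s t. s \<in> {0..T} \<Longrightarrow> t \<in> ordered_tuples T \<Longrightarrow> \<bar>f s t\<bar> \<le> C * width t powr b"
proof -
  have i: "f \<in> incr T" and fin: "hnorm2 T b f < \<infinity>" using assms by (auto simp: holder2_def)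
  obtain C where C: "0 \<le> C"
    "\<And>p. p \<in> {0..T} \<times> strict_tuples T \<Longrightarrow> \<bar>f (fst p) (snd p)\<bar> / width (snd p) powr b \<le> C"
    using SUP_ennreal_bounded[OF fin[unfolded hnorm2_def case_prod_beta]] by blast
  have "\<bar>f s t\<bar> \<le> C * width t powr b" if "s \<in> {0..T}" "t \<in> ordered_tuples T" for s t
  proof (cases "t \<in> strict_tuples T")
    case True
    then show ?thesis using C(2)[of "(s, t)"] that width_pos(1)[of t T] by (simp add: divide_le_eq)
  next
    case False
    then show ?thesis using incr_zero[OF i _ that(2), of s] that C(1) by (simp add: ordered_tuples_real)
  qed
  then show ?thesis using C(1) that by blast
qed

lemma holder1I:
  assumes "f \<in> incr T" "0 \<le> C"
    and "\<And>s t. s \<in> ordered_tuples T \<Longrightarrow> t \<in> {0..T} \<Longrightarrow> \<bar>f s t\<bar> \<le> C * width s powr a"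
  shows "f \<in> holder1 T a"
proof -
  have "\<bar>f s t\<bar> / width s powr a \<le> C" if "s \<in> strict_tuples T" "t \<in> {0..T}" for s t
    using assms(3)[of s t] that width_pos(1)[of s T] by (simp add: divide_le_eq strict_tuples_def)
  then have "hnorm1 T a f \<le> ennreal C"
    unfolding hnorm1_def by (intro SUP_least) (auto intro!: ennreal_leI)
  then have "hnorm1 T a f < \<infinity>" by (rule le_less_trans) simp
  with assms show ?thesis by (simp add: holder1_def)
qed

lemma holder2I:
  assumes "f \<in> incr T" "0 \<le> C"
    and "\<And>s t. s \<in> {0..T} \<Longrightarrow> t \<in> ordered_tuples T \<Longrightarrow> \<bar>f s t\<bar> \<le> C * width t powr b"
  shows "f \<in> holder2 T b"
proof -
  have "\<bar>f s t\<bar> / width t powr b \<le> C" if "s \<in> {0..T}" "t \<in> strict_tuples T" for s t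
    using assms(3)[of s t] that width_pos(1)[of t T] by (simp add: divide_le_eq strict_tuples_def)
  then have "hnorm2 T b f \<le> ennreal C"
    unfolding hnorm2_def by (intro SUP_least) (auto intro!: ennreal_leI)
  then have "hnorm2 T b f < \<infinity>" by (rule le_less_trans) simp
  with assms show ?thesis by (simp add: holder2_def)
qed

lemma holder_field_split:
  assumes "f \<in> holder_field T a b"
  shows "f \<in> incr T" "\<delta> f \<in> holder T a b" "\<delta>1 f \<in> holder1 T a" "\<delta>2 f \<in> holder2 T b"
  using assms incr_\<delta>[of f T] by (auto simp: holder_field_def field_norm_def holder_def holder1_def holder2_def)

text \<open>The sup bound and the three Hoelder bounds of a field, with a common constant.\<close>

definition field_bounded_by :: "real \<Rightarrow> real \<Rightarrow> real \<Rightarrow> real \<Rightarrow> (real \<Rightarrow> real \<Rightarrow> real) \<Rightarrow> bool" where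
  "field_bounded_by T a b C f \<longleftrightarrow> 0 \<le> C \<and> (\<forall>s\<in>{0..T}. \<forall>t\<in>{0..T}. \<bar>f s t\<bar> \<le> C) \<and>
     (\<forall>s\<in>ordered_tuples T. \<forall>t\<in>ordered_tuples T. \<bar>\<delta> f s t\<bar> \<le> C * width s powr a * width t powr b) \<and>
     (\<forall>s\<in>ordered_tuples T. \<forall>t\<in>{0..T}. \<bar>\<delta>1 f s t\<bar> \<le> C * width s powr a) \<and>
     (\<forall>s\<in>{0..T}. \<forall>t\<in>ordered_tuples T. \<bar>\<delta>2 f s t\<bar> \<le> C * width t powr b)"

lemma field_bounded_byD:
  assumes "field_bounded_by T a b C f"
  shows "0 \<le> C" "s \<in> {0..T} \<Longrightarrow> t \<in> {0..T} \<Longrightarrow> \<bar>f s t\<bar> \<le> C"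
    "u \<in> ordered_tuples T \<Longrightarrow> v \<in> ordered_tuples T \<Longrightarrow> \<bar>\<delta> f u v\<bar> \<le> C * width u powr a * width v powr b"
    "u \<in> ordered_tuples T \<Longrightarrow> t \<in> {0..T} \<Longrightarrow> \<bar>\<delta>1 f u t\<bar> \<le> C * width u powr a"
    "s \<in> {0..T} \<Longrightarrow> v \<in> ordered_tuples T \<Longrightarrow> \<bar>\<delta>2 f s v\<bar> \<le> C * width v powr b"
  using assms unfolding field_bounded_by_def by blast+

lemma holder_field_bounded:
  assumes f: "f \<in> holder_field T a b"
  shows "\<exists>C. field_bounded_by T a b C f"
proof -
  note h = holder_field_split[OF f]
  obtain C0 where C0: "0 \<le> C0" "\<And>s t. s \<in> {0..T} \<Longrightarrow> t \<in> {0..T} \<Longrightarrow> \<bar>f s t\<bar> \<le> C0"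
    using field_bounded[OF h(1)] by blast
  obtain C1 where C1: "0 \<le> C1" "\<And>s t. s \<in> ordered_tuples T \<Longrightarrow> t \<in> ordered_tuples T \<Longrightarrow>
      \<bar>\<delta> f s t\<bar> \<le> C1 * width s powr a * width t powr b"
    using holder22D[OF h(2)] by blast
  obtain C2 where C2: "0 \<le> C2" "\<And>s t. s \<in> ordered_tuples T \<Longrightarrow> t \<in> {0..T} \<Longrightarrow> \<bar>\<delta>1 f s t\<bar> \<le> C2 * width s powr a"
    using holder1D[OF h(3)] by blast
  obtain C3 where C3: "0 \<le> C3" "\<And>s t. s \<in> {0..T} \<Longrightarrow> t \<in> ordered_tuples T \<Longrightarrow> \<bar>\<delta>2 f s t\<bar> \<le> C3 * width t powr b"
    using holder2D[OF h(4)] by blast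
  define C where "C = C0 + C1 + C2 + C3"
  have C: "0 \<le> C" "C0 \<le> C" "C1 \<le> C" "C2 \<le> C" "C3 \<le> C" using C0 C1 C2 C3 by (auto simp: C_def)
  have le: "C' * u \<le> C * u" if "C' \<le> C" "0 \<le> u" for C' u using that by (rule mult_right_mono)
  have "field_bounded_by T a b C f"
    unfolding field_bounded_by_def
  proof (intro conjI ballI)
    fix s t :: real assume "s \<in> {0..T}" "t \<in> {0..T}"
    then show "\<bar>f s t\<bar> \<le> C" using C0(2) C(2) by fastforce
  next
    fix s t :: "real \<times> real" assume "s \<in> ordered_tuples T" "t \<in> ordered_tuples T"
    then show "\<bar>\<delta> f s t\<bar> \<le> C * width s powr a * width t powr b"
      using C1(2)[of s t] le[OF C(3), of "width s powr a * width t powr b"] by (simp add: mult.assoc)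
  next
    fix s :: "real \<times> real" and t :: real assume "s \<in> ordered_tuples T" "t \<in> {0..T}"
    then show "\<bar>\<delta>1 f s t\<bar> \<le> C * width s powr a"
      using C2(2)[of s t] le[OF C(4), of "width s powr a"] by simp
  next
    fix t :: "real \<times> real" and s :: real assume "t \<in> ordered_tuples T" "s \<in> {0..T}"
    then show "\<bar>\<delta>2 f s t\<bar> \<le> C * width t powr b"
      using C3(2)[of s t] le[OF C(5), of "width t powr b"] by simp
  qed (rule C(1))
  then show ?thesis ..
qed

section \<open>Two-parameter sewing\<close>

text \<open>Two-parameter germs: the exponents \<open>\<alpha>\<close>, \<open>\<beta>\<close> replace \<open>a\<close>, \<open>b\<close> in those variables in which a coboundary
  is taken.\<close>

locale germ2d =
  fixes T a b \<alpha> \<beta> C :: real and g :: "real \<times> real \<Rightarrow> real \<times> real \<Rightarrow> real"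
  assumes T: "0 < T" and exps: "0 < a" "a \<le> \<alpha>" "1 < \<alpha>" "0 < b" "b \<le> \<beta>" "1 < \<beta>" and C: "0 \<le> C"
    and g: "g \<in> incr T"
    and bound0: "\<And>s t. s \<in> ordered_tuples T \<Longrightarrow> t \<in> ordered_tuples T \<Longrightarrow>
      \<bar>g s t\<bar> \<le> C * width s powr a * width t powr b"
    and bound1: "\<And>s t. s \<in> ordered_tuples T \<Longrightarrow> t \<in> ordered_tuples T \<Longrightarrow>
      \<bar>\<delta>1' g s t\<bar> \<le> C * width s powr \<alpha> * width t powr b"
    and bound2: "\<And>s t. s \<in> ordered_tuples T \<Longrightarrow> t \<in> ordered_tuples T \<Longrightarrow>
      \<bar>\<delta>2' g s t\<bar> \<le> C * width s powr a * width t powr \<beta>"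
    and bound12: "\<And>s t. s \<in> ordered_tuples T \<Longrightarrow> t \<in> ordered_tuples T \<Longrightarrow>
      \<bar>\<delta>' g s t\<bar> \<le> C * width s powr \<alpha> * width t powr \<beta>"
begin

text \<open>\<open>J2\<close> is the integral of the germ in the \<open>t\<close>-variables, \<open>J12\<close> the integral of \<open>J2\<close> in the \<open>s\<close>-variables.
  \<open>R2 = \<Lambda>2 \<delta>2 g\<close> is the remainder of the first integration, and \<open>JR\<close> its integral in the \<open>s\<close>-variables.\<close>

definition J2 :: "real \<times> real \<Rightarrow> real \<times> real \<Rightarrow> real" where
  "J2 s t = sew_int (g s) t"

definition J12 :: "real \<times> real \<Rightarrow> real \<times> real \<Rightarrow> real" where
  "J12 s t = sew_int (\<lambda>s. J2 s t) s"

definition R2 :: "real \<times> real \<Rightarrow> real \<times> real \<Rightarrow> real" where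
  "R2 s t = g s t - J2 s t"

definition JR :: "real \<times> real \<Rightarrow> real \<times> real \<Rightarrow> real" where
  "JR s t = sew_int (\<lambda>s. R2 s t) s"

lemma sew_const_pos: "0 < sew_const \<alpha>" "0 < sew_const \<beta>"
  using exps sew_ratio by auto

lemma powr_le_T:
  fixes w :: "real \<times> real"
  assumes "w \<in> ordered_tuples T" "0 \<le> e"
  shows "width w powr e \<le> T powr e"
  using width_le[OF assms(1)] assms(2) by (intro powr_mono2) auto

lemma cob'_\<delta>1': "cob' (\<delta>1' g s) t = \<delta>' g s t"
  by (cases s; cases t) (simp add: \<delta>'_def \<delta>1'_eq \<delta>2'_eq cob'_eq)

lemma germ_t:
  assumes "s \<in> ordered_tuples T"
  shows "sewing_germ T (C * width s powr a) \<beta> (g s)"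
  using bound2[OF assms] C exps by (auto simp: sewing_germ_def \<delta>2'_def on2_def)

lemma germ_t1:
  assumes "s \<in> ordered_tuples T"
  shows "sewing_germ T (C * width s powr \<alpha>) \<beta> (\<delta>1' g s)"
  using bound12[OF assms] C exps by (auto simp: sewing_germ_def cob'_\<delta>1')

lemma g_cont_t: "s \<in> ordered_tuples T \<Longrightarrow> continuous_on (ordered_tuples T) (g s)"
  by (intro incr_compose[OF g] continuous_intros)

lemma g_cont_s: "t \<in> ordered_tuples T \<Longrightarrow> continuous_on (ordered_tuples T) (\<lambda>s. g s t)"
  by (intro incr_compose[OF g] continuous_intros)

lemma triple_pairs:
  assumes "(s1::real, s2::real, s3::real) \<in> ordered_tuples T"
  shows "(s1, s3) \<in> ordered_tuples T" "(s1, s2) \<in> ordered_tuples T" "(s2, s3) \<in> ordered_tuples T"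
  using assms by (auto simp: ordered_tuples_iff)

lemma \<delta>1'_J2:
  assumes "s \<in> ordered_tuples T" "t \<in> ordered_tuples T"
  shows "\<delta>1' J2 s t = sew_int (\<delta>1' g s) t"
proof -
  obtain s1 s2 s3 where s: "s = (s1, s2, s3)" by (cases s)
  show ?thesis
    using sew_int_diff2[OF germ_t germ_t germ_t assms(2), of "(s1, s3)" "(s1, s2)" "(s2, s3)"]
      triple_pairs assms(1)[unfolded s]
    by (simp add: s \<delta>1'_eq[abs_def] J2_def)
qed

lemma R2_bound:
  assumes "s \<in> ordered_tuples T" "t \<in> ordered_tuples T"
  shows "\<bar>R2 s t\<bar> \<le> C * sew_const \<beta> * width s powr a * width t powr \<beta>"
  using sew_int_bound[OF germ_t assms(2)] assms(1) by (simp add: R2_def J2_def mult_ac)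

lemma \<delta>1'_R2: "\<delta>1' R2 s t = \<delta>1' g s t - \<delta>1' J2 s t"
  by (cases s) (simp add: \<delta>1'_eq R2_def)

lemma \<delta>1'_R2_bound:
  assumes "s \<in> ordered_tuples T" "t \<in> ordered_tuples T"
  shows "\<bar>\<delta>1' R2 s t\<bar> \<le> C * sew_const \<beta> * width s powr \<alpha> * width t powr \<beta>"
  using sew_int_bound[OF germ_t1 assms(2)] assms by (simp add: \<delta>1'_R2 \<delta>1'_J2 mult_ac)

text \<open>A constant for the bounds on \<open>J2\<close> and \<open>\<delta>1 J2\<close> that result from lowering the exponent \<open>\<beta>\<close> to \<open>b\<close>.\<close>

definition K where "K = C + C * sew_const \<beta> * T powr (\<beta> - b)"

lemma K: "0 \<le> K"
  using C sew_const_pos by (simp add: K_def)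

lemma weaken_t:
  fixes t :: "real \<times> real"
  assumes "t \<in> ordered_tuples T" "0 \<le> w" "\<bar>u\<bar> \<le> C * w * width t powr b"
    "\<bar>u - v\<bar> \<le> C * sew_const \<beta> * w * width t powr \<beta>"
  shows "\<bar>v\<bar> \<le> K * w * width t powr b"
proof -
  have "C * sew_const \<beta> * w * width t powr \<beta> \<le> C * sew_const \<beta> * w * (T powr (\<beta> - b) * width t powr b)"
    using width_le[OF assms(1)] exps C sew_const_pos assms(2) by (intro mult_left_mono powr_weaken) auto
  with assms have "\<bar>v\<bar> \<le> C * w * width t powr b + C * sew_const \<beta> * w * (T powr (\<beta> - b) * width t powr b)"
    by linarith
  also have "\<dots> = K * w * width t powr b" by (simp add: K_def algebra_simps)
  finally show ?thesis .
qed

lemma J2_bound: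
  assumes "s \<in> ordered_tuples T" "t \<in> ordered_tuples T"
  shows "\<bar>J2 s t\<bar> \<le> K * width s powr a * width t powr b"
  by (rule weaken_t[OF assms(2) _ bound0[OF assms]]) (use R2_bound[OF assms] in \<open>simp_all add: R2_def\<close>)

lemma \<delta>1'_J2_bound:
  assumes "s \<in> ordered_tuples T" "t \<in> ordered_tuples T"
  shows "\<bar>\<delta>1' J2 s t\<bar> \<le> K * width s powr \<alpha> * width t powr b"
  by (rule weaken_t[OF assms(2) _ bound1[OF assms]]) (use \<delta>1'_R2_bound[OF assms] in \<open>simp_all add: \<delta>1'_R2\<close>)

lemma germ_s:
  assumes "t \<in> ordered_tuples T"
  shows "sewing_germ T (C * width t powr b) \<alpha> (\<lambda>s. g s t)"
  using bound1[OF _ assms] C exps by (auto simp: sewing_germ_def \<delta>1'_def on1_def mult_ac)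

lemma germ_J2:
  assumes "t \<in> ordered_tuples T"
  shows "sewing_germ T (K * width t powr b) \<alpha> (\<lambda>s. J2 s t)"
  using \<delta>1'_J2_bound[OF _ assms] K exps by (auto simp: sewing_germ_def \<delta>1'_def on1_def mult_ac)

lemma germ_R2:
  assumes "t \<in> ordered_tuples T"
  shows "sewing_germ T (C * sew_const \<beta> * width t powr \<beta>) \<alpha> (\<lambda>s. R2 s t)"
  using \<delta>1'_R2_bound[OF _ assms] C sew_const_pos exps by (auto simp: sewing_germ_def \<delta>1'_def on1_def mult_ac)

lemma sewing_germ_mono:
  assumes "sewing_germ T C' \<mu> h" "C' \<le> D"
  shows "sewing_germ T D \<mu> h"
  using assms unfolding sewing_germ_def
  by (auto intro: order_trans[OF _ mult_right_mono[OF assms(2)]])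

lemma J2_continuous: "continuous_on (ordered_tuples T \<times> ordered_tuples T) (\<lambda>(s, t). J2 s t)"
  unfolding J2_def
proof (rule sew_int_continuous[OF incr_continuous[OF g]])
  fix s :: "real \<times> real" assume s: "s \<in> ordered_tuples T"
  then show "sewing_germ T (C * T powr a) \<beta> (g s)"
    using C exps powr_le_T by (intro sewing_germ_mono[OF germ_t] mult_left_mono) auto
qed

lemma J2_cont_s:
  assumes "t \<in> ordered_tuples T"
  shows "continuous_on (ordered_tuples T) (\<lambda>s. J2 s t)"
proof -
  have "continuous_on (ordered_tuples T) ((\<lambda>(s, t). J2 s t) \<circ> (\<lambda>s. (s, t)))"
    using assms by (intro continuous_on_compose continuous_on_subset[OF J2_continuous] continuous_intros) auto
  then show ?thesis by (simp add: o_def)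
qed

lemma R2_cont_s: "t \<in> ordered_tuples T \<Longrightarrow> continuous_on (ordered_tuples T) (\<lambda>s. R2 s t)"
  unfolding R2_def by (intro continuous_on_diff g_cont_s J2_cont_s)

lemma J12_continuous: "continuous_on (ordered_tuples T \<times> ordered_tuples T) (\<lambda>(s, t). J12 s t)"
proof -
  have "continuous_on (ordered_tuples T \<times> ordered_tuples T) ((\<lambda>(s, t). J2 s t) \<circ> prod.swap)"
    by (intro continuous_on_compose continuous_on_subset[OF J2_continuous] continuous_on_swap) auto
  then have "continuous_on (ordered_tuples T \<times> ordered_tuples T) (\<lambda>(t, s). J2 s t)"
    by (simp add: o_def case_prod_beta)
  moreover have "sewing_germ T (K * T powr b) \<alpha> (\<lambda>s. J2 s t)" if "t \<in> ordered_tuples T" for t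
    using K exps powr_le_T that by (intro sewing_germ_mono[OF germ_J2] mult_left_mono) auto
  ultimately have "continuous_on (ordered_tuples T \<times> ordered_tuples T) (\<lambda>(t, s). J12 s t)"
    unfolding J12_def by (rule sew_int_continuous)
  then have "continuous_on (ordered_tuples T \<times> ordered_tuples T) ((\<lambda>(t, s). J12 s t) \<circ> prod.swap)"
    by (intro continuous_on_compose continuous_on_swap) (auto elim!: continuous_on_subset)
  then show ?thesis by (simp add: o_def case_prod_beta)
qed

lemma J12_near:
  assumes "s \<in> ordered_tuples T" "t \<in> ordered_tuples T"
  shows "\<bar>J2 s t - J12 s t\<bar> \<le> K * sew_const \<alpha> * width s powr \<alpha> * width t powr b"
  using sew_int_bound[OF germ_J2 assms(1), OF assms(2)] by (simp add: J12_def mult_ac)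

lemma JR_near:
  assumes "s \<in> ordered_tuples T" "t \<in> ordered_tuples T"
  shows "\<bar>R2 s t - JR s t\<bar> \<le> C * sew_const \<beta> * sew_const \<alpha> * width s powr \<alpha> * width t powr \<beta>"
  using sew_int_bound[OF germ_R2 assms(1), OF assms(2)] by (simp add: JR_def mult_ac)

lemma J12_additive_s:
  assumes "t \<in> ordered_tuples T" "0 \<le> s1" "s1 \<le> s2" "s2 \<le> s3" "s3 \<le> T"
  shows "J12 (s1, s3) t = J12 (s1, s2) t + J12 (s2, s3) t"
  unfolding J12_def using assms by (intro sew_int_additive[OF germ_J2 J2_cont_s])

lemma JR_additive_s:
  assumes "t \<in> ordered_tuples T" "0 \<le> s1" "s1 \<le> s2" "s2 \<le> s3" "s3 \<le> T"
  shows "JR (s1, s3) t = JR (s1, s2) t + JR (s2, s3) t"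
  unfolding JR_def using assms by (intro sew_int_additive[OF germ_R2 R2_cont_s])

lemma J2_additive_t:
  assumes "s \<in> ordered_tuples T" "0 \<le> t1" "t1 \<le> t2" "t2 \<le> t3" "t3 \<le> T"
  shows "J2 s (t1, t3) = J2 s (t1, t2) + J2 s (t2, t3)"
  unfolding J2_def using assms by (intro sew_int_additive[OF germ_t g_cont_t])

lemma J12_additive_t:
  assumes s: "s \<in> ordered_tuples T" and t: "0 \<le> t1" "t1 \<le> t2" "t2 \<le> t3" "t3 \<le> T"
  shows "J12 s (t1, t3) = J12 s (t1, t2) + J12 s (t2, t3)"
proof -
  have o: "(t1, t3) \<in> ordered_tuples T" "(t1, t2) \<in> ordered_tuples T" "(t2, t3) \<in> ordered_tuples T"
    using t by (auto simp: ordered_tuples_iff)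
  have "sew_int (\<lambda>s. J2 s (t1, t3) - J2 s (t1, t2)) s = sew_int (\<lambda>s. J2 s (t2, t3)) s"
    unfolding sew_int_def using J2_additive_t[OF _ t]
    by (intro arg_cong[where f = lim] ext eq_sum_cong[OF _ s]) auto
  then show ?thesis
    using sew_int_diff[OF germ_J2 germ_J2 s, OF o(1,2)] by (simp add: J12_def)
qed

lemma J12_bound:
  assumes "s \<in> ordered_tuples T" "t \<in> ordered_tuples T"
  shows "\<bar>J12 s t\<bar> \<le> (K + K * sew_const \<alpha> * T powr (\<alpha> - a)) * width s powr a * width t powr b"
proof -
  have "K * sew_const \<alpha> * width s powr \<alpha> * width t powr b
      \<le> K * sew_const \<alpha> * (T powr (\<alpha> - a) * width s powr a) * width t powr b"
    using width_le[OF assms(1)] exps K sew_const_pos by (intro mult_left_mono mult_right_mono powr_weaken) auto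
  then have "\<bar>J12 s t\<bar> \<le> K * width s powr a * width t powr b
      + K * sew_const \<alpha> * (T powr (\<alpha> - a) * width s powr a) * width t powr b"
    using J2_bound[OF assms] J12_near[OF assms] by linarith
  then show ?thesis by (simp add: algebra_simps)
qed

lemma JR_eq:
  assumes "s \<in> ordered_tuples T" "t \<in> ordered_tuples T"
  shows "JR s t = sew_int (\<lambda>s. g s t) s - J12 s t"
  unfolding JR_def R2_def J12_def by (rule sew_int_diff[OF germ_s germ_J2]) (use assms in auto)

text \<open>The increment to which \<open>\<Lambda>1\<close> is applied in the last term of \<open>sew2d\<close> is again a coboundary, because
  \<open>sew_int\<close> is linear.\<close>

lemma \<Lambda>2_\<delta>':
  assumes "s \<in> ordered_tuples T" "t \<in> ordered_tuples T"
  shows "\<Lambda>2 T (\<delta>' g) s t = \<delta>1' R2 s t"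
  unfolding \<Lambda>2_def on2_def
  using sews_cob'(2)[OF germ_t1 _ cob'_\<delta>1'[symmetric], OF assms(1) _ assms(2)] assms
    incr_compose[OF incr_\<delta>1'[OF g], of "ordered_tuples T" "\<lambda>_. s" "\<lambda>t. t"]
  by (simp add: \<delta>1'_R2 \<delta>1'_J2)

lemma sewable:
  "sewable1 T (\<delta>1' g)" "sewable2 T (\<delta>2' g)" "sewable2 T (\<delta>' g)" "sewable1 T (\<Lambda>2 T (\<delta>' g))"
proof -
  show "sewable1 T (\<delta>1' g)" "sewable2 T (\<delta>2' g)"
    unfolding sewable1_def sewable2_def \<delta>1'_def on1_def \<delta>2'_def on2_def
    by (intro ballI sews_cob'(1)[OF germ_s g_cont_s] sews_cob'(1)[OF germ_t g_cont_t]; simp)+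
  show "sewable2 T (\<delta>' g)"
    unfolding sewable2_def
  proof
    fix s :: "real \<times> real \<times> real" assume s: "s \<in> ordered_tuples T"
    show "\<exists>!F. sews T (\<delta>' g s) F"
      by (rule sews_cob'(1)[OF germ_t1[OF s] incr_compose[OF incr_\<delta>1'[OF g]]])
        (use s in \<open>auto intro!: continuous_intros simp: cob'_\<delta>1'\<close>)
  qed
  show "sewable1 T (\<Lambda>2 T (\<delta>' g))"
    unfolding sewable1_def
  proof
    fix t :: "real \<times> real" assume t: "t \<in> ordered_tuples T"
    show "\<exists>!F. sews T (\<lambda>s. \<Lambda>2 T (\<delta>' g) s t) F"
    proof (rule sews_cob'(1)[OF germ_R2[OF t] R2_cont_s[OF t]])
      fix u :: "real \<times> real \<times> real" assume "u \<in> ordered_tuples T"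
      then show "\<Lambda>2 T (\<delta>' g) u t = cob' (\<lambda>s. R2 s t) u"
        by (simp only: \<Lambda>2_\<delta>'[OF _ t]) (simp add: \<delta>1'_def on1_def)
    qed
  qed
qed

lemma sew2d_eq:
  assumes "s \<in> ordered_tuples T" "t \<in> ordered_tuples T"
  shows "sew2d T g s t = J12 s t"
proof -
  have "\<Lambda>1 T (\<delta>1' g) s t = g s t - sew_int (\<lambda>s. g s t) s"
    unfolding \<Lambda>1_def on1_def
    by (rule sews_cob'(2)[OF germ_s[OF assms(2)] g_cont_s[OF assms(2)] _ assms(1)]) (simp add: \<delta>1'_def on1_def)
  moreover have "\<Lambda>2 T (\<delta>2' g) s t = R2 s t"
    unfolding \<Lambda>2_def on2_def R2_def J2_def
    by (rule sews_cob'(2)[OF germ_t[OF assms(1)] g_cont_t[OF assms(1)] _ assms(2)]) (simp add: \<delta>2'_def on2_def)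
  moreover have "\<Lambda>1 T (\<Lambda>2 T (\<delta>' g)) s t = R2 s t - JR s t"
    unfolding \<Lambda>1_def on1_def JR_def
  proof (rule sews_cob'(2)[OF germ_R2[OF assms(2)] R2_cont_s[OF assms(2)] _ assms(1)])
    fix u :: "real \<times> real \<times> real" assume "u \<in> ordered_tuples T"
    then show "\<Lambda>2 T (\<delta>' g) u t = cob' (\<lambda>s. R2 s t) u"
      by (simp only: \<Lambda>2_\<delta>'[OF _ assms(2)]) (simp add: \<delta>1'_def on1_def)
  qed
  ultimately show ?thesis by (simp add: sew2d_def JR_eq[OF assms] )
qed

lemma sew2d_holder: "sew2d T g \<in> holder T a b"
proof (rule holderI)
  show B: "\<bar>sew2d T g s t\<bar> \<le> (K + K * sew_const \<alpha> * T powr (\<alpha> - a)) * width s powr a * width t powr b"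
    if "s \<in> ordered_tuples T" "t \<in> ordered_tuples T" for s t
    using J12_bound[OF that] by (simp add: sew2d_eq[OF that])
  show "0 \<le> K + K * sew_const \<alpha> * T powr (\<alpha> - a)" using K sew_const_pos by simp
  have "continuous_on (ordered_tuples T \<times> ordered_tuples T) (\<lambda>(s, t). sew2d T g s t)"
    by (rule continuous_on_eq[OF J12_continuous]) (auto simp: sew2d_eq)
  moreover have "sew2d T g s t = 0" if o: "s \<in> ordered_tuples T" "t \<in> ordered_tuples T"
    "s \<notin> strict_tuples T \<or> t \<notin> strict_tuples T" for s t
  proof -
    have "width s = 0 \<or> width t = 0"
      using o by (cases s; cases t) (auto simp: ordered_tuples_iff strict_tuples_iff width_simps)
    then show ?thesis using B[OF o(1,2)] exps by auto
  qed
  ultimately show "sew2d T g \<in> incr T" by (simp add: incr_def)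
qed

lemma well_defined: "sew2d_well_defined T g"
proof -
  \<comment> \<open>The exponents written \<open>*\<close> must lie strictly between 0 and 1, whereas \<open>a\<close> and \<open>b\<close> may be larger.\<close>
  define c where "c = min b (1/2)"
  define d where "d = min a (1/2)"
  have cd: "0 < c" "c < 1" "c \<le> b" "0 < d" "d < 1" "d \<le> a" using exps by (auto simp: c_def d_def)
  have "\<delta>1' g \<in> holder T \<alpha> c"
  proof (rule holderI[OF incr_\<delta>1'[OF g], of "C * T powr (b - c)"])
    fix s :: "real \<times> real \<times> real" and t :: "real \<times> real"
    assume o: "s \<in> ordered_tuples T" "t \<in> ordered_tuples T"
    have "C * width s powr \<alpha> * width t powr b \<le> C * width s powr \<alpha> * (T powr (b - c) * width t powr c)"
      using width_le[OF o(2)] cd C by (intro mult_left_mono powr_weaken) auto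
    then show "\<bar>\<delta>1' g s t\<bar> \<le> C * T powr (b - c) * width s powr \<alpha> * width t powr c"
      using bound1[OF o] by (simp add: mult_ac)
  qed (use C in simp)
  moreover have "\<delta>2' g \<in> holder T d \<beta>"
  proof (rule holderI[OF incr_\<delta>2'[OF g], of "C * T powr (a - d)"])
    fix s :: "real \<times> real" and t :: "real \<times> real \<times> real"
    assume o: "s \<in> ordered_tuples T" "t \<in> ordered_tuples T"
    have "C * width s powr a * width t powr \<beta> \<le> C * (T powr (a - d) * width s powr d) * width t powr \<beta>"
      using width_le[OF o(1)] cd C by (intro mult_left_mono mult_right_mono powr_weaken) auto
    then show "\<bar>\<delta>2' g s t\<bar> \<le> C * T powr (a - d) * width s powr d * width t powr \<beta>"
      using bound2[OF o] by (simp add: mult_ac)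
  qed (use C in simp)
  moreover have "\<delta>' g \<in> holder T \<alpha> \<beta>"
    by (rule holderI[OF _ C bound12]) (simp_all add: \<delta>'_def incr_\<delta>1' incr_\<delta>2' g)
  ultimately show ?thesis
    unfolding sew2d_well_defined_def using sewable exps cd by blast
qed

end

text \<open>Riemann sums along partitions: those of an additive function telescope, and those of a function of
  order greater than one vanish with the mesh.\<close>

lemma partition_nth:
  assumes "is_partition a b p" "i < length p - 1"
  shows "a \<le> p ! i" "p ! i < p ! Suc i" "p ! Suc i \<le> b"
proof -
  have p: "p \<noteq> []" "sorted_wrt (<) p" "p ! 0 = a" "p ! (length p - 1) = b"
    using assms by (auto simp: is_partition_def hd_conv_nth last_conv_nth)
  show "p ! i < p ! Suc i" using p assms by (simp add: sorted_wrt_iff_nth_less)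
  show "a \<le> p ! i" using p assms sorted_wrt_nth_less[OF p(2), of 0 i] by (cases "i = 0") (auto intro: less_imp_le)
  show "p ! Suc i \<le> b"
    using p assms sorted_wrt_nth_less[OF p(2), of "Suc i" "length p - 1"] by (cases "Suc i = length p - 1") (auto intro: less_imp_le)
qed

lemma partition_ends:
  assumes "is_partition a b p"
  shows "p ! 0 = a" "p ! (length p - 1) = b"
  using assms by (auto simp: is_partition_def hd_conv_nth last_conv_nth)

lemma partition_telescope:
  fixes F :: "real \<times> real \<Rightarrow> real"
  assumes p: "is_partition a b p"
    and add: "\<And>s u t. a \<le> s \<Longrightarrow> s \<le> u \<Longrightarrow> u \<le> t \<Longrightarrow> t \<le> b \<Longrightarrow> F (s, t) = F (s, u) + F (u, t)"
    and "a \<le> b"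
  shows "(\<Sum>i<length p - 1. F (p ! i, p ! Suc i)) = F (a, b)"
proof -
  have "(\<Sum>i<j. F (p ! i, p ! Suc i)) = F (a, p ! j)" if "j \<le> length p - 1" for j
    using that
  proof (induction j)
    case 0
    show ?case using add[of a a a] assms(3) partition_ends[OF p] by simp
  next
    case (Suc j)
    then show ?case using add[of a "p ! j" "p ! Suc j"] partition_nth[OF p, of j] by simp
  qed
  from this[of "length p - 1"] show ?thesis using partition_ends[OF p] by simp
qed

lemma mesh_ge:
  assumes "i < length p - 1"
  shows "p ! Suc i - p ! i \<le> mesh p"
  unfolding mesh_def using assms by (intro Max_ge) auto

lemma partition_powr_sum:
  assumes p: "is_partition a b p" and \<mu>: "1 < \<mu>"
  shows "(\<Sum>i<length p - 1. (p ! Suc i - p ! i) powr \<mu>) \<le> mesh p powr (\<mu> - 1) * (b - a)"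
proof -
  have "(\<Sum>i<length p - 1. (p ! Suc i - p ! i) powr \<mu>)
      \<le> (\<Sum>i<length p - 1. mesh p powr (\<mu> - 1) * (p ! Suc i - p ! i))"
  proof (intro sum_mono)
    fix i assume "i \<in> {..<length p - 1}"
    then have i: "i < length p - 1" by simp
    have d: "0 < p ! Suc i - p ! i" using partition_nth[OF p i] by simp
    then have "(p ! Suc i - p ! i) powr \<mu> = (p ! Suc i - p ! i) powr (\<mu> - 1) * (p ! Suc i - p ! i)"
      by (simp add: powr_diff)
    also have "\<dots> \<le> mesh p powr (\<mu> - 1) * (p ! Suc i - p ! i)"
      using mesh_ge[OF i] d \<mu> by (intro mult_right_mono powr_mono2) auto
    finally show "(p ! Suc i - p ! i) powr \<mu> \<le> mesh p powr (\<mu> - 1) * (p ! Suc i - p ! i)" .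
  qed
  also have "\<dots> = mesh p powr (\<mu> - 1) * (b - a)"
    using partition_ends[OF p] by (simp add: sum_distrib_left[symmetric] sum_lessThan_telescope)
  finally show ?thesis .
qed

lemma partition_powr_sum_tendsto:
  assumes p: "\<And>n. is_partition a b (p n)" and ab: "a < b" and \<mu>: "1 < \<mu>"
    and mesh: "(\<lambda>n. mesh (p n)) \<longlonglongrightarrow> 0"
  shows "(\<lambda>n. \<Sum>i<length (p n) - 1. (p n ! Suc i - p n ! i) powr \<mu>) \<longlonglongrightarrow> 0"
proof (rule Lim_null_comparison)
  have "0 \<le> mesh (p n)" for n
  proof -
    have "length (p n) - 1 \<noteq> 0"
      using partition_ends[OF p, of n] ab by (intro notI) simp
    then show ?thesis using mesh_ge[of 0 "p n"] partition_nth[OF p, of 0 n] by simp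
  qed
  then have "(\<lambda>n. mesh (p n) powr (\<mu> - 1)) \<longlonglongrightarrow> 0"
    using \<mu> by (intro tendsto_zero_powrI[OF mesh tendsto_const]) auto
  then show "(\<lambda>n. mesh (p n) powr (\<mu> - 1) * (b - a)) \<longlonglongrightarrow> 0" by (rule tendsto_mult_left_zero)
  show "\<forall>\<^sub>F n in sequentially. norm (\<Sum>i<length (p n) - 1. (p n ! Suc i - p n ! i) powr \<mu>)
      \<le> mesh (p n) powr (\<mu> - 1) * (b - a)"
    using partition_powr_sum[OF p \<mu>] by (simp add: sum_nonneg)
qed

context germ2d
begin

text \<open>In the splitting \<open>g = J12 + (J2 - J12) + JR + (R2 - JR)\<close> the first two terms are additive in \<open>t\<close>, the first
  and the third one are additive in \<open>s\<close>, and each of the last three is of order greater than one in every variable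
  in which it is not additive.\<close>

lemma riemann_sums_tendsto:
  assumes s: "0 \<le> s1" "s1 < s2" "s2 \<le> T" and t: "0 \<le> t1" "t1 < t2" "t2 \<le> T"
    and p: "\<And>n. is_partition s1 s2 (p n)" and q: "\<And>n. is_partition t1 t2 (q n)"
    and mesh: "(\<lambda>n. mesh (p n)) \<longlonglongrightarrow> 0" "(\<lambda>n. mesh (q n)) \<longlonglongrightarrow> 0"
  shows "(\<lambda>n. \<Sum>i<length (p n) - 1. \<Sum>j<length (q n) - 1. g (p n ! i, p n ! Suc i) (q n ! j, q n ! Suc j))
    \<longlonglongrightarrow> sew2d T g (s1, s2) (t1, t2)"
proof -
  define S where "S = (\<lambda>n. \<Sum>i<length (p n) - 1. (p n ! Suc i - p n ! i) powr \<alpha>)"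
  define U where "U = (\<lambda>n. \<Sum>j<length (q n) - 1. (q n ! Suc j - q n ! j) powr \<beta>)"
  have S: "S \<longlonglongrightarrow> 0" and U: "U \<longlonglongrightarrow> 0"
    unfolding S_def U_def
    using partition_powr_sum_tendsto[OF p s(2) _ mesh(1)] partition_powr_sum_tendsto[OF q t(2) _ mesh(2)] exps
    by auto
  define L where "L = K * sew_const \<alpha> * T powr b"
  define M where "M = C * sew_const \<beta> * T powr a + C * sew_const \<beta> * sew_const \<alpha> * T powr \<alpha>"
  define N where "N = C * sew_const \<beta> * sew_const \<alpha>"
  have so: "(s1, s2) \<in> ordered_tuples T" and to: "(t1, t2) \<in> ordered_tuples T"
    using s t by (auto simp: ordered_tuples_iff)
  have bound: "\<bar>(\<Sum>i<length (p n) - 1. \<Sum>j<length (q n) - 1. g (p n ! i, p n ! Suc i) (q n ! j, q n ! Suc j))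
      - J12 (s1, s2) (t1, t2)\<bar> \<le> L * S n + M * U n + N * (S n * U n)" for n
  proof -
    let ?I = "{..<length (p n) - 1}" and ?J = "{..<length (q n) - 1}"
    let ?s = "\<lambda>i. (p n ! i, p n ! Suc i)" and ?t = "\<lambda>j. (q n ! j, q n ! Suc j)"
    have si: "?s i \<in> ordered_tuples T" if "i \<in> ?I" for i
      using partition_nth[OF p, of i n] that s by (auto simp: ordered_tuples_iff)
    have tj: "?t j \<in> ordered_tuples T" if "j \<in> ?J" for j
      using partition_nth[OF q, of j n] that t by (auto simp: ordered_tuples_iff)
    have z: "(\<Sum>i\<in>?I. \<Sum>j\<in>?J. J12 (?s i) (?t j)) = J12 (s1, s2) (t1, t2)"
    proof -
      have "(\<Sum>i\<in>?I. \<Sum>j\<in>?J. J12 (?s i) (?t j)) = (\<Sum>i\<in>?I. J12 (?s i) (t1, t2))"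
      proof (rule sum.cong[OF refl])
        fix i assume i: "i \<in> ?I"
        show "(\<Sum>j\<in>?J. J12 (?s i) (?t j)) = J12 (?s i) (t1, t2)"
          using t by (intro partition_telescope[OF q, where F = "\<lambda>t. J12 (?s i) t"] J12_additive_t si i) auto
      qed
      also have "\<dots> = J12 (s1, s2) (t1, t2)"
        using s by (intro partition_telescope[OF p, where F = "\<lambda>s. J12 s (t1, t2)"] J12_additive_s to) auto
      finally show ?thesis .
    qed
    have e1: "(\<Sum>i\<in>?I. \<Sum>j\<in>?J. J2 (?s i) (?t j) - J12 (?s i) (?t j))
        = (\<Sum>i\<in>?I. J2 (?s i) (t1, t2) - J12 (?s i) (t1, t2))"
    proof (rule sum.cong[OF refl])
      fix i assume i: "i \<in> ?I"
      show "(\<Sum>j\<in>?J. J2 (?s i) (?t j) - J12 (?s i) (?t j)) = J2 (?s i) (t1, t2) - J12 (?s i) (t1, t2)"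
      proof (rule partition_telescope[OF q, where F = "\<lambda>t. J2 (?s i) t - J12 (?s i) t"])
        fix u v w assume "t1 \<le> u" "u \<le> v" "v \<le> w" "w \<le> t2"
        then show "J2 (?s i) (u, w) - J12 (?s i) (u, w)
            = J2 (?s i) (u, v) - J12 (?s i) (u, v) + (J2 (?s i) (v, w) - J12 (?s i) (v, w))"
          using t J12_additive_t[OF si[OF i], of u v w] J2_additive_t[OF si[OF i], of u v w] by linarith
      qed (use t in simp)
    qed
    have e2: "(\<Sum>i\<in>?I. \<Sum>j\<in>?J. JR (?s i) (?t j)) = (\<Sum>j\<in>?J. JR (s1, s2) (?t j))"
    proof -
      have "(\<Sum>i\<in>?I. \<Sum>j\<in>?J. JR (?s i) (?t j)) = (\<Sum>j\<in>?J. \<Sum>i\<in>?I. JR (?s i) (?t j))"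
        by (rule sum.swap)
      also have "\<dots> = (\<Sum>j\<in>?J. JR (s1, s2) (?t j))"
      proof (rule sum.cong[OF refl])
        fix j assume j: "j \<in> ?J"
        show "(\<Sum>i\<in>?I. JR (?s i) (?t j)) = JR (s1, s2) (?t j)"
          using s by (intro partition_telescope[OF p, where F = "\<lambda>s. JR s (?t j)"] JR_additive_s tj j) auto
      qed
      finally show ?thesis .
    qed
    have split: "g (?s i) (?t j) = J12 (?s i) (?t j) + (J2 (?s i) (?t j) - J12 (?s i) (?t j))
        + JR (?s i) (?t j) + (R2 (?s i) (?t j) - JR (?s i) (?t j))" for i j
      by (simp add: R2_def)
    have eq: "(\<Sum>i\<in>?I. \<Sum>j\<in>?J. g (?s i) (?t j)) - J12 (s1, s2) (t1, t2)
        = (\<Sum>i\<in>?I. J2 (?s i) (t1, t2) - J12 (?s i) (t1, t2)) + (\<Sum>j\<in>?J. JR (s1, s2) (?t j))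
          + (\<Sum>i\<in>?I. \<Sum>j\<in>?J. R2 (?s i) (?t j) - JR (?s i) (?t j))"
      unfolding split by (simp only: sum.distrib z e1 e2)
    have b1: "\<bar>\<Sum>i\<in>?I. J2 (?s i) (t1, t2) - J12 (?s i) (t1, t2)\<bar> \<le> L * S n"
      unfolding S_def sum_distrib_left
    proof (rule order_trans[OF sum_abs], rule sum_mono)
      fix i assume i: "i \<in> ?I"
      have "\<bar>J2 (?s i) (t1, t2) - J12 (?s i) (t1, t2)\<bar>
          \<le> K * sew_const \<alpha> * (p n ! Suc i - p n ! i) powr \<alpha> * width (t1, t2) powr b"
        using J12_near[OF si[OF i] to] by (simp add: width_simps)
      also have "\<dots> \<le> K * sew_const \<alpha> * (p n ! Suc i - p n ! i) powr \<alpha> * T powr b"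
        using powr_le_T[OF to] exps K sew_const_pos by (intro mult_left_mono) auto
      finally show "\<bar>J2 (?s i) (t1, t2) - J12 (?s i) (t1, t2)\<bar> \<le> L * (p n ! Suc i - p n ! i) powr \<alpha>"
        by (simp add: L_def mult_ac)
    qed
    have b2: "\<bar>\<Sum>j\<in>?J. JR (s1, s2) (?t j)\<bar> \<le> M * U n"
      unfolding U_def sum_distrib_left
    proof (rule order_trans[OF sum_abs], rule sum_mono)
      fix j assume j: "j \<in> ?J"
      let ?w = "(q n ! Suc j - q n ! j) powr \<beta>"
      have "\<bar>JR (s1, s2) (?t j)\<bar> \<le> C * sew_const \<beta> * width (s1, s2) powr a * ?w
          + C * sew_const \<beta> * sew_const \<alpha> * width (s1, s2) powr \<alpha> * ?w"
        using JR_near[OF so tj[OF j]] R2_bound[OF so tj[OF j]] by (simp add: width_simps)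
      also have "\<dots> \<le> C * sew_const \<beta> * T powr a * ?w + C * sew_const \<beta> * sew_const \<alpha> * T powr \<alpha> * ?w"
        using powr_le_T[OF so] exps C sew_const_pos by (intro add_mono mult_right_mono mult_left_mono) auto
      finally show "\<bar>JR (s1, s2) (?t j)\<bar> \<le> M * ?w" by (simp add: M_def algebra_simps)
    qed
    have b3: "\<bar>\<Sum>i\<in>?I. \<Sum>j\<in>?J. R2 (?s i) (?t j) - JR (?s i) (?t j)\<bar> \<le> N * (S n * U n)"
      unfolding S_def U_def sum_product unfolding sum_distrib_left
    proof (rule order_trans[OF sum_abs], rule sum_mono, rule order_trans[OF sum_abs], rule sum_mono)
      fix i j assume "i \<in> ?I" "j \<in> ?J"
      then show "\<bar>R2 (?s i) (?t j) - JR (?s i) (?t j)\<bar>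
          \<le> N * ((p n ! Suc i - p n ! i) powr \<alpha> * (q n ! Suc j - q n ! j) powr \<beta>)"
        using JR_near[OF si tj, of i j] by (simp add: width_simps N_def mult.assoc)
    qed
    show ?thesis unfolding eq using b1 b2 b3 by linarith
  qed
  have "(\<lambda>n. L * S n + M * U n + N * (S n * U n)) \<longlonglongrightarrow> L * 0 + M * 0 + N * (0 * 0)"
    by (intro tendsto_intros S U)
  then have "(\<lambda>n. L * S n + M * U n + N * (S n * U n)) \<longlonglongrightarrow> 0" by simp
  moreover have "\<forall>\<^sub>F n in sequentially. norm ((\<Sum>i<length (p n) - 1. \<Sum>j<length (q n) - 1.
      g (p n ! i, p n ! Suc i) (q n ! j, q n ! Suc j)) - J12 (s1, s2) (t1, t2))
        \<le> L * S n + M * U n + N * (S n * U n)"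
    unfolding real_norm_def by (intro always_eventually allI bound)
  ultimately have "(\<lambda>n. (\<Sum>i<length (p n) - 1. \<Sum>j<length (q n) - 1.
      g (p n ! i, p n ! Suc i) (q n ! j, q n ! Suc j)) - J12 (s1, s2) (t1, t2)) \<longlonglongrightarrow> 0"
    by (rule Lim_null_comparison[rotated])
  then show ?thesis using sew2d_eq[OF so to] by (simp add: Lim_null[symmetric])
qed

text \<open>A criterion that identifies \<open>sew2d T g\<close> as \<open>Z\<close>, by two applications of one-parameter uniqueness: \<open>Y\<close> is the
  integral of \<open>g\<close> in \<open>t\<close>, and \<open>Z\<close> is the integral of \<open>Y\<close> in \<open>s\<close>.\<close>

lemma sew2d_unique:
  assumes Y: "\<And>s t1 t2 t3. s \<in> ordered_tuples T \<Longrightarrow> 0 \<le> t1 \<Longrightarrow> t1 \<le> t2 \<Longrightarrow> t2 \<le> t3 \<Longrightarrow> t3 \<le> T \<Longrightarrow>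
      Y s (t1, t3) = Y s (t1, t2) + Y s (t2, t3)"
    and nearY: "\<And>s t. s \<in> ordered_tuples T \<Longrightarrow> t \<in> ordered_tuples T \<Longrightarrow> \<bar>Y s t - g s t\<bar> \<le> C1 * width t powr \<mu>"
    and Z: "\<And>t s1 s2 s3. t \<in> ordered_tuples T \<Longrightarrow> 0 \<le> s1 \<Longrightarrow> s1 \<le> s2 \<Longrightarrow> s2 \<le> s3 \<Longrightarrow> s3 \<le> T \<Longrightarrow>
      Z (s1, s3) t = Z (s1, s2) t + Z (s2, s3) t"
    and nearZ: "\<And>s t. s \<in> ordered_tuples T \<Longrightarrow> t \<in> ordered_tuples T \<Longrightarrow> \<bar>Z s t - Y s t\<bar> \<le> C2 * width s powr \<nu>"
    and exps: "1 < \<mu>" "1 < \<nu>"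
    and s: "s \<in> ordered_tuples T" and t: "t \<in> ordered_tuples T"
  shows "sew2d T g s t = Z s t"
proof -
  have J2: "J2 u t = Y u t" if u: "u \<in> ordered_tuples T" for u
    unfolding J2_def
  proof (rule sew_int_unique(2)[OF additive_midpoint[where T = T] nearY[OF u] exps(1) t])
    show "Y u (a, c) = Y u (a, b) + Y u (b, c)" if "0 \<le> a" "a \<le> b" "b \<le> c" "c \<le> T" for a b c
      using Y[OF u that] .
  qed
  have "sew_int (\<lambda>u. Y u t) s = Z s t"
  proof (rule sew_int_unique(2)[OF additive_midpoint[where T = T and J = "\<lambda>u. Z u t"] nearZ[OF _ t] exps(2) s])
    show "Z (a, c) t = Z (a, b) t + Z (b, c) t" if "0 \<le> a" "a \<le> b" "b \<le> c" "c \<le> T" for a b c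
      using Z[OF t that] .
  qed
  moreover have "J12 s t = sew_int (\<lambda>u. Y u t) s"
    unfolding J12_def sew_int_def using J2 by (intro arg_cong[where f = lim] ext eq_sum_cong[OF _ s]) auto
  ultimately show ?thesis using sew2d_eq[OF s t] by simp
qed

end

section \<open>Iterated integrals of continuous fields\<close>

text \<open>Rescaling to the unit interval turns integrals over a variable interval into integrals with a parameter,
  which are continuous in the parameter.\<close>

lemma integral_rescale:
  fixes f :: "real \<Rightarrow> real"
  assumes "a \<le> b" "continuous_on {a..b} f"
  shows "integral {a..b} f = (b - a) * integral {0..1} (\<lambda>u. f (a + u * (b - a)))"
proof (cases "a = b")
  case False
  then have ab: "0 < b - a" using assms by simp
  have "(f has_integral integral {a..b} f) (cbox a b)"
    using integrable_integral[OF integrable_continuous_real[OF assms(2)]] by simp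
  from has_integral_affinity'[OF this ab, of a]
  have "((\<lambda>u. f (a + u * (b - a))) has_integral integral {a..b} f / (b - a)) {0..1}"
    using ab by (simp add: field_simps)
  then have "integral {0..1} (\<lambda>u. f (a + u * (b - a))) = integral {a..b} f / (b - a)"
    by (rule integral_unique)
  then show ?thesis using ab by simp
qed simp

lemma integral_continuous:
  fixes f :: "'p::topological_space \<Rightarrow> real \<Rightarrow> real"
  assumes f: "continuous_on (U \<times> {0..T}) (\<lambda>(p, \<sigma>). f p \<sigma>)"
    and a: "continuous_on U a" and b: "continuous_on U b"
    and ab: "\<And>p. p \<in> U \<Longrightarrow> 0 \<le> a p \<and> a p \<le> b p \<and> b p \<le> T"
  shows "continuous_on U (\<lambda>p. integral {a p..b p} (f p))"
proof -
  have ab': "continuous_on (U \<times> cbox (0::real) 1) (\<lambda>x. a (fst x))" "continuous_on (U \<times> cbox (0::real) 1) (\<lambda>x. b (fst x))"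
    by (rule continuous_on_compose2[OF a continuous_on_fst[OF continuous_on_id]]
        continuous_on_compose2[OF b continuous_on_fst[OF continuous_on_id]]; auto)+
  have "continuous_on (U \<times> cbox 0 1) ((\<lambda>(p, \<sigma>). f p \<sigma>) \<circ> (\<lambda>x. (fst x, a (fst x) + snd x * (b (fst x) - a (fst x)))))"
  proof (intro continuous_on_compose continuous_on_subset[OF f] continuous_intros ab')
    show "(\<lambda>x. (fst x, a (fst x) + snd x * (b (fst x) - a (fst x)))) ` (U \<times> cbox 0 1) \<subseteq> U \<times> {0..T}"
    proof clarsimp
      fix p u assume p: "p \<in> U" and u: "0 \<le> u" "u \<le> (1::real)"
      have "0 \<le> u * (b p - a p)" "u * (b p - a p) \<le> 1 * (b p - a p)"
        using ab[OF p] u by (intro mult_nonneg_nonneg mult_right_mono; simp)+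
      then show "0 \<le> a p + u * (b p - a p) \<and> a p + u * (b p - a p) \<le> T"
        using ab[OF p] by (auto simp del: mult_1)
    qed
  qed
  then have "continuous_on (U \<times> cbox 0 1) (\<lambda>(p, u). f p (a p + u * (b p - a p)))"
    by (simp add: o_def case_prod_beta)
  from integral_continuous_on_param[OF this]
  have "continuous_on U (\<lambda>p. (b p - a p) * integral {0..1} (\<lambda>u. f p (a p + u * (b p - a p))))"
    by (intro continuous_intros a b) simp
  moreover have "integral {a p..b p} (f p) = (b p - a p) * integral {0..1} (\<lambda>u. f p (a p + u * (b p - a p)))"
    if "p \<in> U" for p
  proof (rule integral_rescale)
    have "continuous_on {a p..b p} ((\<lambda>(p, \<sigma>). f p \<sigma>) \<circ> Pair p)"
      using that ab[OF that] by (intro continuous_on_compose continuous_on_subset[OF f] continuous_intros) auto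
    then show "continuous_on {a p..b p} (f p)" by (simp add: o_def)
  qed (use ab[OF that] in simp)
  ultimately show ?thesis by (elim continuous_on_eq) simp
qed

lemma iint_continuous:
  fixes F :: "'p::topological_space \<Rightarrow> real \<Rightarrow> real \<Rightarrow> real"
  assumes F: "continuous_on (U \<times> {0..T} \<times> {0..T}) (\<lambda>(p, \<sigma>, \<tau>). F p \<sigma> \<tau>)"
    and cont: "continuous_on U a" "continuous_on U b" "continuous_on U c" "continuous_on U d"
    and ab: "\<And>p. p \<in> U \<Longrightarrow> 0 \<le> a p \<and> a p \<le> b p \<and> b p \<le> T"
    and cd: "\<And>p. p \<in> U \<Longrightarrow> 0 \<le> c p \<and> c p \<le> d p \<and> d p \<le> T"
  shows "continuous_on U (\<lambda>p. iint (a p) (b p) (c p) (d p) (F p))"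
  unfolding iint_def
proof (rule integral_continuous[OF _ cont(1,2) ab])
  have "continuous_on ((U \<times> {0..T}) \<times> {0..T}) ((\<lambda>(p, \<sigma>, \<tau>). F p \<sigma> \<tau>) \<circ> (\<lambda>x. (fst (fst x), snd (fst x), snd x)))"
    by (intro continuous_on_compose continuous_on_subset[OF F] continuous_intros) auto
  then have *: "continuous_on ((U \<times> {0..T}) \<times> {0..T}) (\<lambda>(q, \<tau>). F (fst q) (snd q) \<tau>)"
    by (simp add: o_def case_prod_beta)
  have "continuous_on (U \<times> {0..T}) (\<lambda>q. integral {c (fst q)..d (fst q)} (F (fst q) (snd q)))"
    using cd by (intro integral_continuous[OF *] continuous_on_compose2[OF cont(3) continuous_on_fst[OF continuous_on_id]]
        continuous_on_compose2[OF cont(4) continuous_on_fst[OF continuous_on_id]]) auto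
  then show "continuous_on (U \<times> {0..T}) (\<lambda>(p, \<sigma>). integral {c p..d p} (F p \<sigma>))"
    by (simp add: case_prod_beta)
qed

lemma field_integrable:
  fixes f :: "real \<Rightarrow> real \<Rightarrow> real"
  assumes f: "f \<in> incr T" and cd: "(c, d) \<in> ordered_tuples T"
  shows "\<sigma> \<in> {0..T} \<Longrightarrow> continuous_on {c..d} (f \<sigma>)"
    and "\<sigma> \<in> {0..T} \<Longrightarrow> f \<sigma> integrable_on {c..d}"
    and "(a, b) \<in> ordered_tuples T \<Longrightarrow> continuous_on {a..b} (\<lambda>\<sigma>. integral {c..d} (f \<sigma>))"
    and "(a, b) \<in> ordered_tuples T \<Longrightarrow> (\<lambda>\<sigma>. integral {c..d} (f \<sigma>)) integrable_on {a..b}"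
proof -
  show 1: "continuous_on {c..d} (f \<sigma>)" if "\<sigma> \<in> {0..T}" for \<sigma>
    using that cd by (intro field_compose[OF f] continuous_intros) (auto simp: ordered_tuples_iff)
  then show "f \<sigma> integrable_on {c..d}" if "\<sigma> \<in> {0..T}"
    using that by (simp add: integrable_continuous_real)
  have "continuous_on {0..T} (\<lambda>\<sigma>. integral {c..d} (f \<sigma>))"
    using f cd by (intro integral_continuous) (auto simp: incr_field_iff ordered_tuples_iff)
  then show "continuous_on {a..b} (\<lambda>\<sigma>. integral {c..d} (f \<sigma>))" if "(a, b) \<in> ordered_tuples T"
    using that by (elim continuous_on_subset) (auto simp: ordered_tuples_iff)
  then show "(\<lambda>\<sigma>. integral {c..d} (f \<sigma>)) integrable_on {a..b}" if "(a, b) \<in> ordered_tuples T"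
    using that by (simp add: integrable_continuous_real)
qed

lemma iint_cong:
  assumes "\<And>\<sigma> \<tau>. a \<le> \<sigma> \<Longrightarrow> \<sigma> \<le> b \<Longrightarrow> c \<le> \<tau> \<Longrightarrow> \<tau> \<le> d \<Longrightarrow> f \<sigma> \<tau> = h \<sigma> \<tau>"
  shows "iint a b c d f = iint a b c d h"
  unfolding iint_def using assms
  by (intro Henstock_Kurzweil_Integration.integral_cong) auto

lemma iint_degenerate [simp]: "iint a a c d f = 0" "iint a b c c f = 0"
  by (simp_all add: iint_def)

lemma iint_zero [simp]: "iint a b c d (\<lambda>\<sigma> \<tau>. 0) = 0"
  by (simp add: iint_def)

lemma iint_cmult: "iint a b c d (\<lambda>\<sigma> \<tau>. k * f \<sigma> \<tau>) = k * iint a b c d f"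
  by (simp add: iint_def)

context
  fixes T a b c d :: real
  assumes ab: "(a, b) \<in> ordered_tuples T" and cd: "(c, d) \<in> ordered_tuples T"
begin

lemma in_square: "\<sigma> \<in> {a..b} \<Longrightarrow> \<sigma> \<in> {0..T}"
  using ab by (auto simp: ordered_tuples_iff)

lemma iint_diff:
  assumes f: "f \<in> incr T" and h: "h \<in> incr T"
  shows "iint a b c d (\<lambda>\<sigma> \<tau>. f \<sigma> \<tau> - h \<sigma> \<tau>) = iint a b c d f - iint a b c d h"
proof -
  have "iint a b c d (\<lambda>\<sigma> \<tau>. f \<sigma> \<tau> - h \<sigma> \<tau>)
      = integral {a..b} (\<lambda>\<sigma>. integral {c..d} (f \<sigma>) - integral {c..d} (h \<sigma>))"
    unfolding iint_def using field_integrable(2)[OF f cd] field_integrable(2)[OF h cd] in_square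
    by (intro Henstock_Kurzweil_Integration.integral_cong Henstock_Kurzweil_Integration.integral_diff) auto
  also have "\<dots> = iint a b c d f - iint a b c d h"
    unfolding iint_def using field_integrable(4)[OF f cd ab] field_integrable(4)[OF h cd ab]
    by (intro Henstock_Kurzweil_Integration.integral_diff) auto
  finally show ?thesis .
qed

lemma iint_split_s:
  assumes f: "f \<in> incr T" and u: "a \<le> u" "u \<le> b"
  shows "iint a b c d f = iint a u c d f + iint u b c d f"
  unfolding iint_def using Henstock_Kurzweil_Integration.integral_combine[OF u field_integrable(4)[OF f cd ab]]
  by simp

lemma iint_split_t:
  assumes f: "f \<in> incr T" and u: "c \<le> u" "u \<le> d"
  shows "iint a b c d f = iint a b c u f + iint a b u d f"
proof -
  have cu: "(c, u) \<in> ordered_tuples T" "(u, d) \<in> ordered_tuples T"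
    using cd u by (auto simp: ordered_tuples_iff)
  have "iint a b c d f = integral {a..b} (\<lambda>\<sigma>. integral {c..u} (f \<sigma>) + integral {u..d} (f \<sigma>))"
    unfolding iint_def
    using Henstock_Kurzweil_Integration.integral_combine[OF u field_integrable(2)[OF f cd]] in_square
    by (intro Henstock_Kurzweil_Integration.integral_cong) auto
  also have "\<dots> = iint a b c u f + iint a b u d f"
    unfolding iint_def using field_integrable(4)[OF f cu(1) ab] field_integrable(4)[OF f cu(2) ab]
    by (intro Henstock_Kurzweil_Integration.integral_add) auto
  finally show ?thesis .
qed

lemma iint_bound:
  assumes f: "f \<in> incr T"
    and B: "\<And>\<sigma> \<tau>. a \<le> \<sigma> \<Longrightarrow> \<sigma> \<le> b \<Longrightarrow> c \<le> \<tau> \<Longrightarrow> \<tau> \<le> d \<Longrightarrow> \<bar>f \<sigma> \<tau>\<bar> \<le> B"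
  shows "\<bar>iint a b c d f\<bar> \<le> B * (b - a) * (d - c)"
proof -
  have "norm (integral {a..b} (\<lambda>\<sigma>. integral {c..d} (f \<sigma>))) \<le> (B * (d - c)) * (b - a)"
  proof (rule integral_bound)
    fix \<sigma> assume \<sigma>: "\<sigma> \<in> {a..b}"
    show "norm (integral {c..d} (f \<sigma>)) \<le> B * (d - c)"
      using cd \<sigma> B by (intro integral_bound field_integrable(1)[OF f cd] in_square) (auto simp: ordered_tuples_iff)
  qed (use ab field_integrable(3)[OF f cd] in \<open>auto simp: ordered_tuples_iff\<close>)
  then show ?thesis by (simp add: iint_def mult_ac)
qed

end

lemma iint_add:
  assumes "(a, b) \<in> ordered_tuples T" "(c, d) \<in> ordered_tuples T" "f \<in> incr T" "h \<in> incr T"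
  shows "iint a b c d (\<lambda>\<sigma> \<tau>. f \<sigma> \<tau> + h \<sigma> \<tau>) = iint a b c d f + iint a b c d h"
proof -
  have "iint a b c d (\<lambda>\<sigma> \<tau>. f \<sigma> \<tau> - (-1) * h \<sigma> \<tau>) = iint a b c d f - iint a b c d (\<lambda>\<sigma> \<tau>. (-1) * h \<sigma> \<tau>)"
    by (rule iint_diff[OF assms(1-3) field_mult[OF field_const assms(4)]])
  then show ?thesis by (simp only: iint_cmult) simp
qed

section \<open>Sheets of smooth fields\<close>

lemma pair_ordered:
  "s \<in> ordered_tuples T \<Longrightarrow> 0 \<le> fst s \<and> fst s \<le> snd s \<and> snd s \<le> T" for s :: "real \<times> real"
  by (cases s) (simp add: ordered_tuples_iff)

lemma incr_field_cong:
  fixes f h :: "real \<Rightarrow> real \<Rightarrow> real"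
  assumes "f \<in> incr T" "\<And>s t. s \<in> {0..T} \<Longrightarrow> t \<in> {0..T} \<Longrightarrow> h s t = f s t"
  shows "h \<in> incr T"
  using assms unfolding incr_field_iff by (auto elim!: continuous_on_eq)

text \<open>The partial derivatives that occur in the sheet of a smooth field are continuous up to the boundary of the
  square, and satisfy the hypotheses of the fundamental theorem of calculus.\<close>

lemma smooth_derivatives:
  assumes T: "0 < T" and y: "smooth T y"
  shows "pd1 T y \<in> incr T" "pd2 T y \<in> incr T" "pd12 T y \<in> incr T"
    and "s \<in> {0..T} \<Longrightarrow> t \<in> {0..T} \<Longrightarrow>
      ((\<lambda>\<sigma>. y \<sigma> t) has_vector_derivative pd1 T y s t) (at s within {0..T})"
    and "s \<in> {0..T} \<Longrightarrow> t \<in> {0..T} \<Longrightarrow>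
      ((\<lambda>\<tau>. pd1 T y s \<tau>) has_vector_derivative pd12 T y s t) (at t within {0..T})"
proof -
  obtain D :: "nat \<Rightarrow> nat \<Rightarrow> real \<Rightarrow> real \<Rightarrow> real" where
    D0: "\<And>s t. s \<in> {0..T} \<Longrightarrow> t \<in> {0..T} \<Longrightarrow> D 0 0 s t = y s t"
    and Dc: "\<And>i j. continuous_on ({0..T} \<times> {0..T}) (\<lambda>(s, t). D i j s t)"
    and D1: "\<And>i j s t. s \<in> {0..T} \<Longrightarrow> t \<in> {0..T} \<Longrightarrow>
      ((\<lambda>\<sigma>. D i j \<sigma> t) has_vector_derivative D (Suc i) j s t) (at s within {0..T})"
    and D2: "\<And>i j s t. s \<in> {0..T} \<Longrightarrow> t \<in> {0..T} \<Longrightarrow>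
      ((\<lambda>\<tau>. D i j s \<tau>) has_vector_derivative D i (Suc j) s t) (at t within {0..T})"
    using y unfolding smooth_def has_real_derivative_iff_has_vector_derivative by metis
  have y1: "((\<lambda>\<sigma>. y \<sigma> t) has_vector_derivative D 1 0 s t) (at s within {0..T})"
    and y2: "((\<lambda>\<tau>. y s \<tau>) has_vector_derivative D 0 1 s t) (at t within {0..T})"
    if "s \<in> {0..T}" "t \<in> {0..T}" for s t
    using has_vector_derivative_transform[OF that(1) D0[OF _ that(2), symmetric] D1[OF that, of 0 0]]
      has_vector_derivative_transform[OF that(2) D0[OF that(1), symmetric] D2[OF that, of 0 0]] by simp_all
  have p2: "pd2 T y s t = D 0 1 s t" if "s \<in> {0..T}" "t \<in> {0..T}" for s t
    unfolding pd2_def by (rule vector_derivative_within_closed_interval[OF T that(2) y2[OF that]])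
  have y12: "((\<lambda>\<sigma>. pd2 T y \<sigma> t) has_vector_derivative D 1 1 s t) (at s within {0..T})"
    if "s \<in> {0..T}" "t \<in> {0..T}" for s t
    using has_vector_derivative_transform[OF that(1) p2[OF _ that(2)] D1[OF that, of 0 1]] by simp
  have p1: "pd1 T y s t = D 1 0 s t" if "s \<in> {0..T}" "t \<in> {0..T}" for s t
    unfolding pd1_def by (rule vector_derivative_within_closed_interval[OF T that(1) y1[OF that]])
  have p12: "pd12 T y s t = D 1 1 s t" if "s \<in> {0..T}" "t \<in> {0..T}" for s t
    unfolding pd12_def pd1_def by (rule vector_derivative_within_closed_interval[OF T that(1) y12[OF that]])
  have Di: "D i j \<in> incr T" for i j using Dc by (simp add: incr_field_iff)
  show "pd1 T y \<in> incr T" "pd2 T y \<in> incr T" "pd12 T y \<in> incr T"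
    using incr_field_cong[OF Di p1] incr_field_cong[OF Di p2] incr_field_cong[OF Di p12] by blast+
  assume st: "s \<in> {0..T}" "t \<in> {0..T}"
  show "((\<lambda>\<sigma>. y \<sigma> t) has_vector_derivative pd1 T y s t) (at s within {0..T})"
    using y1[OF st] by (simp only: p1[OF st])
  show "((\<lambda>\<tau>. pd1 T y s \<tau>) has_vector_derivative pd12 T y s t) (at t within {0..T})"
    using has_vector_derivative_transform[OF st(2) p1[OF st(1)] D2[OF st, of 1 0]] by (simp add: p12[OF st])
qed

lemma smooth_incr: "smooth T y \<Longrightarrow> y \<in> incr T"
proof -
  assume "smooth T y"
  then obtain D :: "nat \<Rightarrow> nat \<Rightarrow> real \<Rightarrow> real \<Rightarrow> real" where
    "\<And>s t. s \<in> {0..T} \<Longrightarrow> t \<in> {0..T} \<Longrightarrow> D 0 0 s t = y s t"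
    "continuous_on ({0..T} \<times> {0..T}) (\<lambda>(s, t). D 0 0 s t)"
    unfolding smooth_def by blast
  then show ?thesis unfolding incr_field_iff
    by (auto elim!: continuous_on_eq)
qed

lemma D_kind_incr:
  assumes T: "0 < T" and y: "smooth T y"
  shows "D_kind T k y \<in> incr T"
  using smooth_derivatives(1-3)[OF T y] field_mult[of "pd1 T y" T "pd2 T y"] by (cases k) auto

lemma \<delta>_smooth:
  assumes T: "0 < T" and y: "smooth T y"
    and s: "(s1, s2) \<in> ordered_tuples T" and t: "(t1, t2) \<in> ordered_tuples T"
  shows "\<delta> y (s1, s2) (t1, t2) = iint s1 s2 t1 t2 (pd12 T y)"
proof -
  note d = smooth_derivatives(4,5)[OF T y]
  have o: "0 \<le> s1" "s1 \<le> s2" "s2 \<le> T" "0 \<le> t1" "t1 \<le> t2" "t2 \<le> T"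
    using s t by (auto simp: ordered_tuples_iff)
  have inner: "integral {t1..t2} (pd12 T y \<sigma>) = pd1 T y \<sigma> t2 - pd1 T y \<sigma> t1" if "\<sigma> \<in> {s1..s2}" for \<sigma>
  proof (rule integral_unique[OF fundamental_theorem_of_calculus])
    fix \<tau> assume "\<tau> \<in> {t1..t2}"
    then show "(pd1 T y \<sigma> has_vector_derivative pd12 T y \<sigma> \<tau>) (at \<tau> within {t1..t2})"
      using that o by (intro has_vector_derivative_within_subset[OF d(2)]) auto
  qed (use o in simp)
  have "iint s1 s2 t1 t2 (pd12 T y) = integral {s1..s2} (\<lambda>\<sigma>. pd1 T y \<sigma> t2 - pd1 T y \<sigma> t1)"
    unfolding iint_def by (intro Henstock_Kurzweil_Integration.integral_cong) (use inner in auto)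
  also have "\<dots> = (y s2 t2 - y s2 t1) - (y s1 t2 - y s1 t1)"
  proof (rule integral_unique[OF fundamental_theorem_of_calculus])
    fix \<sigma> assume "\<sigma> \<in> {s1..s2}"
    then show "((\<lambda>\<sigma>. y \<sigma> t2 - y \<sigma> t1) has_vector_derivative pd1 T y \<sigma> t2 - pd1 T y \<sigma> t1) (at \<sigma> within {s1..s2})"
      using o by (intro has_vector_derivative_diff has_vector_derivative_within_subset[OF d(1)]) auto
  qed (use o in simp)
  finally show ?thesis by (simp add: \<delta>_eq)
qed

lemma smooth_sheet_i_j:
  assumes "0 < T" "smooth T y" "(s1, s2) \<in> ordered_tuples T" "(t1, t2) \<in> ordered_tuples T"
  shows "x_i_j (smooth_sheet T y) k (s1, s2) (t1, t2) = iint s1 s2 t1 t2 (D_kind T k y)"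
  using \<delta>_smooth[OF assms] by (cases k) (simp_all add: smooth_sheet_def)

text \<open>The algebraic relations between the components of a sheet that generalise Chen's relation. Here
  \<open>x_i_j X Plain\<close> is the rectangular increment of the underlying field.\<close>

definition chen_relations :: "real \<Rightarrow> rough_sheet \<Rightarrow> bool" where
  "chen_relations T X \<longleftrightarrow>
     (\<forall>k s1 s2 s3 t1 t2 t3. (s1, s2, s3) \<in> ordered_tuples T \<longrightarrow> (t1, t2, t3) \<in> ordered_tuples T \<longrightarrow>
        \<delta>1' (x_i_j X k) (s1, s2, s3) (t1, t2) = 0 \<and>
        \<delta>2' (x_i_j X k) (s1, s2) (t1, t2, t3) = 0 \<and>
        \<delta>1' (x_1i_0dj X k) (s1, s2, s3) (t1, t2) = x_1_0 X (s1, s2) t1 * x_i_j X k (s2, s3) (t1, t2) \<and>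
        \<delta>2' (x_1i_0dj X k) (s1, s2) (t1, t2, t3) = - x_1i_2dj X k (s1, s2) (t1, t2, t3) \<and>
        \<delta>1' (x_1i_2dj X k) (s1, s2, s3) (t1, t2, t3)
          = x_i_j X Plain (s1, s2) (t1, t2) * x_i_j X k (s2, s3) (t2, t3))"

lemma smooth_chen_relations:
  assumes T: "0 < T" and y: "smooth T y"
  shows "chen_relations T (smooth_sheet T y)"
  unfolding chen_relations_def
proof (intro allI impI conjI)
  fix k s1 s2 s3 t1 t2 t3
  assume "(s1::real, s2::real, s3::real) \<in> ordered_tuples T" "(t1::real, t2::real, t3::real) \<in> ordered_tuples T"
  then have o: "(s1, s2) \<in> ordered_tuples T" "(s1, s3) \<in> ordered_tuples T" "(s2, s3) \<in> ordered_tuples T"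
    "(t1, t2) \<in> ordered_tuples T" "(t1, t3) \<in> ordered_tuples T" "(t2, t3) \<in> ordered_tuples T"
    and i: "s1 \<in> {0..T}" "s2 \<in> {0..T}" "s3 \<in> {0..T}" "t1 \<in> {0..T}" "t2 \<in> {0..T}" "t3 \<in> {0..T}"
    and le: "s1 \<le> s2" "s2 \<le> s3" "t1 \<le> t2" "t2 \<le> t3"
    by (auto simp: ordered_tuples_iff)
  let ?X = "smooth_sheet T y"
  define W where "W = D_kind T k y"
  have W: "W \<in> incr T" unfolding W_def by (rule D_kind_incr[OF T y])
  note yi = smooth_incr[OF y]
  define c where "c = (\<lambda>s t \<sigma> \<tau>. (y \<sigma> t - y s t) * W \<sigma> \<tau>)"
  have c: "c s t \<in> incr T" if "s \<in> {0..T}" "t \<in> {0..T}" for s t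
    unfolding c_def by (rule field_mult[OF field_diff[OF field_s[OF yi that(2)] field_const] W])
  define e where "e = (\<lambda>s \<sigma> \<tau>. (y \<sigma> t2 - y \<sigma> t1 - (y s t2 - y s t1)) * W \<sigma> \<tau>)"
  have e: "e s \<in> incr T" if "s \<in> {0..T}" for s
    unfolding e_def
    by (rule field_mult[OF field_diff[OF field_diff[OF field_s[OF yi i(5)] field_s[OF yi i(4)]] field_const] W])
  have X: "x_i_j ?X k (s, s') (t, t') = iint s s' t t' W"
    if "(s, s') \<in> ordered_tuples T" "(t, t') \<in> ordered_tuples T" for s s' t t'
    unfolding W_def by (rule smooth_sheet_i_j[OF T y that])
  have X1: "x_1i_0dj ?X k (s, s') (t, t') = iint s s' t t' (c s t)" for s s' t t'
    by (simp add: smooth_sheet_def c_def W_def \<delta>1_eq)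
  have X2: "x_1i_2dj ?X k (s, s') (t1, t2, t3) = iint s s' t2 t3 (e s)" for s s'
    by (simp add: smooth_sheet_def e_def W_def \<delta>_eq)
  have X0: "x_1_0 ?X (s1, s2) t1 = y s2 t1 - y s1 t1" by (simp add: smooth_sheet_def \<delta>1_eq)
  have XP: "x_i_j ?X Plain (s1, s2) (t1, t2) = y s2 t2 - y s2 t1 - (y s1 t2 - y s1 t1)"
    by (simp add: smooth_sheet_def \<delta>_eq)
  show "\<delta>1' (x_i_j ?X k) (s1, s2, s3) (t1, t2) = 0"
    using iint_split_s[OF o(2) o(4) W le(1,2)] by (simp add: \<delta>1'_eq X o)
  show "\<delta>2' (x_i_j ?X k) (s1, s2) (t1, t2, t3) = 0"
    using iint_split_t[OF o(1) o(5) W le(3,4)] by (simp add: \<delta>2'_eq X o)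
  have "\<delta>1' (x_1i_0dj ?X k) (s1, s2, s3) (t1, t2) = iint s2 s3 t1 t2 (c s1 t1) - iint s2 s3 t1 t2 (c s2 t1)"
    using iint_split_s[OF o(2) o(4) c[OF i(1) i(4)] le(1,2)] by (simp add: \<delta>1'_eq X1)
  also have "\<dots> = iint s2 s3 t1 t2 (\<lambda>\<sigma> \<tau>. c s1 t1 \<sigma> \<tau> - c s2 t1 \<sigma> \<tau>)"
    by (rule iint_diff[OF o(3) o(4) c c, symmetric]) (use i in auto)
  also have "\<dots> = iint s2 s3 t1 t2 (\<lambda>\<sigma> \<tau>. (y s2 t1 - y s1 t1) * W \<sigma> \<tau>)"
    by (simp add: c_def algebra_simps)
  finally show "\<delta>1' (x_1i_0dj ?X k) (s1, s2, s3) (t1, t2) = x_1_0 ?X (s1, s2) t1 * x_i_j ?X k (s2, s3) (t1, t2)"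
    by (simp add: iint_cmult X0 X o)
  have "\<delta>2' (x_1i_0dj ?X k) (s1, s2) (t1, t2, t3) = iint s1 s2 t2 t3 (c s1 t1) - iint s1 s2 t2 t3 (c s1 t2)"
    using iint_split_t[OF o(1) o(5) c[OF i(1) i(4)] le(3,4)] by (simp add: \<delta>2'_eq X1)
  also have "\<dots> = iint s1 s2 t2 t3 (\<lambda>\<sigma> \<tau>. c s1 t1 \<sigma> \<tau> - c s1 t2 \<sigma> \<tau>)"
    by (rule iint_diff[OF o(1) o(6) c c, symmetric]) (use i in auto)
  also have "\<dots> = iint s1 s2 t2 t3 (\<lambda>\<sigma> \<tau>. -1 * e s1 \<sigma> \<tau>)"
    by (simp add: c_def e_def algebra_simps)
  finally show "\<delta>2' (x_1i_0dj ?X k) (s1, s2) (t1, t2, t3) = - x_1i_2dj ?X k (s1, s2) (t1, t2, t3)"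
    by (simp only: iint_cmult X2)
  have "\<delta>1' (x_1i_2dj ?X k) (s1, s2, s3) (t1, t2, t3) = iint s2 s3 t2 t3 (e s1) - iint s2 s3 t2 t3 (e s2)"
    using iint_split_s[OF o(2) o(6) e[OF i(1)] le(1,2)] by (simp add: \<delta>1'_eq X2)
  also have "\<dots> = iint s2 s3 t2 t3 (\<lambda>\<sigma> \<tau>. e s1 \<sigma> \<tau> - e s2 \<sigma> \<tau>)"
    by (rule iint_diff[OF o(3) o(6) e e, symmetric]) (use i in auto)
  also have "\<dots> = iint s2 s3 t2 t3 (\<lambda>\<sigma> \<tau>. (y s2 t2 - y s2 t1 - (y s1 t2 - y s1 t1)) * W \<sigma> \<tau>)"
    by (simp add: e_def algebra_simps)
  finally show "\<delta>1' (x_1i_2dj ?X k) (s1, s2, s3) (t1, t2, t3)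
        = x_i_j ?X Plain (s1, s2) (t1, t2) * x_i_j ?X k (s2, s3) (t2, t3)"
    by (simp add: iint_cmult XP X o)
qed

lemma iint_incr:
  fixes F :: "(real \<times> real) \<times> (real \<times> real) \<Rightarrow> real \<Rightarrow> real \<Rightarrow> real"
  assumes F: "continuous_on ((ordered_tuples T \<times> ordered_tuples T) \<times> {0..T} \<times> {0..T}) (\<lambda>(p, \<sigma>, \<tau>). F p \<sigma> \<tau>)"
  shows "(\<lambda>s t. iint (fst s) (snd s) (fst t) (snd t) (F (s, t))) \<in> incr T"
proof -
  have "continuous_on (ordered_tuples T \<times> ordered_tuples T)
      (\<lambda>p. iint (fst (fst p)) (snd (fst p)) (fst (snd p)) (snd (snd p)) (F p))"
    by (rule iint_continuous[OF F]) (auto intro!: continuous_intros simp: ordered_tuples_iff)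
  then show ?thesis
    using pair_not_strict by (fastforce simp: incr_def case_prod_beta)
qed

context
  fixes T :: real and y :: "real \<Rightarrow> real \<Rightarrow> real"
  assumes T: "0 < T" and y: "smooth T y"
begin

lemma incr_square: "f \<in> incr T \<Longrightarrow> (\<lambda>s t. 1/2 * (f s t)\<^sup>2) \<in> incr T"
  unfolding incr_def case_prod_beta by (auto intro!: continuous_intros)

lemma incr_x_1_0: "x_1_0 (smooth_sheet T y) \<in> incr T"
  and incr_x_0_2: "x_0_2 (smooth_sheet T y) \<in> incr T"
  using incr_\<delta>[OF smooth_incr[OF y]] by (simp_all add: smooth_sheet_def)

lemma incr_x_11_00: "x_11_00 (smooth_sheet T y) \<in> incr T"
  and incr_x_00_22: "x_00_22 (smooth_sheet T y) \<in> incr T"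
  using incr_square[OF incr_x_1_0] incr_square[OF incr_x_0_2] by (simp_all add: smooth_sheet_def)

lemma incr_ordered_cong:
  assumes "f \<in> incr T" "\<And>s t. s \<in> ordered_tuples T \<Longrightarrow> t \<in> ordered_tuples T \<Longrightarrow> h s t = f s t"
  shows "h \<in> incr T"
  using assms unfolding incr_def by (auto elim!: continuous_on_eq)

lemma incr_x_i_j: "x_i_j (smooth_sheet T y) k \<in> incr T"
proof (rule incr_ordered_cong[OF iint_incr[where F = "\<lambda>_. D_kind T k y"]])
  show "continuous_on ((ordered_tuples T \<times> ordered_tuples T) \<times> {0..T} \<times> {0..T})
      (\<lambda>((p :: (real \<times> real) \<times> (real \<times> real)), \<sigma>, \<tau>). D_kind T k y \<sigma> \<tau>)"
    unfolding case_prod_beta by (intro field_compose[OF D_kind_incr[OF T y]] continuous_intros) auto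
  show "x_i_j (smooth_sheet T y) k s t = iint (fst s) (snd s) (fst t) (snd t) (D_kind T k y)"
    if "s \<in> ordered_tuples T" "t \<in> ordered_tuples T" for s t
    using smooth_sheet_i_j[OF T y, of "fst s" "snd s" "fst t" "snd t"] that by simp
qed

lemma incr_x_1i_0j: "x_1i_0j (smooth_sheet T y) k \<in> incr T"
proof (rule incr_ordered_cong[OF iint_incr[where F = "\<lambda>p \<sigma> \<tau>. (y \<sigma> \<tau> - y (fst (fst p)) \<tau>) * D_kind T k y \<sigma> \<tau>"]])
  show "continuous_on ((ordered_tuples T \<times> ordered_tuples T) \<times> {0..T} \<times> {0..T})
      (\<lambda>((p :: (real \<times> real) \<times> (real \<times> real)), \<sigma>, \<tau>). (y \<sigma> \<tau> - y (fst (fst p)) \<tau>) * D_kind T k y \<sigma> \<tau>)"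
    unfolding case_prod_beta
    by (intro continuous_on_mult continuous_on_diff field_compose[OF D_kind_incr[OF T y]]
        field_compose[OF smooth_incr[OF y]] continuous_intros) (auto simp: ordered_tuples_iff)
qed (auto simp: smooth_sheet_def case_prod_beta \<delta>1_eq)

lemma incr_x_1i_0dj: "x_1i_0dj (smooth_sheet T y) k \<in> incr T"
proof (rule incr_ordered_cong[OF iint_incr[where F =
    "\<lambda>p \<sigma> \<tau>. (y \<sigma> (fst (snd p)) - y (fst (fst p)) (fst (snd p))) * D_kind T k y \<sigma> \<tau>"]])
  show "continuous_on ((ordered_tuples T \<times> ordered_tuples T) \<times> {0..T} \<times> {0..T})
      (\<lambda>((p :: (real \<times> real) \<times> (real \<times> real)), \<sigma>, \<tau>).
        (y \<sigma> (fst (snd p)) - y (fst (fst p)) (fst (snd p))) * D_kind T k y \<sigma> \<tau>)"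
    unfolding case_prod_beta
    by (intro continuous_on_mult continuous_on_diff field_compose[OF D_kind_incr[OF T y]]
        field_compose[OF smooth_incr[OF y]] continuous_intros) (auto simp: ordered_tuples_iff)
qed (auto simp: smooth_sheet_def case_prod_beta \<delta>1_eq)

lemma incr_x_1i_2j: "x_1i_2j (smooth_sheet T y) k \<in> incr T"
proof (rule incr_ordered_cong[OF iint_incr[where F = "\<lambda>p \<sigma> \<tau>. (y \<sigma> \<tau> - y \<sigma> (fst (snd p))
      - (y (fst (fst p)) \<tau> - y (fst (fst p)) (fst (snd p)))) * D_kind T k y \<sigma> \<tau>"]])
  show "continuous_on ((ordered_tuples T \<times> ordered_tuples T) \<times> {0..T} \<times> {0..T})
      (\<lambda>((p :: (real \<times> real) \<times> (real \<times> real)), \<sigma>, \<tau>). (y \<sigma> \<tau> - y \<sigma> (fst (snd p))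
      - (y (fst (fst p)) \<tau> - y (fst (fst p)) (fst (snd p)))) * D_kind T k y \<sigma> \<tau>)"
    unfolding case_prod_beta
    by (intro continuous_on_mult continuous_on_diff field_compose[OF D_kind_incr[OF T y]]
        field_compose[OF smooth_incr[OF y]] continuous_intros) (auto simp: ordered_tuples_iff)
qed (auto simp: smooth_sheet_def case_prod_beta \<delta>_eq)

lemma incr_x_1i_2dj: "x_1i_2dj (smooth_sheet T y) k \<in> incr T"
proof -
  let ?U = "ordered_tuples T \<times> ordered_tuples T :: ((real \<times> real) \<times> (real \<times> real \<times> real)) set"
  define F where "F = (\<lambda>(p :: (real \<times> real) \<times> (real \<times> real \<times> real)) \<sigma> \<tau>.
      (y \<sigma> (fst (snd (snd p))) - y \<sigma> (fst (snd p))
      - (y (fst (fst p)) (fst (snd (snd p))) - y (fst (fst p)) (fst (snd p)))) * D_kind T k y \<sigma> \<tau>)"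
  have "continuous_on (?U \<times> {0..T} \<times> {0..T}) (\<lambda>(p, \<sigma>, \<tau>). F p \<sigma> \<tau>)"
    unfolding case_prod_beta F_def
    by (intro continuous_on_mult continuous_on_diff field_compose[OF D_kind_incr[OF T y]]
        field_compose[OF smooth_incr[OF y]] continuous_intros) (auto simp: ordered_tuples_iff)
  then have "continuous_on ?U
      (\<lambda>p. iint (fst (fst p)) (snd (fst p)) (fst (snd (snd p))) (snd (snd (snd p))) (F p))"
    by (rule iint_continuous) (auto intro!: continuous_intros simp: ordered_tuples_iff)
  moreover have "x_1i_2dj (smooth_sheet T y) k s t
      = iint (fst s) (snd s) (fst (snd t)) (snd (snd t)) (F (s, t))" for s t
    by (simp add: smooth_sheet_def F_def case_prod_beta \<delta>_eq)
  moreover have "iint (fst s) (snd s) (fst (snd t)) (snd (snd t)) (F (s, t)) = 0"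
    if o: "s \<in> ordered_tuples T" "t \<in> ordered_tuples T" "s \<notin> strict_tuples T \<or> t \<notin> strict_tuples T" for s t
  proof -
    consider "snd s = fst s" | "fst t = fst (snd t)" | "snd (snd t) = fst (snd t)"
      using o pair_not_strict[of s T] triple_not_strict[of t T] by metis
    then show ?thesis by cases (simp_all add: F_def)
  qed
  ultimately show ?thesis by (simp add: incr_def case_prod_beta)
qed

end

section \<open>Geometric rough sheets and controlled fields\<close>

lemma SUP_ennreal_tendsto:
  assumes "(\<lambda>n. SUP p\<in>A. ennreal (F n p)) \<longlonglongrightarrow> 0" "p \<in> A" "\<And>n. 0 \<le> F n p"
  shows "(\<lambda>n. F n p) \<longlonglongrightarrow> 0"
proof -
  have "(\<lambda>n. ennreal (F n p)) \<longlonglongrightarrow> 0"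
    by (rule tendsto_sandwich[OF _ _ tendsto_const assms(1)])
      (auto intro!: always_eventually SUP_upper assms(2))
  then have "(\<lambda>n. ennreal (F n p)) \<longlonglongrightarrow> ennreal 0" by simp
  then show ?thesis using assms(3) by (subst (asm) tendsto_ennreal_iff) auto
qed

lemma hnorm_pointwise:
  assumes "(\<lambda>n. hnorm T a b (\<lambda>s t. f n s t - F s t)) \<longlonglongrightarrow> 0"
    and "s \<in> strict_tuples T" "t \<in> strict_tuples T" and pos: "0 < width s" "0 < width t"
  shows "(\<lambda>n. f n s t) \<longlonglongrightarrow> F s t"
proof -
  define w where "w = width s powr a * width t powr b"
  have w: "0 < w" using pos by (simp add: w_def)
  have "(\<lambda>n. case (s, t) of (s, t) \<Rightarrow> \<bar>f n s t - F s t\<bar> / (width s powr a * width t powr b)) \<longlonglongrightarrow> 0"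
    by (rule SUP_ennreal_tendsto[where A = "strict_tuples T \<times> strict_tuples T"])
       (use assms in \<open>auto simp: hnorm_def case_prod_beta\<close>)
  then have "(\<lambda>n. \<bar>f n s t - F s t\<bar> / w) \<longlonglongrightarrow> 0" by (simp only: w_def prod.case)
  from tendsto_mult_left[OF this, of w] w have "(\<lambda>n. \<bar>f n s t - F s t\<bar>) \<longlonglongrightarrow> 0" by simp
  then show ?thesis by (simp add: tendsto_rabs_zero_iff LIM_zero_iff)
qed

lemma hnorm1_pointwise:
  assumes "(\<lambda>n. hnorm1 T a (\<lambda>s t. f n s t - F s t)) \<longlonglongrightarrow> 0"
    and "s \<in> strict_tuples T" "t \<in> {0..T}"
  shows "(\<lambda>n. f n s t) \<longlonglongrightarrow> F s t"
proof -
  have w: "0 < width s powr a" using width_pos(1)[OF assms(2)] by simp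
  have "(\<lambda>n. case (s, t) of (s, t) \<Rightarrow> \<bar>f n s t - F s t\<bar> / width s powr a) \<longlonglongrightarrow> 0"
    by (rule SUP_ennreal_tendsto[where A = "strict_tuples T \<times> {0..T}"])
       (use assms in \<open>auto simp: hnorm1_def case_prod_beta\<close>)
  from tendsto_mult_left[OF this, of "width s powr a"] w have "(\<lambda>n. \<bar>f n s t - F s t\<bar>) \<longlonglongrightarrow> 0" by simp
  then show ?thesis by (simp add: tendsto_rabs_zero_iff LIM_zero_iff)
qed

lemma holder_limit_pointwise:
  fixes F :: "'s::tuple \<Rightarrow> 't::tuple \<Rightarrow> real"
  assumes lim: "holder_limit T a b f F" and f: "\<And>n. f n \<in> incr T"
    and st: "s \<in> ordered_tuples T" "t \<in> ordered_tuples T"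
    and pos: "\<And>s::'s. s \<in> strict_tuples T \<Longrightarrow> 0 < width s" "\<And>t::'t. t \<in> strict_tuples T \<Longrightarrow> 0 < width t"
  shows "(\<lambda>n. f n s t) \<longlonglongrightarrow> F s t"
proof (cases "s \<in> strict_tuples T \<and> t \<in> strict_tuples T")
  case True
  then show ?thesis using lim pos by (intro hnorm_pointwise[of T a b]) (auto simp: holder_limit_def)
next
  case False
  have "F \<in> incr T" using lim by (simp add: holder_limit_def holder_def)
  then have "f n s t = 0" "F s t = 0" for n
    using incr_zero[OF _ st] False f by blast+
  then show ?thesis by simp
qed

text \<open>A geometric rough sheet above \<open>x\<close> inherits the algebraic relations of the smooth sheets, and its first
  order components are the increments of \<open>x\<close>.\<close>

lemma geometric_rough_sheetD:
  assumes T: "0 < T" and X: "geometric_rough_sheet T \<gamma>1 \<gamma>2 x X"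
  shows "chen_relations T X"
    and "s \<in> ordered_tuples T \<Longrightarrow> t \<in> {0..T} \<Longrightarrow> x_1_0 X s t = \<delta>1 x s t"
    and "s \<in> ordered_tuples T \<Longrightarrow> u \<in> ordered_tuples T \<Longrightarrow> x_i_j X Plain s u = \<delta> x s u"
    and "x_i_j X k \<in> holder T \<gamma>1 \<gamma>2" "x_1i_0dj X k \<in> holder T (2*\<gamma>1) \<gamma>2"
    and "x_1i_2dj X k \<in> holder T (2*\<gamma>1) (2*\<gamma>2)"
proof -
  obtain y where y: "\<And>n. smooth T (y n)"
    and x: "(\<lambda>n. field_norm T \<gamma>1 \<gamma>2 (\<lambda>s t. x s t - y n s t)) \<longlonglongrightarrow> 0"
    and lim: "sheet_limit T \<gamma>1 \<gamma>2 (\<lambda>n. smooth_sheet T (y n)) X"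
    using X unfolding geometric_rough_sheet_def by blast
  let ?Y = "\<lambda>n. smooth_sheet T (y n)"
  have l: "holder_limit1 T \<gamma>1 (\<lambda>n. x_1_0 (?Y n)) (x_1_0 X)"
      "holder_limit T \<gamma>1 \<gamma>2 (\<lambda>n. x_i_j (?Y n) k) (x_i_j X k)"
      "holder_limit T (2*\<gamma>1) \<gamma>2 (\<lambda>n. x_1i_0dj (?Y n) k) (x_1i_0dj X k)"
      "holder_limit T (2*\<gamma>1) (2*\<gamma>2) (\<lambda>n. x_1i_2dj (?Y n) k) (x_1i_2dj X k)" for k
    using lim by (simp_all add: sheet_limit_def)
  show "x_i_j X k \<in> holder T \<gamma>1 \<gamma>2" "x_1i_0dj X k \<in> holder T (2*\<gamma>1) \<gamma>2"
    "x_1i_2dj X k \<in> holder T (2*\<gamma>1) (2*\<gamma>2)"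
    using l(2-4)[of k] by (simp_all add: holder_limit_def)
  have p: "(\<lambda>n. x_i_j (?Y n) k s t) \<longlonglongrightarrow> x_i_j X k s t"
    "(\<lambda>n. x_1i_0dj (?Y n) k s t) \<longlonglongrightarrow> x_1i_0dj X k s t"
    if "s \<in> ordered_tuples T" "t \<in> ordered_tuples T" for k s t
    by (rule holder_limit_pointwise[OF l(2) incr_x_i_j[OF T y] that width_pos(1) width_pos(1)]
        holder_limit_pointwise[OF l(3) incr_x_1i_0dj[OF T y] that width_pos(1) width_pos(1)]; assumption)+
  have p2: "(\<lambda>n. x_1i_2dj (?Y n) k s t) \<longlonglongrightarrow> x_1i_2dj X k s t"
    if "s \<in> ordered_tuples T" "t \<in> ordered_tuples T" for k s t
    by (rule holder_limit_pointwise[OF l(4) incr_x_1i_2dj[OF T y] that width_pos(1) width_pos(2)])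
  have p0: "(\<lambda>n. x_1_0 (?Y n) s t) \<longlonglongrightarrow> x_1_0 X s t" if "s \<in> ordered_tuples T" "t \<in> {0..T}" for s t
  proof (cases "s \<in> strict_tuples T")
    case True
    then show ?thesis using l(1) that by (intro hnorm1_pointwise[of T \<gamma>1]) (auto simp: holder_limit1_def)
  next
    case False
    have "x_1_0 X \<in> incr T" using l(1) by (simp add: holder_limit1_def holder1_def)
    then have "x_1_0 (?Y n) s t = 0" "x_1_0 X s t = 0" for n
      using incr_zero[OF _ that(1), of _ t] False incr_x_1_0[OF T y, of n] that by (auto simp: ordered_tuples_real)
    then show ?thesis by simp
  qed
  show "chen_relations T X"
    unfolding chen_relations_def
  proof (intro allI impI conjI)
    fix k s1 s2 s3 t1 t2 t3
    assume st: "(s1::real, s2::real, s3::real) \<in> ordered_tuples T" "(t1::real, t2::real, t3::real) \<in> ordered_tuples T"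
    then have o: "(s1, s2) \<in> ordered_tuples T" "(s1, s3) \<in> ordered_tuples T" "(s2, s3) \<in> ordered_tuples T"
      "(t1, t2) \<in> ordered_tuples T" "(t1, t3) \<in> ordered_tuples T" "(t2, t3) \<in> ordered_tuples T" "t1 \<in> {0..T}"
      by (auto simp: ordered_tuples_iff)
    note R = smooth_chen_relations[OF T y, unfolded chen_relations_def, rule_format, OF st]
    show "\<delta>1' (x_i_j X k) (s1, s2, s3) (t1, t2) = 0"
    proof (rule LIMSEQ_unique)
      show "(\<lambda>n. \<delta>1' (x_i_j (?Y n) k) (s1, s2, s3) (t1, t2)) \<longlonglongrightarrow> \<delta>1' (x_i_j X k) (s1, s2, s3) (t1, t2)"
        unfolding \<delta>1'_eq by (intro tendsto_diff p o)
      show "(\<lambda>n. \<delta>1' (x_i_j (?Y n) k) (s1, s2, s3) (t1, t2)) \<longlonglongrightarrow> 0"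
        unfolding R[THEN conjunct1] by (intro tendsto_const)
    qed
    show "\<delta>2' (x_i_j X k) (s1, s2) (t1, t2, t3) = 0"
    proof (rule LIMSEQ_unique)
      show "(\<lambda>n. \<delta>2' (x_i_j (?Y n) k) (s1, s2) (t1, t2, t3)) \<longlonglongrightarrow> \<delta>2' (x_i_j X k) (s1, s2) (t1, t2, t3)"
        unfolding \<delta>2'_eq by (intro tendsto_diff p o)
      show "(\<lambda>n. \<delta>2' (x_i_j (?Y n) k) (s1, s2) (t1, t2, t3)) \<longlonglongrightarrow> 0"
        unfolding R[THEN conjunct2, THEN conjunct1] by (intro tendsto_const)
    qed
    show "\<delta>1' (x_1i_0dj X k) (s1, s2, s3) (t1, t2) = x_1_0 X (s1, s2) t1 * x_i_j X k (s2, s3) (t1, t2)"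
    proof (rule LIMSEQ_unique)
      show "(\<lambda>n. \<delta>1' (x_1i_0dj (?Y n) k) (s1, s2, s3) (t1, t2)) \<longlonglongrightarrow> \<delta>1' (x_1i_0dj X k) (s1, s2, s3) (t1, t2)"
        unfolding \<delta>1'_eq by (intro tendsto_diff p o)
      show "(\<lambda>n. \<delta>1' (x_1i_0dj (?Y n) k) (s1, s2, s3) (t1, t2)) \<longlonglongrightarrow> x_1_0 X (s1, s2) t1 * x_i_j X k (s2, s3) (t1, t2)"
        unfolding R[THEN conjunct2, THEN conjunct2, THEN conjunct1] by (intro tendsto_mult p p0 o)
    qed
    show "\<delta>2' (x_1i_0dj X k) (s1, s2) (t1, t2, t3) = - x_1i_2dj X k (s1, s2) (t1, t2, t3)"
    proof (rule LIMSEQ_unique)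
      show "(\<lambda>n. \<delta>2' (x_1i_0dj (?Y n) k) (s1, s2) (t1, t2, t3)) \<longlonglongrightarrow> \<delta>2' (x_1i_0dj X k) (s1, s2) (t1, t2, t3)"
        unfolding \<delta>2'_eq by (intro tendsto_diff p o)
      show "(\<lambda>n. \<delta>2' (x_1i_0dj (?Y n) k) (s1, s2) (t1, t2, t3)) \<longlonglongrightarrow> - x_1i_2dj X k (s1, s2) (t1, t2, t3)"
        unfolding R[THEN conjunct2, THEN conjunct2, THEN conjunct2, THEN conjunct1] by (intro tendsto_minus p2 o st)
    qed
    show "\<delta>1' (x_1i_2dj X k) (s1, s2, s3) (t1, t2, t3) = x_i_j X Plain (s1, s2) (t1, t2) * x_i_j X k (s2, s3) (t2, t3)"
    proof (rule LIMSEQ_unique)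
      show "(\<lambda>n. \<delta>1' (x_1i_2dj (?Y n) k) (s1, s2, s3) (t1, t2, t3)) \<longlonglongrightarrow> \<delta>1' (x_1i_2dj X k) (s1, s2, s3) (t1, t2, t3)"
        unfolding \<delta>1'_eq by (intro tendsto_diff p2 o st)
      show "(\<lambda>n. \<delta>1' (x_1i_2dj (?Y n) k) (s1, s2, s3) (t1, t2, t3)) \<longlonglongrightarrow> x_i_j X Plain (s1, s2) (t1, t2) * x_i_j X k (s2, s3) (t2, t3)"
        unfolding R[THEN conjunct2, THEN conjunct2, THEN conjunct2, THEN conjunct2] by (intro tendsto_mult p o)
    qed
  qed
  have lin: "\<delta>1 (\<lambda>s t. x s t - y n s t) s t = \<delta>1 x s t - \<delta>1 (y n) s t"
    "\<delta> (\<lambda>s t. x s t - y n s t) s u = \<delta> x s u - \<delta> (y n) s u" for n s t u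
    by (cases s; cases u; simp add: \<delta>1_eq \<delta>_eq)+
  have "(\<lambda>n. hnorm1 T \<gamma>1 (\<lambda>s t. \<delta>1 x s t - \<delta>1 (y n) s t)) \<longlonglongrightarrow> 0"
    by (rule tendsto_sandwich[OF _ _ tendsto_const x])
       (auto simp: field_norm_def lin[abs_def] add.assoc add.left_commute intro!: always_eventually)
  then have x1: "(\<lambda>n. hnorm1 T \<gamma>1 (\<lambda>s t. \<delta>1 (y n) s t - \<delta>1 x s t)) \<longlonglongrightarrow> 0"
    by (simp add: hnorm1_def abs_minus_commute)
  have "(\<lambda>n. hnorm T \<gamma>1 \<gamma>2 (\<lambda>s t. \<delta> x s t - \<delta> (y n) s t)) \<longlonglongrightarrow> 0"
    by (rule tendsto_sandwich[OF _ _ tendsto_const x])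
       (auto simp: field_norm_def lin[abs_def] add.assoc intro!: always_eventually)
  then have x12: "(\<lambda>n. hnorm T \<gamma>1 \<gamma>2 (\<lambda>s t. \<delta> (y n) s t - \<delta> x s t)) \<longlonglongrightarrow> 0"
    by (simp add: hnorm_def abs_minus_commute)
  show "x_1_0 X s t = \<delta>1 x s t" if "s \<in> ordered_tuples T" "t \<in> {0..T}"
  proof (cases "s \<in> strict_tuples T")
    case True
    have "(\<lambda>n. \<delta>1 (y n) s t) \<longlonglongrightarrow> \<delta>1 x s t" by (rule hnorm1_pointwise[OF x1 True that(2)])
    moreover have "(\<lambda>n. \<delta>1 (y n) s t) \<longlonglongrightarrow> x_1_0 X s t"
      using p0[OF that] by (simp add: smooth_sheet_def)
    ultimately show ?thesis by (rule LIMSEQ_unique[rotated])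
  next
    case False
    have "x_1_0 X \<in> incr T" using l(1) by (simp add: holder_limit1_def holder1_def)
    then have "x_1_0 X s t = 0" using incr_zero[of "x_1_0 X" T s t] False that by (auto simp: ordered_tuples_real)
    moreover have "\<delta>1 x s t = 0" using pair_not_strict[OF that(1) False] by (cases s) (simp add: \<delta>1_eq)
    ultimately show ?thesis by simp
  qed
  show "x_i_j X Plain s u = \<delta> x s u" if "s \<in> ordered_tuples T" "u \<in> ordered_tuples T"
  proof (cases "s \<in> strict_tuples T \<and> u \<in> strict_tuples T")
    case True
    then have "(\<lambda>n. \<delta> (y n) s u) \<longlonglongrightarrow> \<delta> x s u"
      using width_pos(1)[of s T] width_pos(1)[of u T] by (intro hnorm_pointwise[OF x12]) auto
    moreover have "(\<lambda>n. \<delta> (y n) s u) \<longlonglongrightarrow> x_i_j X Plain s u"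
      using p(1)[OF that, of Plain] by (simp add: smooth_sheet_def)
    ultimately show ?thesis by (rule LIMSEQ_unique[rotated])
  next
    case False
    have "x_i_j X Plain \<in> incr T" using l(2)[of Plain] by (simp add: holder_limit_def holder_def)
    then have "x_i_j X Plain s u = 0" using incr_zero[of "x_i_j X Plain" T s u] False that by auto
    moreover have "\<delta> x s u = 0"
      using pair_not_strict[OF that(1)] pair_not_strict[OF that(2)] False by (cases s; cases u) (auto simp: \<delta>_eq)
    ultimately show ?thesis by simp
  qed
qed

lemma germ_incr:
  assumes "x_i_j X k \<in> incr T" "x_1i_0dj X k \<in> incr T" "\<zeta> \<in> incr T" "\<zeta>1 \<in> incr T"
  shows "germ k X \<zeta> \<zeta>1 \<in> incr T"
proof -
  let ?A = "ordered_tuples T \<times> ordered_tuples T :: ((real \<times> real) \<times> (real \<times> real)) set"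
  have "continuous_on ?A (\<lambda>x. \<zeta> (fst (fst x)) (fst (snd x)) * x_i_j X k (fst x) (snd x)
      + \<zeta>1 (fst (fst x)) (fst (snd x)) * x_1i_0dj X k (fst x) (snd x))"
    by (intro continuous_on_add continuous_on_mult field_compose[OF assms(3)] field_compose[OF assms(4)]
        incr_compose[OF assms(1)] incr_compose[OF assms(2)] continuous_intros)
      (auto simp: ordered_tuples_iff)
  then show ?thesis
    using incr_zero[OF assms(1)] incr_zero[OF assms(2)] by (simp add: incr_def germ_def case_prod_beta)
qed

text \<open>The regularity of the germs. In each coboundary the terms of low order cancel by the Chen relations
  and by the definition of a controlled field.\<close>

lemma controlled_germ2d:
  assumes T: "0 < T" and \<gamma>: "1/3 < \<gamma>1" "1/2 < \<gamma>2"
    and X: "geometric_rough_sheet T \<gamma>1 \<gamma>2 x X" and c: "controlled T \<gamma>1 \<gamma>2 x \<zeta> \<zeta>1 r"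
  shows "\<exists>C. germ2d T \<gamma>1 \<gamma>2 (3*\<gamma>1) (2*\<gamma>2) C (germ k X \<zeta> \<zeta>1)"
proof -
  note XD = geometric_rough_sheetD[OF T X]
  have cF: "\<zeta> \<in> holder_field T \<gamma>1 \<gamma>2" "\<zeta>1 \<in> holder_field T \<gamma>1 \<gamma>2"
    "r \<in> holder1 T (2*\<gamma>1)" "\<delta>2 r \<in> holder T (2*\<gamma>1) \<gamma>2"
    using c by (auto simp: controlled_def)
  obtain M1 where "field_bounded_by T \<gamma>1 \<gamma>2 M1 \<zeta>"
    using holder_field_bounded[OF cF(1)] by blast
  note M1 = field_bounded_byD[OF this]
  obtain M2 where "field_bounded_by T \<gamma>1 \<gamma>2 M2 \<zeta>1"
    using holder_field_bounded[OF cF(2)] by blast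
  note M2 = field_bounded_byD[OF this]
  obtain M3 where M3: "0 \<le> M3" "\<And>s t. s \<in> ordered_tuples T \<Longrightarrow> t \<in> {0..T} \<Longrightarrow> \<bar>r s t\<bar> \<le> M3 * width s powr (2*\<gamma>1)"
    using holder1D[OF cF(3)] by blast
  obtain M4 where M4: "0 \<le> M4" "\<And>s t. s \<in> ordered_tuples T \<Longrightarrow> t \<in> ordered_tuples T \<Longrightarrow>
      \<bar>\<delta>2 r s t\<bar> \<le> M4 * width s powr (2*\<gamma>1) * width t powr \<gamma>2"
    using holder22D[OF cF(4)] by blast
  obtain M5 where M5: "0 \<le> M5" "\<And>s t. s \<in> ordered_tuples T \<Longrightarrow> t \<in> ordered_tuples T \<Longrightarrow>
      \<bar>x_i_j X k s t\<bar> \<le> M5 * width s powr \<gamma>1 * width t powr \<gamma>2"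
    using holder22D[OF XD(4)[of k]] by blast
  obtain M6 where M6: "0 \<le> M6" "\<And>s t. s \<in> ordered_tuples T \<Longrightarrow> t \<in> ordered_tuples T \<Longrightarrow>
      \<bar>x_1i_0dj X k s t\<bar> \<le> M6 * width s powr (2*\<gamma>1) * width t powr \<gamma>2"
    using holder22D[OF XD(5)[of k]] by blast
  obtain M7 where M7: "0 \<le> M7" "\<And>s t. s \<in> ordered_tuples T \<Longrightarrow> t \<in> ordered_tuples T \<Longrightarrow>
      \<bar>x_1i_2dj X k s t\<bar> \<le> M7 * width s powr (2*\<gamma>1) * width t powr (2*\<gamma>2)"
    using holder23D[OF XD(6)[of k]] by blast
  define M where "M = M1 + M2 + M3 + M4 + M5 + M6 + M7"
  have M: "0 \<le> M" "M1 \<le> M" "M2 \<le> M" "M3 \<le> M" "M4 \<le> M" "M5 \<le> M" "M6 \<le> M" "M7 \<le> M"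
    using M1(1) M2(1) M3(1) M4(1) M5(1) M6(1) M7(1) by (auto simp: M_def)
  \<comment> \<open>All bounds hold with the constant \<open>M\<close>, and with the powers \<open>P S\<close>, \<open>Q U\<close> of the lengths \<open>S\<close>, \<open>U\<close> of any larger intervals.\<close>
  define P where "P = (\<lambda>w::real. w powr \<gamma>1)"
  define Q where "Q = (\<lambda>w::real. w powr \<gamma>2)"
  have PQ: "0 \<le> P w" "0 \<le> Q w" "w powr (2*\<gamma>1) = P w * P w" "w powr (2*\<gamma>2) = Q w * Q w"
    "w powr (3*\<gamma>1) = P w * P w * P w" for w
  proof -
    have "w powr (3*\<gamma>1) = w powr (\<gamma>1 + \<gamma>1 + \<gamma>1)" by (rule arg_cong[where f = "\<lambda>e. w powr e"]) simp
    then show "w powr (3*\<gamma>1) = P w * P w * P w" by (simp only: powr_add P_def)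
    show "w powr (2*\<gamma>1) = P w * P w" "w powr (2*\<gamma>2) = Q w * Q w"
      by (simp_all only: mult_2 powr_add P_def Q_def)
  qed (simp_all add: P_def Q_def)
  have mono: "P v \<le> P w" "Q v \<le> Q w" if "0 \<le> v" "v \<le> w" for v w
    using that \<gamma> by (auto simp: P_def Q_def intro!: powr_mono2)
  have up: "m * A \<le> M * B" if "0 \<le> m" "m \<le> M" "0 \<le> A" "A \<le> B" for m A B
    using that M(1) by (intro mult_mono) auto
  have bnd: "\<bar>u\<bar> \<le> M * B" if "\<bar>u\<bar> \<le> m * A" "0 \<le> m" "m \<le> M" "0 \<le> A" "A \<le> B" for u m A B
    using that(1) up[OF that(2-5)] by linarith
  have bz: "\<bar>\<zeta> s t\<bar> \<le> M" "\<bar>\<zeta>1 s t\<bar> \<le> M" if "s \<in> {0..T}" "t \<in> {0..T}" for s t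
    using M1(2)[OF that] M2(2)[OF that] M by linarith+
  have b2z: "\<bar>\<delta>2 \<zeta> s (t, t')\<bar> \<le> M * Q U" "\<bar>\<delta>2 \<zeta>1 s (t, t')\<bar> \<le> M * Q U"
    if "s \<in> {0..T}" "(t, t') \<in> ordered_tuples T" "t' - t \<le> U" for s t t' U
  proof -
    have m: "Q (t' - t) \<le> Q U" using that by (intro mono) (auto simp: ordered_tuples_iff)
    show "\<bar>\<delta>2 \<zeta> s (t, t')\<bar> \<le> M * Q U"
      by (rule bnd[OF _ M1(1) M(2) _ m]) (use M1(5)[OF that(1,2)] in \<open>auto simp: width_simps Q_def\<close>)
    show "\<bar>\<delta>2 \<zeta>1 s (t, t')\<bar> \<le> M * Q U"
      by (rule bnd[OF _ M2(1) M(3) _ m]) (use M2(5)[OF that(1,2)] in \<open>auto simp: width_simps Q_def\<close>)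
  qed
  have b1z: "\<bar>\<delta>1 \<zeta>1 (s, s') t\<bar> \<le> M * P S"
    if "(s, s') \<in> ordered_tuples T" "t \<in> {0..T}" "s' - s \<le> S" for s s' t S
  proof -
    have m: "P (s' - s) \<le> P S" using that by (intro mono) (auto simp: ordered_tuples_iff)
    show ?thesis
      by (rule bnd[OF _ M2(1) M(3) _ m]) (use M2(4)[OF that(1,2)] in \<open>auto simp: width_simps P_def\<close>)
  qed
  have br: "\<bar>r (s, s') t\<bar> \<le> M * (P S * P S)"
    if "(s, s') \<in> ordered_tuples T" "t \<in> {0..T}" "s' - s \<le> S" for s s' t S
  proof -
    have "P (s' - s) \<le> P S" using that by (intro mono) (auto simp: ordered_tuples_iff)
    then have m: "P (s' - s) * P (s' - s) \<le> P S * P S" using PQ by (intro mult_mono) auto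
    show ?thesis
      by (rule bnd[OF _ M3(1) M(4) _ m]) (use M3(2)[OF that(1,2)] in \<open>auto simp: width_simps PQ(3)\<close>)
  qed
  have rect: "\<bar>\<delta> \<zeta>1 (s, s') (t, t')\<bar> \<le> M * (P S * Q U)"
    "\<bar>\<delta>2 r (s, s') (t, t')\<bar> \<le> M * (P S * P S * Q U)"
    "\<bar>x_i_j X k (s, s') (t, t')\<bar> \<le> M * (P S * Q U)"
    "\<bar>x_1i_0dj X k (s, s') (t, t')\<bar> \<le> M * (P S * P S * Q U)"
    if "(s, s') \<in> ordered_tuples T" "(t, t') \<in> ordered_tuples T" "s' - s \<le> S" "t' - t \<le> U" for s s' t t' S U
  proof -
    have le: "0 \<le> s' - s" "0 \<le> t' - t" using that by (auto simp: ordered_tuples_iff)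
    have m: "P (s' - s) * Q (t' - t) \<le> P S * Q U"
      "P (s' - s) * P (s' - s) * Q (t' - t) \<le> P S * P S * Q U"
      using le that by (auto intro!: mult_mono mono PQ mult_nonneg_nonneg)
    show "\<bar>\<delta> \<zeta>1 (s, s') (t, t')\<bar> \<le> M * (P S * Q U)"
      by (rule bnd[OF _ M2(1) M(3) _ m(1)])
        (use M2(3)[OF that(1,2)] in \<open>auto simp: width_simps P_def Q_def mult.assoc\<close>)
    show "\<bar>x_i_j X k (s, s') (t, t')\<bar> \<le> M * (P S * Q U)"
      by (rule bnd[OF _ M5(1) M(6) _ m(1)])
        (use M5(2)[OF that(1,2)] in \<open>auto simp: width_simps P_def Q_def mult.assoc\<close>)
    show "\<bar>\<delta>2 r (s, s') (t, t')\<bar> \<le> M * (P S * P S * Q U)"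
      by (rule bnd[OF _ M4(1) M(5) _ m(2)])
        (use M4(2)[OF that(1,2)] PQ in \<open>auto simp: width_simps PQ(3) Q_def mult.assoc\<close>)
    show "\<bar>x_1i_0dj X k (s, s') (t, t')\<bar> \<le> M * (P S * P S * Q U)"
      by (rule bnd[OF _ M6(1) M(7) _ m(2)])
        (use M6(2)[OF that(1,2)] PQ in \<open>auto simp: width_simps PQ(3) Q_def mult.assoc\<close>)
  qed
  have rect3: "\<bar>x_1i_2dj X k (s, s') (t1, t2, t3)\<bar> \<le> M * (P S * P S * (Q (t3 - t1) * Q (t3 - t1)))"
    if "(s, s') \<in> ordered_tuples T" "(t1, t2, t3) \<in> ordered_tuples T" "s' - s \<le> S" for s s' t1 t2 t3 S
  proof -
    have "0 \<le> s' - s" using that by (auto simp: ordered_tuples_iff)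
    then have m: "P (s' - s) * P (s' - s) * (Q (t3 - t1) * Q (t3 - t1)) \<le> P S * P S * (Q (t3 - t1) * Q (t3 - t1))"
      using that by (auto intro!: mult_mono mono PQ mult_nonneg_nonneg)
    show ?thesis
      by (rule bnd[OF _ M7(1) M(8) _ m])
        (use M7(2)[OF that(1,2)] PQ in \<open>auto simp: width_simps PQ(3,4) mult.assoc\<close>)
  qed
  let ?g = "germ k X \<zeta> \<zeta>1"
  let ?C = "M * M * (3 + 2 * P T)"
  note ch = XD(1)[unfolded chen_relations_def, rule_format]
  have g: "?g (s, s') (t, t') = \<zeta> s t * x_i_j X k (s, s') (t, t') + \<zeta>1 s t * x_1i_0dj X k (s, s') (t, t')"
    for s s' t t' by (simp add: germ_def)
  have d1: "\<delta>1' ?g (s1, s2, s3) (t1, t2)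
      = - (r (s1, s2) t1 * x_i_j X k (s2, s3) (t1, t2)) - \<delta>1 \<zeta>1 (s1, s2) t1 * x_1i_0dj X k (s2, s3) (t1, t2)"
    if s: "(s1, s2, s3) \<in> ordered_tuples T" and t: "(t1, t2) \<in> ordered_tuples T" for s1 s2 s3 t1 t2
  proof -
    have o: "(s1, s2) \<in> ordered_tuples T" "t1 \<in> {0..T}" "(t1, t2, t2) \<in> ordered_tuples T"
      using s t by (auto simp: ordered_tuples_iff)
    have "\<delta>1 \<zeta> (s1, s2) t1 = \<zeta>1 s1 t1 * \<delta>1 x (s1, s2) t1 + r (s1, s2) t1"
      using c o unfolding controlled_def by blast
    moreover note conjunct1[OF ch[OF s o(3)], of k]
    moreover note conjunct1[OF conjunct2[OF conjunct2[OF ch[OF s o(3)]]], of k]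
    moreover note XD(2)[OF o(1,2)]
    ultimately show ?thesis
      unfolding \<delta>1'_eq g \<delta>1_eq by algebra
  qed
  have d2: "\<delta>2' ?g (s, s') (t1, t2, t3)
      = - (\<delta>2 \<zeta> s (t1, t2) * x_i_j X k (s, s') (t2, t3)) - \<delta>2 \<zeta>1 s (t1, t2) * x_1i_0dj X k (s, s') (t2, t3)
        - \<zeta>1 s t1 * x_1i_2dj X k (s, s') (t1, t2, t3)"
    if s: "(s, s') \<in> ordered_tuples T" and t: "(t1, t2, t3) \<in> ordered_tuples T" for s s' t1 t2 t3
  proof -
    have o: "(s, s', s') \<in> ordered_tuples T" using s by (auto simp: ordered_tuples_iff)
    note conjunct1[OF conjunct2[OF ch[OF o t]], of k]
    moreover note conjunct1[OF conjunct2[OF conjunct2[OF conjunct2[OF ch[OF o t]]]], of k]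
    ultimately show ?thesis
      unfolding \<delta>2'_eq g \<delta>2_eq by algebra
  qed
  have d12: "\<delta>' ?g (s1, s2, s3) (t1, t2, t3)
      = \<delta>2 r (s1, s2) (t1, t2) * x_i_j X k (s2, s3) (t2, t3)
        + \<delta> \<zeta>1 (s1, s2) (t1, t2) * x_1i_0dj X k (s2, s3) (t2, t3)
        + \<delta>1 \<zeta>1 (s1, s2) t1 * x_1i_2dj X k (s2, s3) (t1, t2, t3)"
    if s: "(s1, s2, s3) \<in> ordered_tuples T" and t: "(t1, t2, t3) \<in> ordered_tuples T" for s1 s2 s3 t1 t2 t3
  proof -
    have o: "(s1, s2) \<in> ordered_tuples T" "(s1, s3) \<in> ordered_tuples T" "(s2, s3) \<in> ordered_tuples T"
      "(t1, t2) \<in> ordered_tuples T" "(t2, t3, t3) \<in> ordered_tuples T" "t2 \<in> {0..T}"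
      using s t by (auto simp: ordered_tuples_iff)
    have "\<delta> \<zeta> (s1, s2) (t1, t2) = \<zeta>1 s1 t1 * \<delta> x (s1, s2) (t1, t2) + \<delta>2 \<zeta>1 s1 (t1, t2) * \<delta>1 x (s1, s2) t2
          + \<delta>2 r (s1, s2) (t1, t2)"
      using c o(1,4) unfolding controlled_def by blast
    moreover note conjunct1[OF ch[OF s o(5)], of k]
    moreover note conjunct1[OF conjunct2[OF conjunct2[OF ch[OF s o(5)]]], of k]
    moreover note conjunct2[OF conjunct2[OF conjunct2[OF conjunct2[OF ch[OF s t]]]], of k]
    moreover note XD(2)[OF o(1,6)] XD(3)[OF o(1,4)]
    ultimately show ?thesis
      unfolding \<delta>'_def \<delta>1'_eq d2[OF o(1) t] d2[OF o(2) t] d2[OF o(3) t] \<delta>_eq \<delta>2_eq \<delta>1_eq by algebra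
  qed
  have PT: "P (width s) \<le> P T" if "s \<in> ordered_tuples T" for s :: "real \<times> real"
    using width_le[OF that] by (intro mono) auto
  have "germ2d T \<gamma>1 \<gamma>2 (3*\<gamma>1) (2*\<gamma>2) ?C ?g"
  proof
    show "?g \<in> incr T"
      using XD(4,5)[of k] holder_field_split(1)[OF cF(1)] holder_field_split(1)[OF cF(2)]
      by (intro germ_incr) (auto simp: holder_def)
    show "0 \<le> ?C" using M PQ by simp
  next
    fix s t :: "real \<times> real" assume st: "s \<in> ordered_tuples T" "t \<in> ordered_tuples T"
    obtain s1 s2 t1 t2 where e: "s = (s1, s2)" "t = (t1, t2)" by (cases s; cases t)
    let ?S = "width s" and ?U = "width t"
    have i: "s1 \<in> {0..T}" "t1 \<in> {0..T}" using st by (auto simp: e ordered_tuples_iff)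
    have "\<bar>\<zeta> s1 t1 * x_i_j X k s t\<bar> \<le> M * (M * (P ?S * Q ?U))"
      using rect(3)[OF st[unfolded e], of ?S ?U] by (intro abs_mult_le bz i) (simp add: e width_simps)
    moreover have "\<bar>\<zeta>1 s1 t1 * x_1i_0dj X k s t\<bar> \<le> M * (M * (P ?S * P ?S * Q ?U))"
      using rect(4)[OF st[unfolded e], of ?S ?U] by (intro abs_mult_le bz i) (simp add: e width_simps)
    ultimately have "\<bar>?g s t\<bar> \<le> M * (M * (P ?S * Q ?U)) + M * (M * (P ?S * P ?S * Q ?U))"
      unfolding e g by linarith
    also have "\<dots> = M * M * (1 + P ?S) * (P ?S * Q ?U)" by (simp add: algebra_simps)
    also have "\<dots> \<le> ?C * (P ?S * Q ?U)"
    proof (intro mult_right_mono mult_left_mono mult_nonneg_nonneg PQ M)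
      show "1 + P ?S \<le> 3 + 2 * P T" using PT[OF st(1)] PQ(1)[of T] by linarith
    qed
    finally show "\<bar>?g s t\<bar> \<le> ?C * ?S powr \<gamma>1 * ?U powr \<gamma>2" by (simp add: P_def Q_def mult.assoc)
  next
    fix s :: "real \<times> real \<times> real" and t :: "real \<times> real"
    assume st: "s \<in> ordered_tuples T" "t \<in> ordered_tuples T"
    obtain s1 s2 s3 t1 t2 where e: "s = (s1, s2, s3)" "t = (t1, t2)" by (cases s; cases t)
    let ?S = "width s" and ?U = "width t"
    have o: "(s1, s2) \<in> ordered_tuples T" "(s2, s3) \<in> ordered_tuples T" "(t1, t2) \<in> ordered_tuples T"
      "t1 \<in> {0..T}" "s2 - s1 \<le> ?S" "s3 - s2 \<le> ?S" "t2 - t1 \<le> ?U"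
      using st by (auto simp: e ordered_tuples_iff width_simps)
    have "\<bar>r (s1, s2) t1 * x_i_j X k (s2, s3) (t1, t2)\<bar> \<le> M * (P ?S * P ?S) * (M * (P ?S * Q ?U))"
      by (intro abs_mult_le br rect o)
    moreover have "\<bar>\<delta>1 \<zeta>1 (s1, s2) t1 * x_1i_0dj X k (s2, s3) (t1, t2)\<bar> \<le> M * P ?S * (M * (P ?S * P ?S * Q ?U))"
      by (intro abs_mult_le b1z rect o)
    ultimately have "\<bar>\<delta>1' ?g s t\<bar> \<le> M * (P ?S * P ?S) * (M * (P ?S * Q ?U)) + M * P ?S * (M * (P ?S * P ?S * Q ?U))"
      unfolding e d1[OF st[unfolded e]] by linarith
    also have "\<dots> = M * M * 2 * (P ?S * P ?S * P ?S * Q ?U)" by (simp add: algebra_simps)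
    also have "\<dots> \<le> ?C * (P ?S * P ?S * P ?S * Q ?U)"
      using M PQ(1)[of T] by (intro mult_right_mono mult_left_mono mult_nonneg_nonneg PQ) auto
    finally show "\<bar>\<delta>1' ?g s t\<bar> \<le> ?C * ?S powr (3*\<gamma>1) * ?U powr \<gamma>2"
      by (simp add: PQ(5) Q_def mult.assoc)
  next
    fix s :: "real \<times> real" and t :: "real \<times> real \<times> real"
    assume st: "s \<in> ordered_tuples T" "t \<in> ordered_tuples T"
    obtain s1 s2 t1 t2 t3 where e: "s = (s1, s2)" "t = (t1, t2, t3)" by (cases s; cases t)
    let ?S = "width s" and ?U = "width t"
    have o: "(s1, s2) \<in> ordered_tuples T" "(t1, t2) \<in> ordered_tuples T" "(t2, t3) \<in> ordered_tuples T"
      "s1 \<in> {0..T}" "t1 \<in> {0..T}" "s2 - s1 \<le> ?S" "t2 - t1 \<le> ?U" "t3 - t2 \<le> ?U"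
      using st by (auto simp: e ordered_tuples_iff width_simps)
    have U: "?U = t3 - t1" by (simp add: e width_simps)
    have "\<bar>\<delta>2 \<zeta> s1 (t1, t2) * x_i_j X k (s1, s2) (t2, t3)\<bar> \<le> M * Q ?U * (M * (P ?S * Q ?U))"
      by (intro abs_mult_le b2z rect o)
    moreover have "\<bar>\<delta>2 \<zeta>1 s1 (t1, t2) * x_1i_0dj X k (s1, s2) (t2, t3)\<bar> \<le> M * Q ?U * (M * (P ?S * P ?S * Q ?U))"
      by (intro abs_mult_le b2z rect o)
    moreover have "\<bar>\<zeta>1 s1 t1 * x_1i_2dj X k (s1, s2) (t1, t2, t3)\<bar> \<le> M * (M * (P ?S * P ?S * (Q ?U * Q ?U)))"
      unfolding U by (intro abs_mult_le bz rect3 o st(2)[unfolded e])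
    ultimately have "\<bar>\<delta>2' ?g s t\<bar> \<le> M * Q ?U * (M * (P ?S * Q ?U)) + M * Q ?U * (M * (P ?S * P ?S * Q ?U))
        + M * (M * (P ?S * P ?S * (Q ?U * Q ?U)))"
      unfolding e d2[OF st[unfolded e]] by linarith
    also have "\<dots> = M * M * (1 + 2 * P ?S) * (P ?S * (Q ?U * Q ?U))" by (simp add: algebra_simps)
    also have "\<dots> \<le> ?C * (P ?S * (Q ?U * Q ?U))"
      using PT[OF st(1)] M by (intro mult_right_mono mult_left_mono mult_nonneg_nonneg PQ) auto
    finally show "\<bar>\<delta>2' ?g s t\<bar> \<le> ?C * ?S powr \<gamma>1 * ?U powr (2*\<gamma>2)"
      by (simp add: PQ(4) P_def mult.assoc)
  next
    fix s t :: "real \<times> real \<times> real"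
    assume st: "s \<in> ordered_tuples T" "t \<in> ordered_tuples T"
    obtain s1 s2 s3 t1 t2 t3 where e: "s = (s1, s2, s3)" "t = (t1, t2, t3)" by (cases s; cases t)
    let ?S = "width s" and ?U = "width t"
    have o: "(s1, s2) \<in> ordered_tuples T" "(s2, s3) \<in> ordered_tuples T"
      "(t1, t2) \<in> ordered_tuples T" "(t2, t3) \<in> ordered_tuples T" "t1 \<in> {0..T}"
      "s2 - s1 \<le> ?S" "s3 - s2 \<le> ?S" "t2 - t1 \<le> ?U" "t3 - t2 \<le> ?U"
      using st by (auto simp: e ordered_tuples_iff width_simps)
    have U: "?U = t3 - t1" by (simp add: e width_simps)
    have "\<bar>\<delta>2 r (s1, s2) (t1, t2) * x_i_j X k (s2, s3) (t2, t3)\<bar> \<le> M * (P ?S * P ?S * Q ?U) * (M * (P ?S * Q ?U))"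
      by (intro abs_mult_le rect o)
    moreover have "\<bar>\<delta> \<zeta>1 (s1, s2) (t1, t2) * x_1i_0dj X k (s2, s3) (t2, t3)\<bar>
        \<le> M * (P ?S * Q ?U) * (M * (P ?S * P ?S * Q ?U))"
      by (intro abs_mult_le rect o)
    moreover have "\<bar>\<delta>1 \<zeta>1 (s1, s2) t1 * x_1i_2dj X k (s2, s3) (t1, t2, t3)\<bar>
        \<le> M * P ?S * (M * (P ?S * P ?S * (Q ?U * Q ?U)))"
      using b1z[OF o(1,5,6)] rect3[OF o(2) st(2)[unfolded e] o(7)] unfolding U by (intro abs_mult_le)
    ultimately have "\<bar>\<delta>' ?g s t\<bar> \<le> M * (P ?S * P ?S * Q ?U) * (M * (P ?S * Q ?U))
        + M * (P ?S * Q ?U) * (M * (P ?S * P ?S * Q ?U)) + M * P ?S * (M * (P ?S * P ?S * (Q ?U * Q ?U)))"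
      unfolding e d12[OF st[unfolded e]] by linarith
    also have "\<dots> = M * M * 3 * (P ?S * P ?S * P ?S * (Q ?U * Q ?U))" by (simp add: algebra_simps)
    also have "\<dots> \<le> ?C * (P ?S * P ?S * P ?S * (Q ?U * Q ?U))"
      using M PQ(1)[of T] by (intro mult_right_mono mult_left_mono mult_nonneg_nonneg PQ) auto
    finally show "\<bar>\<delta>' ?g s t\<bar> \<le> ?C * ?S powr (3*\<gamma>1) * ?U powr (2*\<gamma>2)"
      by (simp add: PQ(4,5) mult.assoc)
  qed (use T \<gamma> in auto)
  then show ?thesis by blast
qed

section \<open>Smooth fields as rough sheets\<close>

text \<open>Hoelder continuity with an exponent greater than one forces a function to be constant.\<close>

lemma holder_constant:
  fixes x :: "real \<Rightarrow> real \<Rightarrow> real"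
  assumes "x \<in> holder_field T a b" "1 < b" "s \<in> {0..T}" "t \<in> {0..T}"
  shows "x s t = x s 0"
proof -
  obtain C where C: "0 \<le> C" "\<And>s t. s \<in> {0..T} \<Longrightarrow> t \<in> ordered_tuples T \<Longrightarrow> \<bar>\<delta>2 x s t\<bar> \<le> C * width t powr b"
    using holder2D[OF holder_field_split(4)[OF assms(1)]] by blast
  have o: "(0::real, t) \<in> ordered_tuples T" using assms(4) by (simp add: ordered_tuples_iff)
  have "sew_int (\<lambda>_. 0) (0, t) = \<delta>2 x s (0, t)"
  proof (rule sew_int_unique(2)[OF additive_midpoint[where T = T and J = "\<delta>2 x s"] _ assms(2) o])
    show "\<bar>\<delta>2 x s q - 0\<bar> \<le> C * width q powr b" if "q \<in> ordered_tuples T" for q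
      using C(2)[OF assms(3) that] by simp
  qed (simp_all add: \<delta>2_eq)
  moreover have "sew_int (\<lambda>_. 0) (0, t) = 0" unfolding sew_int_def eq_sum_def by simp
  ultimately show ?thesis by (simp add: \<delta>2_eq)
qed

lemma D_kind_eq_0:
  assumes T: "0 < T" and x: "x \<in> holder_field T a b" and b: "1 < b" and s: "s \<in> {0..T}" and t: "t \<in> {0..T}"
  shows "D_kind T k x s t = 0"
proof -
  have 2: "pd2 T x u t = 0" if u: "u \<in> {0..T}" for u
    unfolding pd2_def
    by (rule vector_derivative_within_closed_interval[OF T t])
      (rule has_vector_derivative_transform[OF t holder_constant[OF x b u] has_vector_derivative_const])
  have "pd12 T x s t = 0"
    unfolding pd12_def pd1_def
    by (rule vector_derivative_within_closed_interval[OF T s])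
      (rule has_vector_derivative_transform[OF s 2 has_vector_derivative_const])
  then show ?thesis using 2[OF s] by (cases k) auto
qed

text \<open>The bound behind the regularity of all components of a smooth sheet. For \<open>\<gamma>2 > 1\<close> it holds because
  \<open>x\<close> does not depend on its second variable.\<close>

lemma weighted_iint_bound:
  assumes T: "0 < T" and y: "smooth T x" and x: "x \<in> holder_field T \<gamma>1 \<gamma>2" and \<gamma>: "\<gamma>1 \<le> 1"
  obtains K where "0 \<le> K" "\<And>s1 s2 t1 t2 c B. (s1, s2) \<in> ordered_tuples T \<Longrightarrow> (t1, t2) \<in> ordered_tuples T \<Longrightarrow>
    c \<in> incr T \<Longrightarrow> 0 \<le> B \<Longrightarrow>
    (\<And>\<sigma> \<tau>. s1 \<le> \<sigma> \<Longrightarrow> \<sigma> \<le> s2 \<Longrightarrow> t1 \<le> \<tau> \<Longrightarrow> \<tau> \<le> t2 \<Longrightarrow> \<bar>c \<sigma> \<tau>\<bar> \<le> B) \<Longrightarrow>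
    \<bar>iint s1 s2 t1 t2 (\<lambda>\<sigma> \<tau>. c \<sigma> \<tau> * D_kind T k x \<sigma> \<tau>)\<bar> \<le> B * (K * ((s2 - s1) powr \<gamma>1 * (t2 - t1) powr \<gamma>2))"
proof (cases "1 < \<gamma>2")
  case True
  have "iint s1 s2 t1 t2 (\<lambda>\<sigma> \<tau>. c \<sigma> \<tau> * D_kind T k x \<sigma> \<tau>) = 0"
    if "(s1, s2) \<in> ordered_tuples T" "(t1, t2) \<in> ordered_tuples T" for s1 s2 t1 t2 c
  proof -
    have "iint s1 s2 t1 t2 (\<lambda>\<sigma> \<tau>. c \<sigma> \<tau> * D_kind T k x \<sigma> \<tau>) = iint s1 s2 t1 t2 (\<lambda>\<sigma> \<tau>. 0)"
      using that by (intro iint_cong) (auto simp: D_kind_eq_0[OF T x True] ordered_tuples_iff)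
    then show ?thesis by simp
  qed
  then show ?thesis using that[of 0] by simp
next
  case False
  note W = D_kind_incr[OF T y, of k]
  obtain M where M: "0 \<le> M" "\<And>s t. s \<in> {0..T} \<Longrightarrow> t \<in> {0..T} \<Longrightarrow> \<bar>D_kind T k x s t\<bar> \<le> M"
    using field_bounded[OF W] by blast
  define K where "K = M * (T powr (1 - \<gamma>1) * T powr (1 - \<gamma>2))"
  show ?thesis
  proof (rule that[of K])
    show "0 \<le> K" using M by (simp add: K_def)
    fix s1 s2 t1 t2 B and c :: "real \<Rightarrow> real \<Rightarrow> real"
    assume s: "(s1, s2) \<in> ordered_tuples T" and t: "(t1, t2) \<in> ordered_tuples T" and c: "c \<in> incr T"
      and B: "0 \<le> B" "\<And>\<sigma> \<tau>. s1 \<le> \<sigma> \<Longrightarrow> \<sigma> \<le> s2 \<Longrightarrow> t1 \<le> \<tau> \<Longrightarrow> \<tau> \<le> t2 \<Longrightarrow> \<bar>c \<sigma> \<tau>\<bar> \<le> B"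
    have le: "0 \<le> s2 - s1" "s2 - s1 \<le> T" "0 \<le> t2 - t1" "t2 - t1 \<le> T"
      using s t by (auto simp: ordered_tuples_iff)
    have "\<bar>iint s1 s2 t1 t2 (\<lambda>\<sigma> \<tau>. c \<sigma> \<tau> * D_kind T k x \<sigma> \<tau>)\<bar> \<le> B * M * (s2 - s1) * (t2 - t1)"
      using s t by (intro iint_bound[OF s t field_mult[OF c W]] abs_mult_le B(2) M(2)) (auto simp: ordered_tuples_iff)
    also have "\<dots> \<le> B * M * (T powr (1 - \<gamma>1) * (s2 - s1) powr \<gamma>1) * (T powr (1 - \<gamma>2) * (t2 - t1) powr \<gamma>2)"
      using powr_weaken[OF le(1,2) \<gamma>] powr_weaken[OF le(3,4), of \<gamma>2 1] le False B M
      by (intro mult_mono mult_nonneg_nonneg order_refl) auto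
    finally show "\<bar>iint s1 s2 t1 t2 (\<lambda>\<sigma> \<tau>. c \<sigma> \<tau> * D_kind T k x \<sigma> \<tau>)\<bar>
        \<le> B * (K * ((s2 - s1) powr \<gamma>1 * (t2 - t1) powr \<gamma>2))"
      by (simp add: K_def mult_ac)
  qed
qed

lemma holder_limit_const:
  "F \<in> holder T a b \<Longrightarrow> holder_limit T a b (\<lambda>n. F) F"
  "F' \<in> holder1 T a \<Longrightarrow> holder_limit1 T a (\<lambda>n. F') F'"
  "F'' \<in> holder2 T b \<Longrightarrow> holder_limit2 T b (\<lambda>n. F'') F''"
proof -
  have "hnorm T a b (\<lambda>s t. F s t - F s t) = 0" "hnorm1 T a (\<lambda>s t. F' s t - F' s t) = 0"
    "hnorm2 T b (\<lambda>s t. F'' s t - F'' s t) = 0"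
    unfolding hnorm_def hnorm1_def hnorm2_def by (intro antisym SUP_least; auto)+
  then show "F \<in> holder T a b \<Longrightarrow> holder_limit T a b (\<lambda>n. F) F"
    "F' \<in> holder1 T a \<Longrightarrow> holder_limit1 T a (\<lambda>n. F') F'"
    "F'' \<in> holder2 T b \<Longrightarrow> holder_limit2 T b (\<lambda>n. F'') F''"
    by (simp_all add: holder_limit_def holder_limit1_def holder_limit2_def)
qed

lemma smooth_geometric_rough_sheet:
  assumes T: "0 < T" and \<gamma>: "0 < \<gamma>1" "\<gamma>1 \<le> 1" "0 < \<gamma>2" and x: "x \<in> holder_field T \<gamma>1 \<gamma>2" and y: "smooth T x"
  shows "geometric_rough_sheet T \<gamma>1 \<gamma>2 x (smooth_sheet T x)"
proof -
  let ?X = "smooth_sheet T x"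
  note xs = holder_field_split[OF x]
  obtain C where "field_bounded_by T \<gamma>1 \<gamma>2 C x"
    using holder_field_bounded[OF x] by blast
  note C = field_bounded_byD[OF this]
  have dbl: "w powr (2 * \<gamma>) = w powr \<gamma> * w powr \<gamma>" for w \<gamma> :: real
    by (simp only: mult_2 powr_add)
  have h1: "x_1_0 ?X \<in> holder1 T \<gamma>1" and h2: "x_0_2 ?X \<in> holder2 T \<gamma>2"
    using xs by (simp_all add: smooth_sheet_def)
  have h11: "x_11_00 ?X \<in> holder1 T (2*\<gamma>1)"
  proof (rule holder1I[OF incr_x_11_00[OF T y], of "C * C"])
    fix s :: "real \<times> real" and t :: real assume "s \<in> ordered_tuples T" "t \<in> {0..T}"
    from C(4)[OF this] have "\<bar>\<delta>1 x s t\<bar> * \<bar>\<delta>1 x s t\<bar> \<le> (C * width s powr \<gamma>1) * (C * width s powr \<gamma>1)"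
      using C(1) by (intro mult_mono) auto
    then have "\<bar>\<delta>1 x s t\<bar> * \<bar>\<delta>1 x s t\<bar> \<le> C * C * (width s powr \<gamma>1 * width s powr \<gamma>1)"
      by (simp only: mult_ac)
    moreover have "\<bar>x_11_00 ?X s t\<bar> = 1/2 * (\<bar>\<delta>1 x s t\<bar> * \<bar>\<delta>1 x s t\<bar>)"
      by (simp add: smooth_sheet_def power2_eq_square)
    moreover have "0 \<le> \<bar>\<delta>1 x s t\<bar> * \<bar>\<delta>1 x s t\<bar>" by simp
    ultimately show "\<bar>x_11_00 ?X s t\<bar> \<le> C * C * width s powr (2*\<gamma>1)"
      unfolding dbl by linarith
  qed (use C in simp)
  have h22: "x_00_22 ?X \<in> holder2 T (2*\<gamma>2)"
  proof (rule holder2I[OF incr_x_00_22[OF T y], of "C * C"])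
    fix s :: real and t :: "real \<times> real" assume "s \<in> {0..T}" "t \<in> ordered_tuples T"
    from C(5)[OF this] have "\<bar>\<delta>2 x s t\<bar> * \<bar>\<delta>2 x s t\<bar> \<le> (C * width t powr \<gamma>2) * (C * width t powr \<gamma>2)"
      using C(1) by (intro mult_mono) auto
    then have "\<bar>\<delta>2 x s t\<bar> * \<bar>\<delta>2 x s t\<bar> \<le> C * C * (width t powr \<gamma>2 * width t powr \<gamma>2)"
      by (simp only: mult_ac)
    moreover have "\<bar>x_00_22 ?X s t\<bar> = 1/2 * (\<bar>\<delta>2 x s t\<bar> * \<bar>\<delta>2 x s t\<bar>)"
      by (simp add: smooth_sheet_def power2_eq_square)
    moreover have "0 \<le> \<bar>\<delta>2 x s t\<bar> * \<bar>\<delta>2 x s t\<bar>" by simp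
    ultimately show "\<bar>x_00_22 ?X s t\<bar> \<le> C * C * width t powr (2*\<gamma>2)"
      unfolding dbl by linarith
  qed (use C in simp)
  have hk: "x_i_j ?X k \<in> holder T \<gamma>1 \<gamma>2" "x_1i_0j ?X k \<in> holder T (2*\<gamma>1) \<gamma>2"
    "x_1i_0dj ?X k \<in> holder T (2*\<gamma>1) \<gamma>2" "x_1i_2j ?X k \<in> holder T (2*\<gamma>1) (2*\<gamma>2)"
    "x_1i_2dj ?X k \<in> holder T (2*\<gamma>1) (2*\<gamma>2)" for k
  proof -
    obtain K where K: "0 \<le> K" "\<And>s1 s2 t1 t2 c B. (s1, s2) \<in> ordered_tuples T \<Longrightarrow> (t1, t2) \<in> ordered_tuples T \<Longrightarrow>
      c \<in> incr T \<Longrightarrow> 0 \<le> B \<Longrightarrow>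
      (\<And>\<sigma> \<tau>. s1 \<le> \<sigma> \<Longrightarrow> \<sigma> \<le> s2 \<Longrightarrow> t1 \<le> \<tau> \<Longrightarrow> \<tau> \<le> t2 \<Longrightarrow> \<bar>c \<sigma> \<tau>\<bar> \<le> B) \<Longrightarrow>
      \<bar>iint s1 s2 t1 t2 (\<lambda>\<sigma> \<tau>. c \<sigma> \<tau> * D_kind T k x \<sigma> \<tau>)\<bar> \<le> B * (K * ((s2 - s1) powr \<gamma>1 * (t2 - t1) powr \<gamma>2))"
      using weighted_iint_bound[OF T y x \<gamma>(2), of k] by blast
    have xi: "x \<in> incr T" by (rule smooth_incr[OF y])
    have b1: "\<bar>x \<sigma> \<tau> - x s1 \<tau>\<bar> \<le> C * (s2 - s1) powr \<gamma>1"
      if "(s1, s2) \<in> ordered_tuples T" "\<tau> \<in> {0..T}" "s1 \<le> \<sigma>" "\<sigma> \<le> s2" for s1 s2 \<sigma> \<tau>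
    proof -
      have "\<bar>x \<sigma> \<tau> - x s1 \<tau>\<bar> \<le> C * (\<sigma> - s1) powr \<gamma>1"
        using C(4)[of "(s1, \<sigma>)" \<tau>] that by (simp add: ordered_tuples_iff \<delta>1_eq width_simps)
      also have "\<dots> \<le> C * (s2 - s1) powr \<gamma>1"
        using that C(1) \<gamma> by (intro mult_left_mono powr_mono2) auto
      finally show ?thesis .
    qed
    have b2: "\<bar>x \<sigma> \<tau> - x \<sigma> t1 - (x s1 \<tau> - x s1 t1)\<bar> \<le> C * (s2 - s1) powr \<gamma>1 * (t2 - t1) powr \<gamma>2"
      if "(s1, s2) \<in> ordered_tuples T" "(t1, t2) \<in> ordered_tuples T" "s1 \<le> \<sigma>" "\<sigma> \<le> s2" "t1 \<le> \<tau>" "\<tau> \<le> t2"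
      for s1 s2 t1 t2 \<sigma> \<tau>
    proof -
      have "\<bar>x \<sigma> \<tau> - x \<sigma> t1 - (x s1 \<tau> - x s1 t1)\<bar> \<le> C * (\<sigma> - s1) powr \<gamma>1 * (\<tau> - t1) powr \<gamma>2"
        using C(3)[of "(s1, \<sigma>)" "(t1, \<tau>)"] that by (simp add: ordered_tuples_iff \<delta>_eq width_simps)
      also have "\<dots> \<le> C * (s2 - s1) powr \<gamma>1 * (t2 - t1) powr \<gamma>2"
        using that C(1) \<gamma> by (intro mult_mono mult_left_mono powr_mono2 mult_nonneg_nonneg) auto
      finally show ?thesis .
    qed
    show "x_i_j ?X k \<in> holder T \<gamma>1 \<gamma>2"
    proof (rule holderI[OF incr_x_i_j[OF T y] K(1)])
      fix s t :: "real \<times> real" assume st: "s \<in> ordered_tuples T" "t \<in> ordered_tuples T"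
      obtain s1 s2 t1 t2 where e: "s = (s1, s2)" "t = (t1, t2)" by (cases s; cases t)
      show "\<bar>x_i_j ?X k s t\<bar> \<le> K * width s powr \<gamma>1 * width t powr \<gamma>2"
        using K(2)[OF st[unfolded e] field_const, of 1 1] smooth_sheet_i_j[OF T y st[unfolded e], of k]
        by (simp add: e width_simps mult.assoc)
    qed
    show "x_1i_0j ?X k \<in> holder T (2*\<gamma>1) \<gamma>2"
    proof (rule holderI[OF incr_x_1i_0j[OF T y], of "C * K"])
      fix s t :: "real \<times> real" assume st: "s \<in> ordered_tuples T" "t \<in> ordered_tuples T"
      obtain s1 s2 t1 t2 where e: "s = (s1, s2)" "t = (t1, t2)" by (cases s; cases t)
      have i: "s1 \<in> {0..T}" using st by (auto simp: e ordered_tuples_iff)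
      have "\<bar>iint s1 s2 t1 t2 (\<lambda>\<sigma> \<tau>. (x \<sigma> \<tau> - x s1 \<tau>) * D_kind T k x \<sigma> \<tau>)\<bar>
          \<le> C * (s2 - s1) powr \<gamma>1 * (K * ((s2 - s1) powr \<gamma>1 * (t2 - t1) powr \<gamma>2))"
        using st C(1) by (intro K(2)[OF st[unfolded e] field_diff[OF xi field_t[OF xi i]]] b1)
          (auto simp: e ordered_tuples_iff)
      then show "\<bar>x_1i_0j ?X k s t\<bar> \<le> C * K * width s powr (2*\<gamma>1) * width t powr \<gamma>2"
        unfolding dbl by (simp add: e smooth_sheet_def \<delta>1_eq width_simps mult_ac)
    qed (use C K in simp)
    show "x_1i_0dj ?X k \<in> holder T (2*\<gamma>1) \<gamma>2"
    proof (rule holderI[OF incr_x_1i_0dj[OF T y], of "C * K"])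
      fix s t :: "real \<times> real" assume st: "s \<in> ordered_tuples T" "t \<in> ordered_tuples T"
      obtain s1 s2 t1 t2 where e: "s = (s1, s2)" "t = (t1, t2)" by (cases s; cases t)
      have i: "t1 \<in> {0..T}" using st by (auto simp: e ordered_tuples_iff)
      have "\<bar>iint s1 s2 t1 t2 (\<lambda>\<sigma> \<tau>. (x \<sigma> t1 - x s1 t1) * D_kind T k x \<sigma> \<tau>)\<bar>
          \<le> C * (s2 - s1) powr \<gamma>1 * (K * ((s2 - s1) powr \<gamma>1 * (t2 - t1) powr \<gamma>2))"
        using st C(1) by (intro K(2)[OF st[unfolded e] field_diff[OF field_s[OF xi i] field_const]] b1)
          (auto simp: e ordered_tuples_iff)
      then show "\<bar>x_1i_0dj ?X k s t\<bar> \<le> C * K * width s powr (2*\<gamma>1) * width t powr \<gamma>2"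
        unfolding dbl by (simp add: e smooth_sheet_def \<delta>1_eq width_simps mult_ac)
    qed (use C K in simp)
    show "x_1i_2j ?X k \<in> holder T (2*\<gamma>1) (2*\<gamma>2)"
    proof (rule holderI[OF incr_x_1i_2j[OF T y], of "C * K"])
      fix s t :: "real \<times> real" assume st: "s \<in> ordered_tuples T" "t \<in> ordered_tuples T"
      obtain s1 s2 t1 t2 where e: "s = (s1, s2)" "t = (t1, t2)" by (cases s; cases t)
      have i: "s1 \<in> {0..T}" "t1 \<in> {0..T}" using st by (auto simp: e ordered_tuples_iff)
      have c: "(\<lambda>\<sigma> \<tau>. x \<sigma> \<tau> - x \<sigma> t1 - (x s1 \<tau> - x s1 t1)) \<in> incr T"
        by (rule field_diff[OF field_diff[OF xi field_s[OF xi i(2)]] field_diff[OF field_t[OF xi i(1)] field_const]])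
      have "\<bar>iint s1 s2 t1 t2 (\<lambda>\<sigma> \<tau>. (x \<sigma> \<tau> - x \<sigma> t1 - (x s1 \<tau> - x s1 t1)) * D_kind T k x \<sigma> \<tau>)\<bar>
          \<le> C * (s2 - s1) powr \<gamma>1 * (t2 - t1) powr \<gamma>2 * (K * ((s2 - s1) powr \<gamma>1 * (t2 - t1) powr \<gamma>2))"
        using C(1) by (intro K(2)[OF st[unfolded e] c] b2 st[unfolded e]) auto
      then show "\<bar>x_1i_2j ?X k s t\<bar> \<le> C * K * width s powr (2*\<gamma>1) * width t powr (2*\<gamma>2)"
        unfolding dbl by (simp add: e smooth_sheet_def \<delta>_eq width_simps mult_ac)
    qed (use C K in simp)
    show "x_1i_2dj ?X k \<in> holder T (2*\<gamma>1) (2*\<gamma>2)"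
    proof (rule holderI[OF incr_x_1i_2dj[OF T y], of "C * K"])
      fix s :: "real \<times> real" and t :: "real \<times> real \<times> real"
      assume st: "s \<in> ordered_tuples T" "t \<in> ordered_tuples T"
      obtain s1 s2 t1 t2 t3 where e: "s = (s1, s2)" "t = (t1, t2, t3)" by (cases s; cases t)
      have i: "s1 \<in> {0..T}" "t1 \<in> {0..T}" "t2 \<in> {0..T}" "0 \<le> t3 - t2" "t3 - t2 \<le> t3 - t1"
        and o: "(s1, s2) \<in> ordered_tuples T" "(t1, t3) \<in> ordered_tuples T" "(t2, t3) \<in> ordered_tuples T"
        and le: "t1 \<le> t2" "t2 \<le> t3"
        using st by (auto simp: e ordered_tuples_iff)
      have c: "(\<lambda>\<sigma> (\<tau>::real). x \<sigma> t2 - x \<sigma> t1 - (x s1 t2 - x s1 t1)) \<in> incr T"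
        by (rule field_diff[OF field_diff[OF field_s[OF xi i(3)] field_s[OF xi i(2)]] field_const])
      have "\<bar>iint s1 s2 t2 t3 (\<lambda>\<sigma> \<tau>. (x \<sigma> t2 - x \<sigma> t1 - (x s1 t2 - x s1 t1)) * D_kind T k x \<sigma> \<tau>)\<bar>
          \<le> C * (s2 - s1) powr \<gamma>1 * (t3 - t1) powr \<gamma>2 * (K * ((s2 - s1) powr \<gamma>1 * (t3 - t2) powr \<gamma>2))"
        using C(1) by (intro K(2)[OF o(1,3) c] b2[OF o(1,2)] le) auto
      also have "\<dots> \<le> C * (s2 - s1) powr \<gamma>1 * (t3 - t1) powr \<gamma>2 * (K * ((s2 - s1) powr \<gamma>1 * (t3 - t1) powr \<gamma>2))"
        using C(1) K(1) i(4,5) \<gamma> by (intro mult_left_mono powr_mono2) auto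
      finally show "\<bar>x_1i_2dj ?X k s t\<bar> \<le> C * K * width s powr (2*\<gamma>1) * width t powr (2*\<gamma>2)"
        unfolding dbl by (simp add: e smooth_sheet_def \<delta>_eq width_simps mult_ac)
    qed (use C K in simp)
  qed
  have zero: "field_norm T \<gamma>1 \<gamma>2 (\<lambda>s t. x s t - x s t) = 0"
  proof -
    have "\<delta> (\<lambda>s t. x s t - x s t) s t = 0" "\<delta>1 (\<lambda>s t. x s t - x s t) s u = 0"
      "\<delta>2 (\<lambda>s t. x s t - x s t) u t = 0" for s t u
      by (cases s; cases t; simp add: \<delta>_eq \<delta>1_eq \<delta>2_eq)+
    then have "hnorm T \<gamma>1 \<gamma>2 (\<delta> (\<lambda>s t. x s t - x s t)) = 0" "hnorm1 T \<gamma>1 (\<delta>1 (\<lambda>s t. x s t - x s t)) = 0"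
      "hnorm2 T \<gamma>2 (\<delta>2 (\<lambda>s t. x s t - x s t)) = 0"
      unfolding hnorm_def hnorm1_def hnorm2_def by (intro antisym SUP_least; force)+
    then show ?thesis by (simp add: field_norm_def)
  qed
  have "sheet_limit T \<gamma>1 \<gamma>2 (\<lambda>n. ?X) ?X"
    unfolding sheet_limit_def using h1 h2 h11 h22 hk by (simp add: holder_limit_const)
  then show ?thesis
    \<comment> \<open>The constant sequence \<open>x\<close> approximates \<open>x\<close>.\<close>
    unfolding geometric_rough_sheet_def using y zero by (intro exI[of _ "\<lambda>n. x"]) simp
qed

lemma smooth_rough_integral:
  assumes T: "0 < T" and \<gamma>: "1/3 < \<gamma>1" "\<gamma>1 < 1/2" "1/2 < \<gamma>2"
    and x: "x \<in> holder_field T \<gamma>1 \<gamma>2" and y: "smooth T x"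
    and c: "controlled T \<gamma>1 \<gamma>2 x \<zeta> \<zeta>1 r"
    and s: "(s1, s2) \<in> ordered_tuples T" and t: "(t1, t2) \<in> ordered_tuples T"
  shows "rough_integral T k (smooth_sheet T x) \<zeta> \<zeta>1 (s1, s2) (t1, t2)
    = iint s1 s2 t1 t2 (\<lambda>\<sigma> \<tau>. \<zeta> \<sigma> \<tau> * D_kind T k x \<sigma> \<tau>)"
proof -
  have X: "geometric_rough_sheet T \<gamma>1 \<gamma>2 x (smooth_sheet T x)"
    using \<gamma> by (intro smooth_geometric_rough_sheet[OF T _ _ _ x y]) auto
  obtain C where "germ2d T \<gamma>1 \<gamma>2 (3*\<gamma>1) (2*\<gamma>2) C (germ k (smooth_sheet T x) \<zeta> \<zeta>1)"
    using controlled_germ2d[OF T \<gamma>(1,3) X c] by blast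
  then interpret germ2d T \<gamma>1 \<gamma>2 "3*\<gamma>1" "2*\<gamma>2" C "germ k (smooth_sheet T x) \<zeta> \<zeta>1" .
  have cF: "\<zeta> \<in> holder_field T \<gamma>1 \<gamma>2" "\<zeta>1 \<in> holder_field T \<gamma>1 \<gamma>2" "r \<in> holder1 T (2*\<gamma>1)"
    using c by (auto simp: controlled_def)
  note xi = smooth_incr[OF y]
  note zi = holder_field_split(1)[OF cF(1)] holder_field_split(1)[OF cF(2)]
  define W where "W = D_kind T k x"
  have W: "W \<in> incr T" unfolding W_def by (rule D_kind_incr[OF T y])
  obtain MW where MW: "0 \<le> MW" "\<And>s t. s \<in> {0..T} \<Longrightarrow> t \<in> {0..T} \<Longrightarrow> \<bar>W s t\<bar> \<le> MW"
    using field_bounded[OF W] by blast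
  obtain M0 where "field_bounded_by T \<gamma>1 \<gamma>2 M0 x"
    using holder_field_bounded[OF x] by blast
  note M0 = field_bounded_byD[OF this]
  obtain M1 where "field_bounded_by T \<gamma>1 \<gamma>2 M1 \<zeta>"
    using holder_field_bounded[OF cF(1)] by blast
  note M1 = field_bounded_byD[OF this]
  obtain M2 where "field_bounded_by T \<gamma>1 \<gamma>2 M2 \<zeta>1"
    using holder_field_bounded[OF cF(2)] by blast
  note M2 = field_bounded_byD[OF this]
  obtain M3 where M3: "0 \<le> M3" "\<And>s t. s \<in> ordered_tuples T \<Longrightarrow> t \<in> {0..T} \<Longrightarrow> \<bar>r s t\<bar> \<le> M3 * width s powr (2*\<gamma>1)"
    using holder1D[OF cF(3)] by blast
  \<comment> \<open>\<open>q s\<close> is the expansion of first order of \<open>\<zeta>\<close> at \<open>s\<close> in its first variable, with error \<open>r (s, \<sigma>) \<tau>\<close>.\<close>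
  define q where "q = (\<lambda>s \<sigma> \<tau>. \<zeta> s \<tau> + \<zeta>1 s \<tau> * (x \<sigma> \<tau> - x s \<tau>))"
  have q: "q s \<in> incr T" if "s \<in> {0..T}" for s
    unfolding q_def
    by (rule field_add[OF field_t[OF zi(1) that] field_mult[OF field_t[OF zi(2) that] field_diff[OF xi field_t[OF xi that]]]])
  have qf: "(\<lambda>\<sigma> (\<tau>::real). q s \<sigma> t) \<in> incr T" if "s \<in> {0..T}" "t \<in> {0..T}" for s t
    by (rule field_s[OF q[OF that(1)] that(2)])
  define Y where "Y = (\<lambda>s t. iint (fst s) (snd s) (fst t) (snd t) (\<lambda>\<sigma> \<tau>. q (fst s) \<sigma> \<tau> * W \<sigma> \<tau>))"
  define Z where "Z = (\<lambda>s t. iint (fst s) (snd s) (fst t) (snd t) (\<lambda>\<sigma> \<tau>. \<zeta> \<sigma> \<tau> * W \<sigma> \<tau>))"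
  have germ: "germ k (smooth_sheet T x) \<zeta> \<zeta>1 (s1, s2) (t1, t2)
      = iint s1 s2 t1 t2 (\<lambda>\<sigma> \<tau>. q s1 \<sigma> t1 * W \<sigma> \<tau>)"
    if s: "(s1, s2) \<in> ordered_tuples T" and t: "(t1, t2) \<in> ordered_tuples T" for s1 s2 t1 t2
  proof -
    have i: "s1 \<in> {0..T}" "t1 \<in> {0..T}" using s t by (auto simp: ordered_tuples_iff)
    let ?c = "\<lambda>\<sigma> \<tau>. (x \<sigma> t1 - x s1 t1) * W \<sigma> \<tau>"
    have ci: "?c \<in> incr T" by (rule field_mult[OF field_diff[OF field_s[OF xi i(2)] field_const] W])
    have "iint s1 s2 t1 t2 (\<lambda>\<sigma> \<tau>. q s1 \<sigma> t1 * W \<sigma> \<tau>)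
        = iint s1 s2 t1 t2 (\<lambda>\<sigma> \<tau>. \<zeta> s1 t1 * W \<sigma> \<tau> + \<zeta>1 s1 t1 * ?c \<sigma> \<tau>)"
      by (simp add: q_def algebra_simps)
    also have "\<dots> = iint s1 s2 t1 t2 (\<lambda>\<sigma> \<tau>. \<zeta> s1 t1 * W \<sigma> \<tau>) + iint s1 s2 t1 t2 (\<lambda>\<sigma> \<tau>. \<zeta>1 s1 t1 * ?c \<sigma> \<tau>)"
      by (rule iint_add[OF s t field_mult[OF field_const W] field_mult[OF field_const ci]])
    also have "\<dots> = germ k (smooth_sheet T x) \<zeta> \<zeta>1 (s1, s2) (t1, t2)"
      unfolding iint_cmult germ_def using smooth_sheet_i_j[OF T y s t, of k]
      by (simp add: W_def smooth_sheet_def \<delta>1_eq)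
    finally show ?thesis by simp
  qed
  have "sew2d T (germ k (smooth_sheet T x) \<zeta> \<zeta>1) (s1, s2) (t1, t2) = Z (s1, s2) (t1, t2)"
  proof (rule sew2d_unique[of Y, OF _ _ _ _ _ _ s t])
    fix s :: "real \<times> real" and t1 t2 t3 :: real
    assume s: "s \<in> ordered_tuples T" and t: "0 \<le> t1" "t1 \<le> t2" "t2 \<le> t3" "t3 \<le> T"
    have "fst s \<in> {0..T}" using pair_ordered[OF s] by auto
    then show "Y s (t1, t3) = Y s (t1, t2) + Y s (t2, t3)"
      unfolding Y_def fst_conv snd_conv using s t
      by (intro iint_split_t[of _ _ T] field_mult q W) (auto simp: ordered_tuples_iff)
  next
    fix t :: "real \<times> real" and s1 s2 s3 :: real
    assume t: "t \<in> ordered_tuples T" and s: "0 \<le> s1" "s1 \<le> s2" "s2 \<le> s3" "s3 \<le> T"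
    show "Z (s1, s3) t = Z (s1, s2) t + Z (s2, s3) t"
      unfolding Z_def fst_conv snd_conv using s t
      by (intro iint_split_s[of _ _ T] field_mult zi W) (auto simp: ordered_tuples_iff)
  next
    fix s t :: "real \<times> real" assume st: "s \<in> ordered_tuples T" "t \<in> ordered_tuples T"
    obtain s1 s2 t1 t2 where e: "s = (s1, s2)" "t = (t1, t2)" by (cases s; cases t)
    have i: "s1 \<in> {0..T}" "t1 \<in> {0..T}" and le: "0 \<le> s2 - s1" "s2 - s1 \<le> T" "0 \<le> t2 - t1"
      using st by (auto simp: e ordered_tuples_iff)
    let ?U = "(t2 - t1) powr \<gamma>2"
    have "Y s t - germ k (smooth_sheet T x) \<zeta> \<zeta>1 s t
        = iint s1 s2 t1 t2 (\<lambda>\<sigma> \<tau>. q s1 \<sigma> \<tau> * W \<sigma> \<tau> - q s1 \<sigma> t1 * W \<sigma> \<tau>)"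
      using iint_diff[OF st[unfolded e] field_mult[OF q[OF i(1)] W] field_mult[OF qf[OF i] W]]
      by (simp add: e germ[OF st[unfolded e]] Y_def)
    also have "\<dots> = iint s1 s2 t1 t2 (\<lambda>\<sigma> \<tau>. (q s1 \<sigma> \<tau> - q s1 \<sigma> t1) * W \<sigma> \<tau>)"
      by (simp add: algebra_simps)
    finally have eq: "Y s t - germ k (smooth_sheet T x) \<zeta> \<zeta>1 s t
        = iint s1 s2 t1 t2 (\<lambda>\<sigma> \<tau>. (q s1 \<sigma> \<tau> - q s1 \<sigma> t1) * W \<sigma> \<tau>)" .
    define L where "L = M1 + M2 * (M0 * T powr \<gamma>1) + M2 * (M0 * T powr \<gamma>1)"
    have L: "0 \<le> L" using M0 M1 M2 by (simp add: L_def)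
    have bq: "\<bar>q s1 \<sigma> \<tau> - q s1 \<sigma> t1\<bar> \<le> L * ?U" if r: "s1 \<le> \<sigma>" "\<sigma> \<le> s2" "t1 \<le> \<tau>" "\<tau> \<le> t2" for \<sigma> \<tau>
    proof -
      have o: "(s1, \<sigma>) \<in> ordered_tuples T" "(t1, \<tau>) \<in> ordered_tuples T" "\<tau> \<in> {0..T}"
        using st r by (auto simp: e ordered_tuples_iff)
      have U: "(\<tau> - t1) powr \<gamma>2 \<le> ?U" and S: "(\<sigma> - s1) powr \<gamma>1 \<le> T powr \<gamma>1"
        using r le \<gamma> by (auto intro!: powr_mono2)
      have "q s1 \<sigma> \<tau> - q s1 \<sigma> t1 = \<delta>2 \<zeta> s1 (t1, \<tau>) + \<zeta>1 s1 \<tau> * \<delta> x (s1, \<sigma>) (t1, \<tau>)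
          + \<delta>2 \<zeta>1 s1 (t1, \<tau>) * \<delta>1 x (s1, \<sigma>) t1"
        by (simp add: q_def \<delta>_eq \<delta>1_eq \<delta>2_eq algebra_simps)
      moreover have "\<bar>\<delta>2 \<zeta> s1 (t1, \<tau>)\<bar> \<le> M1 * ?U"
        using M1(5)[OF i(1) o(2)] mult_left_mono[OF U M1(1)] by (simp add: width_simps)
      moreover have "\<bar>\<zeta>1 s1 \<tau> * \<delta> x (s1, \<sigma>) (t1, \<tau>)\<bar> \<le> M2 * (M0 * T powr \<gamma>1 * ?U)"
      proof (intro abs_mult_le M2(2) i o)
        have "M0 * (\<sigma> - s1) powr \<gamma>1 * (\<tau> - t1) powr \<gamma>2 \<le> M0 * T powr \<gamma>1 * ?U"
          using U S M0(1) by (intro mult_mono) auto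
        then show "\<bar>\<delta> x (s1, \<sigma>) (t1, \<tau>)\<bar> \<le> M0 * T powr \<gamma>1 * ?U"
          using M0(3)[OF o(1,2)] by (simp add: width_simps)
      qed
      moreover have "\<bar>\<delta>2 \<zeta>1 s1 (t1, \<tau>) * \<delta>1 x (s1, \<sigma>) t1\<bar> \<le> M2 * ?U * (M0 * T powr \<gamma>1)"
      proof (intro abs_mult_le)
        show "\<bar>\<delta>2 \<zeta>1 s1 (t1, \<tau>)\<bar> \<le> M2 * ?U"
          using M2(5)[OF i(1) o(2)] mult_left_mono[OF U M2(1)] by (simp add: width_simps)
        show "\<bar>\<delta>1 x (s1, \<sigma>) t1\<bar> \<le> M0 * T powr \<gamma>1"
          using M0(4)[OF o(1) i(2)] mult_left_mono[OF S M0(1)] by (simp add: width_simps)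
      qed
      ultimately have "\<bar>q s1 \<sigma> \<tau> - q s1 \<sigma> t1\<bar> \<le> M1 * ?U + M2 * (M0 * T powr \<gamma>1 * ?U) + M2 * ?U * (M0 * T powr \<gamma>1)"
        by linarith
      then show ?thesis by (simp add: L_def algebra_simps)
    qed
    have "\<bar>iint s1 s2 t1 t2 (\<lambda>\<sigma> \<tau>. (q s1 \<sigma> \<tau> - q s1 \<sigma> t1) * W \<sigma> \<tau>)\<bar> \<le> L * ?U * MW * (s2 - s1) * (t2 - t1)"
      using st by (intro iint_bound[OF st[unfolded e] field_mult[OF field_diff[OF q[OF i(1)] qf[OF i]] W]]
          abs_mult_le bq MW(2)) (auto simp: e ordered_tuples_iff)
    also have "\<dots> \<le> L * ?U * MW * T * (t2 - t1)"
      using L MW le by (intro mult_right_mono mult_left_mono) auto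
    also have "\<dots> = L * MW * T * (t2 - t1) powr (\<gamma>2 + 1)"
      using le by (simp add: powr_add mult_ac)
    finally show "\<bar>Y s t - germ k (smooth_sheet T x) \<zeta> \<zeta>1 s t\<bar>
        \<le> (M1 + M2 * (M0 * T powr \<gamma>1) + M2 * (M0 * T powr \<gamma>1)) * MW * T * width t powr (\<gamma>2 + 1)"
      unfolding eq by (simp add: L_def e width_simps)
  next
    fix s t :: "real \<times> real" assume st: "s \<in> ordered_tuples T" "t \<in> ordered_tuples T"
    obtain s1 s2 t1 t2 where e: "s = (s1, s2)" "t = (t1, t2)" by (cases s; cases t)
    have i: "s1 \<in> {0..T}" and le: "0 \<le> s2 - s1" "t2 - t1 \<le> T" "0 \<le> t2 - t1"
      using st by (auto simp: e ordered_tuples_iff)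
    have "Z s t - Y s t = iint s1 s2 t1 t2 (\<lambda>\<sigma> \<tau>. \<zeta> \<sigma> \<tau> * W \<sigma> \<tau> - q s1 \<sigma> \<tau> * W \<sigma> \<tau>)"
      using iint_diff[OF st[unfolded e] field_mult[OF zi(1) W] field_mult[OF q[OF i] W]]
      by (simp add: e Y_def Z_def)
    also have "\<dots> = iint s1 s2 t1 t2 (\<lambda>\<sigma> \<tau>. (\<zeta> \<sigma> \<tau> - q s1 \<sigma> \<tau>) * W \<sigma> \<tau>)"
      by (simp add: algebra_simps)
    finally have eq: "Z s t - Y s t = iint s1 s2 t1 t2 (\<lambda>\<sigma> \<tau>. (\<zeta> \<sigma> \<tau> - q s1 \<sigma> \<tau>) * W \<sigma> \<tau>)" .
    have bq: "\<bar>\<zeta> \<sigma> \<tau> - q s1 \<sigma> \<tau>\<bar> \<le> M3 * (s2 - s1) powr (2*\<gamma>1)"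
      if rr: "s1 \<le> \<sigma>" "\<sigma> \<le> s2" "t1 \<le> \<tau>" "\<tau> \<le> t2" for \<sigma> \<tau>
    proof -
      have o: "(s1, \<sigma>) \<in> ordered_tuples T" "\<tau> \<in> {0..T}"
        using st rr by (auto simp: e ordered_tuples_iff)
      have "\<delta>1 \<zeta> (s1, \<sigma>) \<tau> = \<zeta>1 s1 \<tau> * \<delta>1 x (s1, \<sigma>) \<tau> + r (s1, \<sigma>) \<tau>"
        using c o unfolding controlled_def by blast
      then have "\<zeta> \<sigma> \<tau> - q s1 \<sigma> \<tau> = r (s1, \<sigma>) \<tau>" by (simp add: q_def \<delta>1_eq algebra_simps)
      moreover have "M3 * (\<sigma> - s1) powr (2*\<gamma>1) \<le> M3 * (s2 - s1) powr (2*\<gamma>1)"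
        using rr M3(1) \<gamma> by (intro mult_left_mono powr_mono2) auto
      ultimately show ?thesis using M3(2)[OF o] by (simp add: width_simps)
    qed
    have "\<bar>iint s1 s2 t1 t2 (\<lambda>\<sigma> \<tau>. (\<zeta> \<sigma> \<tau> - q s1 \<sigma> \<tau>) * W \<sigma> \<tau>)\<bar>
        \<le> M3 * (s2 - s1) powr (2*\<gamma>1) * MW * (s2 - s1) * (t2 - t1)"
      using st by (intro iint_bound[OF st[unfolded e] field_mult[OF field_diff[OF zi(1) q[OF i]] W]]
          abs_mult_le bq MW(2)) (auto simp: e ordered_tuples_iff)
    also have "\<dots> \<le> M3 * (s2 - s1) powr (2*\<gamma>1) * MW * (s2 - s1) * T"
      using M3 MW le by (intro mult_left_mono mult_nonneg_nonneg) auto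
    also have "\<dots> = M3 * MW * T * (s2 - s1) powr (2*\<gamma>1 + 1)"
      using le by (simp add: powr_add mult_ac)
    finally show "\<bar>Z s t - Y s t\<bar> \<le> M3 * MW * T * width s powr (2*\<gamma>1 + 1)"
      unfolding eq by (simp add: e width_simps)
  qed (use \<gamma> in auto)
  then show ?thesis by (simp add: rough_integral_def Z_def W_def)
qed

section \<open>The integral of a controlled field\<close>

theorem theorem4p11:
  fixes T \<gamma>1 \<gamma>2 :: real and x :: "real \<Rightarrow> real \<Rightarrow> real"
  assumes "T > 0"
    and "1/3 < \<gamma>1" and "\<gamma>1 < 1/2" and "\<gamma>2 > 1/2"
    and "x \<in> holder_field T \<gamma>1 \<gamma>2"
  shows
   "(\<forall>X \<zeta> \<zeta>1 r. geometric_rough_sheet T \<gamma>1 \<gamma>2 x X \<longrightarrow> controlled T \<gamma>1 \<gamma>2 x \<zeta> \<zeta>1 r \<longrightarrow>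
       (\<forall>k. sew2d_well_defined T (germ k X \<zeta> \<zeta>1) \<and>
            rough_integral T k X \<zeta> \<zeta>1 \<in> holder T \<gamma>1 \<gamma>2))
    \<and>
    (smooth T x \<longrightarrow>
       geometric_rough_sheet T \<gamma>1 \<gamma>2 x (smooth_sheet T x) \<and>
       (\<forall>\<zeta> \<zeta>1 r. controlled T \<gamma>1 \<gamma>2 x \<zeta> \<zeta>1 r \<longrightarrow>
          (\<forall>s1 s2 t1 t2. (s1, s2) \<in> ordered_tuples T \<longrightarrow> (t1, t2) \<in> ordered_tuples T \<longrightarrow>
             rough_integral T Plain (smooth_sheet T x) \<zeta> \<zeta>1 (s1, s2) (t1, t2)
               = iint s1 s2 t1 t2 (\<lambda>\<sigma> \<tau>. \<zeta> \<sigma> \<tau> * pd12 T x \<sigma> \<tau>) \<and>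
             rough_integral T Hat (smooth_sheet T x) \<zeta> \<zeta>1 (s1, s2) (t1, t2)
               = iint s1 s2 t1 t2 (\<lambda>\<sigma> \<tau>. \<zeta> \<sigma> \<tau> * pd1 T x \<sigma> \<tau> * pd2 T x \<sigma> \<tau>))))
    \<and>
    (\<forall>X \<zeta> \<zeta>1 r. geometric_rough_sheet T \<gamma>1 \<gamma>2 x X \<longrightarrow> controlled T \<gamma>1 \<gamma>2 x \<zeta> \<zeta>1 r \<longrightarrow>
       (\<forall>s1 s2 t1 t2 (\<pi>1 :: nat \<Rightarrow> real list) (\<pi>2 :: nat \<Rightarrow> real list).
          0 \<le> s1 \<and> s1 < s2 \<and> s2 \<le> T \<and> 0 \<le> t1 \<and> t1 < t2 \<and> t2 \<le> T \<longrightarrow>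
          (\<forall>n. is_partition s1 s2 (\<pi>1 n)) \<and> (\<forall>n. is_partition t1 t2 (\<pi>2 n)) \<longrightarrow>
          (\<lambda>n. mesh (\<pi>1 n)) \<longlonglongrightarrow> 0 \<and> (\<lambda>n. mesh (\<pi>2 n)) \<longlonglongrightarrow> 0 \<longrightarrow>
          (\<forall>k. (\<lambda>n. \<Sum>i<length (\<pi>1 n) - 1. \<Sum>j<length (\<pi>2 n) - 1.
                  germ k X \<zeta> \<zeta>1 (\<pi>1 n ! i, \<pi>1 n ! Suc i) (\<pi>2 n ! j, \<pi>2 n ! Suc j))
               \<longlonglongrightarrow> rough_integral T k X \<zeta> \<zeta>1 (s1, s2) (t1, t2))))"
proof (intro conjI allI impI)
  fix X \<zeta> \<zeta>1 r k
  assume "geometric_rough_sheet T \<gamma>1 \<gamma>2 x X" "controlled T \<gamma>1 \<gamma>2 x \<zeta> \<zeta>1 r"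
  then obtain C where *: "germ2d T \<gamma>1 \<gamma>2 (3*\<gamma>1) (2*\<gamma>2) C (germ k X \<zeta> \<zeta>1)"
    using controlled_germ2d[OF assms(1,2,4)] by blast
  show "sew2d_well_defined T (germ k X \<zeta> \<zeta>1)" by (rule germ2d.well_defined[OF *])
  show "rough_integral T k X \<zeta> \<zeta>1 \<in> holder T \<gamma>1 \<gamma>2"
    unfolding rough_integral_def by (rule germ2d.sew2d_holder[OF *])
next
  assume "smooth T x"
  then show "geometric_rough_sheet T \<gamma>1 \<gamma>2 x (smooth_sheet T x)"
    using assms by (intro smooth_geometric_rough_sheet) auto
next
  fix \<zeta> \<zeta>1 :: "real \<Rightarrow> real \<Rightarrow> real" and r and s1 s2 t1 t2 :: real
  assume "smooth T x" "controlled T \<gamma>1 \<gamma>2 x \<zeta> \<zeta>1 r"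
    "(s1, s2) \<in> ordered_tuples T" "(t1, t2) \<in> ordered_tuples T"
  note * = smooth_rough_integral[OF assms this]
  show "rough_integral T Plain (smooth_sheet T x) \<zeta> \<zeta>1 (s1, s2) (t1, t2)
      = iint s1 s2 t1 t2 (\<lambda>\<sigma> \<tau>. \<zeta> \<sigma> \<tau> * pd12 T x \<sigma> \<tau>)"
    using *[of Plain] by simp
  show "rough_integral T Hat (smooth_sheet T x) \<zeta> \<zeta>1 (s1, s2) (t1, t2)
      = iint s1 s2 t1 t2 (\<lambda>\<sigma> \<tau>. \<zeta> \<sigma> \<tau> * pd1 T x \<sigma> \<tau> * pd2 T x \<sigma> \<tau>)"
    using *[of Hat] by (simp add: mult.assoc)
next
  fix X \<zeta> \<zeta>1 r s1 s2 t1 t2 k and \<pi>1 \<pi>2 :: "nat \<Rightarrow> real list"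
  assume X: "geometric_rough_sheet T \<gamma>1 \<gamma>2 x X" "controlled T \<gamma>1 \<gamma>2 x \<zeta> \<zeta>1 r"
    and st: "0 \<le> s1 \<and> s1 < s2 \<and> s2 \<le> T \<and> 0 \<le> t1 \<and> t1 < t2 \<and> t2 \<le> T"
    and \<pi>: "(\<forall>n. is_partition s1 s2 (\<pi>1 n)) \<and> (\<forall>n. is_partition t1 t2 (\<pi>2 n))"
    and mesh: "(\<lambda>n. mesh (\<pi>1 n)) \<longlonglongrightarrow> 0 \<and> (\<lambda>n. mesh (\<pi>2 n)) \<longlonglongrightarrow> 0"
  obtain C where "germ2d T \<gamma>1 \<gamma>2 (3*\<gamma>1) (2*\<gamma>2) C (germ k X \<zeta> \<zeta>1)"
    using controlled_germ2d[OF assms(1,2,4) X] by blast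
  then show "(\<lambda>n. \<Sum>i<length (\<pi>1 n) - 1. \<Sum>j<length (\<pi>2 n) - 1.
      germ k X \<zeta> \<zeta>1 (\<pi>1 n ! i, \<pi>1 n ! Suc i) (\<pi>2 n ! j, \<pi>2 n ! Suc j))
      \<longlonglongrightarrow> rough_integral T k X \<zeta> \<zeta>1 (s1, s2) (t1, t2)"
    unfolding rough_integral_def by (rule germ2d.riemann_sums_tendsto) (use st \<pi> mesh in auto)
qed

end
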